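(* Let $\Bbbk$ be an algebraically closed field. Let $(A,\mathfrak m)$ and $(B,\mathfrak n)$ be two commutative Noetherian local algebras over $\Bbbk$ such that $A\otimes_\Bbbk B$ is Noetherian. Assume that $\Bbbk$ is the common residue field of both $A$ and $B$, and that either $A$ or $B$ is algebraic over $\Bbbk$. Let $L$ and $N$ be nonzero finitely generated modules over $A$ and $B$, respectively. Then the following conditions are equivalent: (a) $L\otimes_\Bbbk N$ is a sequentially Cohen--Macaulay $A\otimes_\Bbbk B$-module; (b) $L$ and $N$ are sequentially Cohen--Macaulay over $A$ and $B$, respectively.
   Context: Under these hypotheses $A\otimes_\Bbbk B$ is a local ring with unique maximal ideal $\mathfrak m\otimes_\Bbbk B+A\otimes_\Bbbk\mathfrak n$. A finitely generated module $M$ over a Noetherian local ring is sequentially Cohen--Macaulay if there is a finite filtration $0=M_0\subsetneq M_1\subsetneq\dots\subsetneq M_r=M$ by submodules such that each $M_i/M_{i-1}$ is Cohen--Macaulay and $\dim(M_1/M_0)<\dim(M_2/M_1)<\dots<\dim(M_r/M_{r-1})$. *)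

theory Defs
  imports
    "HOL-Algebra.Module"
    "HOL-Algebra.Free_Abelian_Groups"
    "HOL-Algebra.Algebraic_Closure"
    "HOL-Library.Extended_Nat"
begin

section \<open>Local algebras\<close>

definition local_ring :: "('a, 'r) ring_scheme \<Rightarrow> 'a set \<Rightarrow> bool" where
  "local_ring R \<mm> \<longleftrightarrow> cring R \<and> maximalideal \<mm> R \<and> (\<forall>I. maximalideal I R \<longrightarrow> I = \<mm>)"

definition structure_map :: "('k, 'a, 'r) module_scheme \<Rightarrow> 'k \<Rightarrow> 'a" where
  "structure_map A c = c \<odot>\<^bsub>A\<^esub> \<one>\<^bsub>A\<^esub>"

text \<open>The residue field being \<open>k\<close> means that the canonical map from \<open>k\<close> to the residue field
  is an isomorphism, not merely that the two fields are abstractly isomorphic.\<close>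

definition residue_field_is ::
    "('k, 's) ring_scheme \<Rightarrow> ('k, 'a, 'r) module_scheme \<Rightarrow> 'a set \<Rightarrow> bool" where
  "residue_field_is k A \<mm> \<longleftrightarrow> (\<lambda>c. \<mm> +>\<^bsub>A\<^esub> structure_map A c) \<in> ring_iso k (A Quot \<mm>)"

definition algebraic_algebra ::
    "('k, 's) ring_scheme \<Rightarrow> ('k, 'a, 'r) module_scheme \<Rightarrow> bool" where
  "algebraic_algebra k A \<longleftrightarrow>
     (\<forall>x \<in> carrier A. (ring.algebraic A over (structure_map A ` carrier k)) x)"

section \<open>Submodules and quotient modules\<close>

definition module_span ::
    "('a, 'r) ring_scheme \<Rightarrow> ('a, 'm, 's) module_scheme \<Rightarrow> 'm set \<Rightarrow> 'm set" where
  "module_span R M S = \<Inter> {N. submodule N R M \<and> S \<subseteq> N}"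

definition fin_gen_module ::
    "('a, 'r) ring_scheme \<Rightarrow> ('a, 'm, 's) module_scheme \<Rightarrow> bool" where
  "fin_gen_module R M \<longleftrightarrow> module R M \<and>
     (\<exists>S. finite S \<and> S \<subseteq> carrier M \<and> module_span R M S = carrier M)"

text \<open>The record type of modules extends that of rings, so the (irrelevant) multiplicative fields
  of a module that is not an algebra are left unspecified, here and below.\<close>

definition quotient_module ::
    "('a, 'm, 's) module_scheme \<Rightarrow> 'm set \<Rightarrow> ('a, 'm set) module" where
  "quotient_module M N =
     \<lparr>carrier = a_rcosets\<^bsub>M\<^esub> N, monoid.mult = undefined, one = undefined,
      zero = N, add = set_add M, smult = (\<lambda>r U. \<Union>x\<in>U. N +>\<^bsub>M\<^esub> (r \<odot>\<^bsub>M\<^esub> x))\<rparr>"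

section \<open>Dimension, depth and Cohen--Macaulay modules\<close>

definition module_annihilator ::
    "('a, 'r) ring_scheme \<Rightarrow> ('a, 'm, 's) module_scheme \<Rightarrow> 'a set" where
  "module_annihilator R M = {r \<in> carrier R. \<forall>x \<in> carrier M. r \<odot>\<^bsub>M\<^esub> x = \<zero>\<^bsub>M\<^esub>}"

text \<open>The Krull dimension of \<open>R / Ann M\<close>, as the supremum of the lengths of chains of primes of \<open>R\<close>
  containing \<open>Ann M\<close>.  For the zero module this yields the value \<open>0\<close>; in the definition of
  sequentially Cohen--Macaulay modules only nonzero modules occur as arguments.\<close>

definition module_dim ::
    "('a, 'r) ring_scheme \<Rightarrow> ('a, 'm, 's) module_scheme \<Rightarrow> enat" where
  "module_dim R M = Sup {enat n | n. \<exists>P :: nat \<Rightarrow> 'a set.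
     (\<forall>i\<le>n. primeideal (P i) R \<and> module_annihilator R M \<subseteq> P i) \<and>
     (\<forall>i<n. P i \<subset> P (Suc i))}"

definition seq_multiples ::
    "('a, 'r) ring_scheme \<Rightarrow> ('a, 'm, 's) module_scheme \<Rightarrow> 'a list \<Rightarrow> 'm set" where
  "seq_multiples R M xs = module_span R M {x \<odot>\<^bsub>M\<^esub> z | x z. x \<in> set xs \<and> z \<in> carrier M}"

text \<open>Each \<open>x\<^sub>i\<close> is a nonzerodivisor on \<open>M / (x\<^sub>0, \<dots>, x\<^sub>i\<^sub>-\<^sub>1) M\<close>, and \<open>M \<noteq> (x\<^sub>0, \<dots>, x\<^sub>n\<^sub>-\<^sub>1) M\<close>.\<close>

definition regular_sequence ::
    "('a, 'r) ring_scheme \<Rightarrow> ('a, 'm, 's) module_scheme \<Rightarrow> 'a list \<Rightarrow> bool" where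
  "regular_sequence R M xs \<longleftrightarrow> set xs \<subseteq> carrier R \<and>
     (\<forall>i < length xs. \<forall>z \<in> carrier M.
        (xs ! i) \<odot>\<^bsub>M\<^esub> z \<in> seq_multiples R M (take i xs) \<longrightarrow> z \<in> seq_multiples R M (take i xs)) \<and>
     seq_multiples R M xs \<noteq> carrier M"

definition module_depth ::
    "('a, 'r) ring_scheme \<Rightarrow> 'a set \<Rightarrow> ('a, 'm, 's) module_scheme \<Rightarrow> enat" where
  "module_depth R I M = Sup {enat (length xs) | xs. set xs \<subseteq> I \<and> regular_sequence R M xs}"

definition cohen_macaulay ::
    "('a, 'r) ring_scheme \<Rightarrow> ('a, 'm, 's) module_scheme \<Rightarrow> bool" where
  "cohen_macaulay R M \<longleftrightarrow> noetherian_ring R \<and> fin_gen_module R M \<and>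
     (\<exists>\<mm>. local_ring R \<mm> \<and> module_depth R \<mm> M = module_dim R M)"

definition filtration_factor ::
    "('a, 'm, 's) module_scheme \<Rightarrow> (nat \<Rightarrow> 'm set) \<Rightarrow> nat \<Rightarrow> ('a, 'm set) module" where
  "filtration_factor M F i = quotient_module (M\<lparr>carrier := F (Suc i)\<rparr>) (F i)"

definition sequentially_cohen_macaulay ::
    "('a, 'r) ring_scheme \<Rightarrow> ('a, 'm, 's) module_scheme \<Rightarrow> bool" where
  "sequentially_cohen_macaulay R M \<longleftrightarrow>
     noetherian_ring R \<and> (\<exists>\<mm>. local_ring R \<mm>) \<and> fin_gen_module R M \<and>
     (\<exists>r F. F 0 = {\<zero>\<^bsub>M\<^esub>} \<and> F r = carrier M \<and>
        (\<forall>i\<le>r. submodule (F i) R M) \<and>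
        (\<forall>i<r. F i \<subset> F (Suc i)) \<and>
        (\<forall>i<r. cohen_macaulay R (filtration_factor M F i)) \<and>
        (\<forall>i. Suc i < r \<longrightarrow>
           module_dim R (filtration_factor M F i) < module_dim R (filtration_factor M F (Suc i))))"

section \<open>Tensor products over the base ring\<close>

text \<open>\<open>M \<otimes>\<^sub>k N\<close> is the free abelian group on \<open>M \<times> N\<close> modulo the subgroup generated by the
  bilinearity relations.\<close>

definition tensor_relations ::
    "('k, 's) ring_scheme \<Rightarrow> ('k, 'm, 't) module_scheme \<Rightarrow> ('k, 'n, 'u) module_scheme
       \<Rightarrow> ('m \<times> 'n \<Rightarrow>\<^sub>0 int) set" where
  "tensor_relations k M N =
     {frag_of (x \<oplus>\<^bsub>M\<^esub> x', y) - frag_of (x, y) - frag_of (x', y) | x x' y.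
        x \<in> carrier M \<and> x' \<in> carrier M \<and> y \<in> carrier N} \<union>
     {frag_of (x, y \<oplus>\<^bsub>N\<^esub> y') - frag_of (x, y) - frag_of (x, y') | x y y'.
        x \<in> carrier M \<and> y \<in> carrier N \<and> y' \<in> carrier N} \<union>
     {frag_of (c \<odot>\<^bsub>M\<^esub> x, y) - frag_of (x, c \<odot>\<^bsub>N\<^esub> y) | c x y.
        c \<in> carrier k \<and> x \<in> carrier M \<and> y \<in> carrier N}"

definition tensor_kernel ::
    "('k, 's) ring_scheme \<Rightarrow> ('k, 'm, 't) module_scheme \<Rightarrow> ('k, 'n, 'u) module_scheme
       \<Rightarrow> ('m \<times> 'n \<Rightarrow>\<^sub>0 int) set" where
  "tensor_kernel k M N =
     generate (free_Abelian_group (carrier M \<times> carrier N)) (tensor_relations k M N)"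

definition tensor_group ::
    "('k, 's) ring_scheme \<Rightarrow> ('k, 'm, 't) module_scheme \<Rightarrow> ('k, 'n, 'u) module_scheme
       \<Rightarrow> ('m \<times> 'n \<Rightarrow>\<^sub>0 int) set monoid" where
  "tensor_group k M N =
     free_Abelian_group (carrier M \<times> carrier N) Mod tensor_kernel k M N"

definition tensor_class ::
    "('k, 's) ring_scheme \<Rightarrow> ('k, 'm, 't) module_scheme \<Rightarrow> ('k, 'n, 'u) module_scheme
       \<Rightarrow> ('m \<times> 'n \<Rightarrow>\<^sub>0 int) \<Rightarrow> ('m \<times> 'n \<Rightarrow>\<^sub>0 int) set" where
  "tensor_class k M N c =
     r_coset (free_Abelian_group (carrier M \<times> carrier N)) (tensor_kernel k M N) c"

text \<open>The biadditive extension of \<open>(a, b) \<cdot> (x, y) = (f a x, g b y)\<close> to formal sums.\<close>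

definition frag_act ::
    "('a \<Rightarrow> 'm \<Rightarrow> 'm) \<Rightarrow> ('b \<Rightarrow> 'n \<Rightarrow> 'n)
       \<Rightarrow> ('a \<times> 'b \<Rightarrow>\<^sub>0 int) \<Rightarrow> ('m \<times> 'n \<Rightarrow>\<^sub>0 int) \<Rightarrow> ('m \<times> 'n \<Rightarrow>\<^sub>0 int)" where
  "frag_act f g c d =
     frag_extend (\<lambda>(a, b). frag_extend (\<lambda>(x, y). frag_of (f a x, g b y)) d) c"

definition tensor_algebra ::
    "('k, 's) ring_scheme \<Rightarrow> ('k, 'a, 't) module_scheme \<Rightarrow> ('k, 'b, 'u) module_scheme
       \<Rightarrow> ('k, ('a \<times> 'b \<Rightarrow>\<^sub>0 int) set) module" where
  "tensor_algebra k A B =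
     \<lparr>carrier = carrier (tensor_group k A B),
      monoid.mult = (\<lambda>U V. \<Union>c\<in>U. \<Union>d\<in>V.
        tensor_class k A B (frag_act (monoid.mult A) (monoid.mult B) c d)),
      one = tensor_class k A B (frag_of (\<one>\<^bsub>A\<^esub>, \<one>\<^bsub>B\<^esub>)),
      zero = \<one>\<^bsub>tensor_group k A B\<^esub>,
      add = monoid.mult (tensor_group k A B),
      smult = (\<lambda>r U. \<Union>c\<in>U.
        tensor_class k A B (frag_extend (\<lambda>(a, b). frag_of (r \<odot>\<^bsub>A\<^esub> a, b)) c))\<rparr>"

definition restrict_scalars ::
    "('k, 'a, 't) module_scheme \<Rightarrow> ('a, 'm, 'u) module_scheme \<Rightarrow> ('k, 'm) module" where
  "restrict_scalars A L =
     \<lparr>carrier = carrier L, monoid.mult = undefined, one = undefined,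
      zero = \<zero>\<^bsub>L\<^esub>, add = add L, smult = (\<lambda>c x. structure_map A c \<odot>\<^bsub>L\<^esub> x)\<rparr>"

text \<open>\<open>L \<otimes>\<^sub>k N\<close> as a module over \<open>A \<otimes>\<^sub>k B\<close>, with \<open>(a \<otimes> b) (x \<otimes> y) = a x \<otimes> b y\<close>.\<close>

definition tensor_module ::
    "('k, 's) ring_scheme \<Rightarrow> ('k, 'a, 't) module_scheme \<Rightarrow> ('k, 'b, 'u) module_scheme
       \<Rightarrow> ('a, 'm, 'v) module_scheme \<Rightarrow> ('b, 'n, 'w) module_scheme
       \<Rightarrow> (('a \<times> 'b \<Rightarrow>\<^sub>0 int) set, ('m \<times> 'n \<Rightarrow>\<^sub>0 int) set) module" where
  "tensor_module k A B L N =
     (let L' = restrict_scalars A L; N' = restrict_scalars B N in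
      \<lparr>carrier = carrier (tensor_group k L' N'),
       monoid.mult = undefined, one = undefined,
       zero = \<one>\<^bsub>tensor_group k L' N'\<^esub>,
       add = monoid.mult (tensor_group k L' N'),
       smult = (\<lambda>U V. \<Union>c\<in>U. \<Union>d\<in>V.
         tensor_class k L' N' (frag_act (smult L) (smult N) c d))\<rparr>)"

end

theory Submission
  imports Defs
begin

text \<open>Suppose \<open>A\<close> is algebraic. Its maximal ideal is then nil, so \<open>A\<close> is Artinian with residue field \<open>k\<close>, every
  nonzero finitely generated \<open>A\<close>-module is Cohen--Macaulay of dimension 0, and \<open>L\<close> is a finite-dimensional
  vector space. Hence \<open>L \<otimes> N\<close> is over \<open>B\<close> a finite direct sum of copies of \<open>N\<close>, and \<open>A \<otimes> B\<close> is \<open>B\<close>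
  up to nilpotents, so dimension and depth over \<open>A \<otimes> B\<close> and over \<open>B\<close> agree. The filtration of a
  sequentially Cohen--Macaulay module consists of the sets of elements \<open>x\<close> whose cyclic module has bounded
  dimension. It is therefore stable under all \<open>B\<close>-linear endomorphisms, which makes filtrations of
  \<open>L \<otimes> N\<close> and of \<open>N\<close> correspond to each other.\<close>

section \<open>Noetherian modules\<close>

text \<open>Three obstacles shape the proof. Filtrations and regular sequences involve iterated
  quotients, and every quotient changes the HOL type; hence depth, annihilator and dimension of
  \<open>F / K\<close> are expressed inside the ambient module by pairs of submodules
  \<open>K \<subseteq> F\<close>, and cosets are treated once. Next, an element \<open>s\<close> of
  \<open>A \<otimes> B\<close> does not act on \<open>L \<otimes> N\<close> like its image in
  \<open>B\<close>: the nilpotent difference acts too and may mix the copies of \<open>N\<close>.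
  What survives is that \<open>s\<close> and its image, put back into \<open>A \<otimes> B\<close>,
  have powers that are multiples of each other. So only notions depending on radicals are compared:
  primes, dimension and, thanks to Nakayama's lemma, regularity of sequences in the maximal ideal.
  Finally, a submodule of a sum of copies of \<open>N\<close> need not be a sum of copies of one
  submodule. For the filtration it is, because its members are recognised by the primes above
  annihilators, and moving an element between copies only enlarges its annihilator up to radical. If
  \<open>B\<close> is the algebraic factor, the factors are exchanged in a description of the tensor
  product that is symmetric from the start.\<close>

lemma set_add_iff: "x \<in> H <+>\<^bsub>G\<^esub> K \<longleftrightarrow> (\<exists>h\<in>H. \<exists>k\<in>K. x = h \<oplus>\<^bsub>G\<^esub> k)"
  by (auto simp: set_add_def set_mult_def)

context module
begin

lemma submodule_subset: "submodule H R M \<Longrightarrow> x \<in> H \<Longrightarrow> x \<in> carrier M"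
  using submoduleE(1) by blast

lemma submodule_zero: "submodule H R M \<Longrightarrow> \<zero>\<^bsub>M\<^esub> \<in> H"
  using submoduleE(1,2,4)[of H] smult_l_null by (metis R.zero_closed all_not_in_conv subsetD)

lemma submodule_minus: "submodule H R M \<Longrightarrow> x \<in> H \<Longrightarrow> y \<in> H \<Longrightarrow> x \<ominus>\<^bsub>M\<^esub> y \<in> H"
  unfolding a_minus_def using submoduleE(3,5) by blast

lemma submodule_add_cancel:
  assumes "submodule H R M" "x \<in> H" "y \<in> carrier M" "x \<oplus>\<^bsub>M\<^esub> y \<in> H"
  shows "y \<in> H"
proof -
  have "y = (\<ominus>\<^bsub>M\<^esub> x) \<oplus>\<^bsub>M\<^esub> (x \<oplus>\<^bsub>M\<^esub> y)"
    using assms submodule_subset[OF assms(1)] by (simp add: M.r_neg1)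
  then show ?thesis using assms submoduleE(3,5) by metis
qed

lemma submodule_zero_singleton: "submodule {\<zero>\<^bsub>M\<^esub>} R M"
  by (rule submoduleI) auto

lemma submodule_Int: "submodule H R M \<Longrightarrow> submodule K R M \<Longrightarrow> submodule (H \<inter> K) R M"
  by (rule submoduleI) (auto intro: submoduleE submodule_zero submodule_subset)

lemma submodule_add_sets:
  assumes H: "submodule H R M" and K: "submodule K R M"
  shows "submodule (H <+>\<^bsub>M\<^esub> K) R M"
proof (rule submoduleI)
  note sub = submodule_subset[OF H] submodule_subset[OF K]
  show "H <+>\<^bsub>M\<^esub> K \<subseteq> carrier M" using sub by (auto simp: set_add_iff)
  show "\<zero>\<^bsub>M\<^esub> \<in> H <+>\<^bsub>M\<^esub> K"
    unfolding set_add_iff using submodule_zero[OF H] submodule_zero[OF K]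
    by (metis M.l_zero M.zero_closed)
  show "\<ominus>\<^bsub>M\<^esub> a \<in> H <+>\<^bsub>M\<^esub> K" if "a \<in> H <+>\<^bsub>M\<^esub> K" for a
    using that unfolding set_add_iff
    by (metis M.minus_add sub submoduleE(3)[OF H] submoduleE(3)[OF K])
  show "a \<oplus>\<^bsub>M\<^esub> b \<in> H <+>\<^bsub>M\<^esub> K" if ab: "a \<in> H <+>\<^bsub>M\<^esub> K" "b \<in> H <+>\<^bsub>M\<^esub> K" for a b
  proof -
    obtain h k h' k' where e: "h \<in> H" "k \<in> K" "h' \<in> H" "k' \<in> K"
      "a = h \<oplus>\<^bsub>M\<^esub> k" "b = h' \<oplus>\<^bsub>M\<^esub> k'" using ab unfolding set_add_iff by blast
    then have "a \<oplus>\<^bsub>M\<^esub> b = (h \<oplus>\<^bsub>M\<^esub> h') \<oplus>\<^bsub>M\<^esub> (k \<oplus>\<^bsub>M\<^esub> k')"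
      using sub by (simp add: M.add.m_ac)
    then show ?thesis using e submoduleE(5)[OF H] submoduleE(5)[OF K] unfolding set_add_iff by blast
  qed
  show "a \<odot>\<^bsub>M\<^esub> x \<in> H <+>\<^bsub>M\<^esub> K" if "a \<in> carrier R" "x \<in> H <+>\<^bsub>M\<^esub> K" for a x
    using that unfolding set_add_iff
    by (metis smult_r_distr sub submoduleE(4)[OF H] submoduleE(4)[OF K])
qed

lemma submodule_smult_image:
  assumes H: "submodule H R M" and a: "a \<in> carrier R"
  shows "submodule ((\<lambda>x. a \<odot>\<^bsub>M\<^esub> x) ` H) R M"
proof (rule submoduleI)
  note sub = submodule_subset[OF H]
  show "(\<lambda>x. a \<odot>\<^bsub>M\<^esub> x) ` H \<subseteq> carrier M" using sub a by auto
  show "\<zero>\<^bsub>M\<^esub> \<in> (\<lambda>x. a \<odot>\<^bsub>M\<^esub> x) ` H"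
    using submodule_zero[OF H] a by (metis imageI smult_r_null)
  show "\<ominus>\<^bsub>M\<^esub> y \<in> (\<lambda>x. a \<odot>\<^bsub>M\<^esub> x) ` H" if "y \<in> (\<lambda>x. a \<odot>\<^bsub>M\<^esub> x) ` H" for y
    using that submoduleE(3)[OF H] a sub by (auto simp: smult_r_minus[symmetric])
  show "y \<oplus>\<^bsub>M\<^esub> z \<in> (\<lambda>x. a \<odot>\<^bsub>M\<^esub> x) ` H"
    if "y \<in> (\<lambda>x. a \<odot>\<^bsub>M\<^esub> x) ` H" "z \<in> (\<lambda>x. a \<odot>\<^bsub>M\<^esub> x) ` H" for y z
    using that submoduleE(5)[OF H] a sub by (auto simp: smult_r_distr[symmetric])
  show "r \<odot>\<^bsub>M\<^esub> y \<in> (\<lambda>x. a \<odot>\<^bsub>M\<^esub> x) ` H"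
    if r: "r \<in> carrier R" and y: "y \<in> (\<lambda>x. a \<odot>\<^bsub>M\<^esub> x) ` H" for r y
  proof -
    obtain x where "x \<in> H" "y = a \<odot>\<^bsub>M\<^esub> x" using y by blast
    then have "r \<odot>\<^bsub>M\<^esub> y = a \<odot>\<^bsub>M\<^esub> (r \<odot>\<^bsub>M\<^esub> x)"
      using r a sub by (metis R.m_comm smult_assoc1)
    then show ?thesis using submoduleE(4)[OF H] r \<open>x \<in> H\<close> by blast
  qed
qed

lemma submodule_cyclic:
  assumes x: "x \<in> carrier M"
  shows "submodule ((\<lambda>r. r \<odot>\<^bsub>M\<^esub> x) ` carrier R) R M"
proof (rule submoduleI)
  show "(\<lambda>r. r \<odot>\<^bsub>M\<^esub> x) ` carrier R \<subseteq> carrier M" using x by auto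
  show "\<zero>\<^bsub>M\<^esub> \<in> (\<lambda>r. r \<odot>\<^bsub>M\<^esub> x) ` carrier R"
    using x by (metis R.zero_closed imageI smult_l_null)
  show "\<ominus>\<^bsub>M\<^esub> y \<in> (\<lambda>r. r \<odot>\<^bsub>M\<^esub> x) ` carrier R" if "y \<in> (\<lambda>r. r \<odot>\<^bsub>M\<^esub> x) ` carrier R" for y
    using that x by (auto simp: smult_l_minus[symmetric])
  show "y \<oplus>\<^bsub>M\<^esub> z \<in> (\<lambda>r. r \<odot>\<^bsub>M\<^esub> x) ` carrier R"
    if "y \<in> (\<lambda>r. r \<odot>\<^bsub>M\<^esub> x) ` carrier R" "z \<in> (\<lambda>r. r \<odot>\<^bsub>M\<^esub> x) ` carrier R" for y z
    using that x by (auto simp: smult_l_distr[symmetric])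
  show "r \<odot>\<^bsub>M\<^esub> y \<in> (\<lambda>r. r \<odot>\<^bsub>M\<^esub> x) ` carrier R"
    if "r \<in> carrier R" "y \<in> (\<lambda>r. r \<odot>\<^bsub>M\<^esub> x) ` carrier R" for r y
    using that x by (auto simp: smult_assoc1[symmetric])
qed

lemma submodule_span:
  assumes "S \<subseteq> carrier M"
  shows "submodule (module_span R M S) R M"
proof (rule submoduleI)
  show "module_span R M S \<subseteq> carrier M"
    unfolding module_span_def using carrier_is_submodule assms by blast
qed (auto simp: module_span_def intro: submodule_zero submoduleE)

lemma span_superset: "S \<subseteq> module_span R M S"
  by (auto simp: module_span_def)

lemma span_minimal: "submodule H R M \<Longrightarrow> S \<subseteq> H \<Longrightarrow> module_span R M S \<subseteq> H"
  by (auto simp: module_span_def)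

lemma ideal_colon:
  assumes H: "submodule H R M" and S: "S \<subseteq> carrier M"
  shows "ideal {r \<in> carrier R. \<forall>x\<in>S. r \<odot>\<^bsub>M\<^esub> x \<in> H} R" (is "ideal ?I R")
proof (rule idealI[OF R.ring_axioms])
  note sub = subsetD[OF S]
  have zero: "\<zero> \<in> ?I" using sub submodule_zero[OF H] by simp
  have minus: "\<ominus> a \<in> ?I" if "a \<in> ?I" for a
    using that sub submoduleE(3)[OF H] by (simp add: smult_l_minus)
  have add: "a \<oplus> b \<in> ?I" if "a \<in> ?I" "b \<in> ?I" for a b
    using that sub submoduleE(5)[OF H] by (simp add: smult_l_distr)
  show "subgroup ?I (add_monoid R)"
    by (rule R.add.subgroupI) (use zero minus add in \<open>auto simp: a_inv_def\<close>)
  fix a r assume a: "a \<in> ?I" and r: "r \<in> carrier R"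
  show "r \<otimes> a \<in> ?I" using a r sub submoduleE(4)[OF H] by (simp add: smult_assoc1)
  then show "a \<otimes> r \<in> ?I" using a r by (simp add: R.m_comm)
qed

end

section \<open>Finitely generated modules over a Noetherian ring\<close>

definition noetherian_module :: "('a, 'r) ring_scheme \<Rightarrow> ('a, 'm, 's) module_scheme \<Rightarrow> bool" where
  "noetherian_module R M \<longleftrightarrow> module R M \<and>
     (\<forall>H. submodule H R M \<longrightarrow> (\<exists>T. finite T \<and> T \<subseteq> H \<and> module_span R M T = H))"

text \<open>With \<open>W\<close> the span of \<open>S\<close>, the submodule \<open>H\<close> is
  controlled by \<open>H \<inter> W\<close> and by the ideal of those \<open>r\<close> for which
  some element of \<open>H\<close> is congruent to \<open>r x\<close> modulo \<open>W\<close>.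
  Generators of the ideal lift to \<open>H\<close>, and together with generators of
  \<open>H \<inter> W\<close> they generate \<open>H\<close>.\<close>

lemma (in module) span_insert_fin_gen:
  assumes noeth: "noetherian_ring R" and x: "x \<in> carrier M" and S: "S \<subseteq> carrier M"
    and IH: "\<And>H. submodule H R M \<Longrightarrow> H \<subseteq> module_span R M S \<Longrightarrow>
              \<exists>T. finite T \<and> T \<subseteq> H \<and> module_span R M T = H"
    and H: "submodule H R M" "H \<subseteq> module_span R M (insert x S)"
  shows "\<exists>T. finite T \<and> T \<subseteq> H \<and> module_span R M T = H"
proof -
  let ?W = "module_span R M S"
  have W: "submodule ?W R M" using submodule_span[OF S] .
  note subW = submodule_subset[OF W] and subH = submodule_subset[OF H(1)]
  \<comment> \<open>Coefficients of \<open>x\<close> modulo \<open>?W\<close>; taken for arbitrary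
    \<open>K\<close> because \<open>H\<close> is compared with the submodule \<open>?G\<close>
    generated by the lifts.\<close>
  define I where "I K = {r \<in> carrier R. \<exists>h\<in>K. h \<ominus>\<^bsub>M\<^esub> r \<odot>\<^bsub>M\<^esub> x \<in> ?W}" for K
  have idl: "ideal (I K) R" if K: "submodule K R M" for K
  proof (rule idealI[OF R.ring_axioms])
    note subK = submodule_subset[OF K]
    have add: "a \<oplus> b \<in> I K" if ab: "a \<in> I K" "b \<in> I K" for a b
    proof -
      obtain h h' where h: "h \<in> K" "h' \<in> K" "h \<ominus>\<^bsub>M\<^esub> a \<odot>\<^bsub>M\<^esub> x \<in> ?W" "h' \<ominus>\<^bsub>M\<^esub> b \<odot>\<^bsub>M\<^esub> x \<in> ?W"
        and c: "a \<in> carrier R" "b \<in> carrier R" using ab unfolding I_def by blast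
      have "(h \<oplus>\<^bsub>M\<^esub> h') \<ominus>\<^bsub>M\<^esub> (a \<oplus> b) \<odot>\<^bsub>M\<^esub> x = (h \<ominus>\<^bsub>M\<^esub> a \<odot>\<^bsub>M\<^esub> x) \<oplus>\<^bsub>M\<^esub> (h' \<ominus>\<^bsub>M\<^esub> b \<odot>\<^bsub>M\<^esub> x)"
        using h c x subK by (simp add: smult_l_distr a_minus_def M.minus_add M.add.m_ac)
      then have "(h \<oplus>\<^bsub>M\<^esub> h') \<ominus>\<^bsub>M\<^esub> (a \<oplus> b) \<odot>\<^bsub>M\<^esub> x \<in> ?W"
        using h submoduleE(5)[OF W] by simp
      then show ?thesis using h c submoduleE(5)[OF K] unfolding I_def by blast
    qed
    have mult: "r \<otimes> a \<in> I K" if ab: "a \<in> I K" "r \<in> carrier R" for a r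
    proof -
      obtain h where h: "h \<in> K" "h \<ominus>\<^bsub>M\<^esub> a \<odot>\<^bsub>M\<^esub> x \<in> ?W"
        and c: "a \<in> carrier R" using ab unfolding I_def by blast
      have "(r \<odot>\<^bsub>M\<^esub> h) \<ominus>\<^bsub>M\<^esub> (r \<otimes> a) \<odot>\<^bsub>M\<^esub> x = r \<odot>\<^bsub>M\<^esub> (h \<ominus>\<^bsub>M\<^esub> a \<odot>\<^bsub>M\<^esub> x)"
        using h c x subK ab by (simp add: smult_r_distr smult_assoc1 a_minus_def smult_r_minus)
      then have "(r \<odot>\<^bsub>M\<^esub> h) \<ominus>\<^bsub>M\<^esub> (r \<otimes> a) \<odot>\<^bsub>M\<^esub> x \<in> ?W"
        using h ab submoduleE(4)[OF W] by simp
      then show ?thesis using h c ab submoduleE(4)[OF K] unfolding I_def by blast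
    qed
    have zero: "\<zero> \<in> I K"
    proof -
      have "\<zero>\<^bsub>M\<^esub> \<ominus>\<^bsub>M\<^esub> \<zero> \<odot>\<^bsub>M\<^esub> x = \<zero>\<^bsub>M\<^esub>" using x by (simp add: a_minus_def)
      then have "\<zero>\<^bsub>M\<^esub> \<ominus>\<^bsub>M\<^esub> \<zero> \<odot>\<^bsub>M\<^esub> x \<in> ?W" using submodule_zero[OF W] by simp
      then show ?thesis using submodule_zero[OF K] unfolding I_def by blast
    qed
    show "subgroup (I K) (add_monoid R)"
    proof (rule R.add.subgroupI)
      show "I K \<subseteq> carrier R" "I K \<noteq> {}" using zero by (auto simp: I_def)
      show "\<ominus> a \<in> I K" if "a \<in> I K" for a
      proof -
        have "a \<in> carrier R" using that by (auto simp: I_def)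
        then have "\<ominus> a = (\<ominus> \<one>) \<otimes> a" by (simp add: R.l_minus)
        then show ?thesis using mult[OF that, of "\<ominus> \<one>"] by simp
      qed
    qed (use add in auto)
    fix a r assume "a \<in> I K" "r \<in> carrier R"
    then show "r \<otimes> a \<in> I K" "a \<otimes> r \<in> I K" using mult R.m_comm by (auto simp: I_def)
  qed
  obtain A where A: "A \<subseteq> carrier R" "finite A" "I H = Idl A"
    using noetherian_ring.finetely_gen[OF noeth idl[OF H(1)]] by blast
  have "\<exists>h\<in>H. h \<ominus>\<^bsub>M\<^esub> a \<odot>\<^bsub>M\<^esub> x \<in> ?W" if "a \<in> A" for a
    using that A R.genideal_self[OF A(1)] unfolding I_def by blast
  then obtain g where g: "g a \<in> H" "g a \<ominus>\<^bsub>M\<^esub> a \<odot>\<^bsub>M\<^esub> x \<in> ?W" if "a \<in> A" for a by metis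
  obtain T where T: "finite T" "T \<subseteq> H \<inter> ?W" "module_span R M T = H \<inter> ?W"
    using IH[OF submodule_Int[OF H(1) W]] by blast
  let ?U = "T \<union> g ` A" and ?G = "module_span R M (T \<union> g ` A)"
  have UH: "?U \<subseteq> H" using T g by auto
  then have G: "submodule ?G R M" using submodule_span subH by blast
  have TG: "H \<inter> ?W \<subseteq> ?G" using T span_minimal[OF G, of T] span_superset[of ?U] by auto
  have "I H \<subseteq> I ?G"
    unfolding A(3)
  proof (rule R.genideal_minimal[OF idl[OF G]], rule subsetI)
    fix a assume "a \<in> A" then show "a \<in> I ?G"
      using A g[of a] span_superset[of ?U] unfolding I_def by blast
  qed
  moreover have "H \<subseteq> ?G"
  proof
    fix h assume h: "h \<in> H"
    let ?C = "?W <+>\<^bsub>M\<^esub> ((\<lambda>r. r \<odot>\<^bsub>M\<^esub> x) ` carrier R)"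
    have C: "submodule ?C R M" using submodule_add_sets[OF W submodule_cyclic[OF x]] .
    have "x \<in> ?C" unfolding set_add_iff
      using submodule_zero[OF W] x by (metis M.l_zero R.one_closed imageI smult_one)
    moreover have "S \<subseteq> ?C"
    proof
      fix s assume s: "s \<in> S"
      then have "s \<in> ?W" "s = s \<oplus>\<^bsub>M\<^esub> \<zero> \<odot>\<^bsub>M\<^esub> x" using span_superset[of S] S x by auto
      then show "s \<in> ?C" unfolding set_add_iff using R.zero_closed by blast
    qed
    ultimately have "h \<in> ?C" using span_minimal[OF C, of "insert x S"] H(2) h by blast
    then obtain s r where sr: "s \<in> ?W" "r \<in> carrier R" "h = s \<oplus>\<^bsub>M\<^esub> r \<odot>\<^bsub>M\<^esub> x"
      unfolding set_add_iff by blast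
    then have "h \<ominus>\<^bsub>M\<^esub> r \<odot>\<^bsub>M\<^esub> x \<in> ?W"
      using subW x by (simp add: a_minus_def M.a_assoc M.r_neg)
    then have "r \<in> I H" using sr h unfolding I_def by blast
    then have "r \<in> I ?G" using \<open>I H \<subseteq> I ?G\<close> by blast
    \<comment> \<open>\<open>h\<close> and \<open>g'\<close> have the same coefficient
      \<open>r\<close> at \<open>x\<close>, so their difference lies in
      \<open>H \<inter> ?W\<close>, which is contained in \<open>?G\<close>.\<close>
    then obtain g' where g': "g' \<in> ?G" "g' \<ominus>\<^bsub>M\<^esub> r \<odot>\<^bsub>M\<^esub> x \<in> ?W" unfolding I_def by blast
    have g'H: "g' \<in> H" using g' span_minimal[OF H(1) UH] by blast
    have "h \<ominus>\<^bsub>M\<^esub> g' = (h \<ominus>\<^bsub>M\<^esub> r \<odot>\<^bsub>M\<^esub> x) \<ominus>\<^bsub>M\<^esub> (g' \<ominus>\<^bsub>M\<^esub> r \<odot>\<^bsub>M\<^esub> x)"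
    proof -
      define y where "y = r \<odot>\<^bsub>M\<^esub> x"
      have c: "h \<in> carrier M" "g' \<in> carrier M" "y \<in> carrier M" using h g'H subH sr x y_def by auto
      have "(h \<ominus>\<^bsub>M\<^esub> y) \<ominus>\<^bsub>M\<^esub> (g' \<ominus>\<^bsub>M\<^esub> y) = h \<ominus>\<^bsub>M\<^esub> g' \<oplus>\<^bsub>M\<^esub> (\<ominus>\<^bsub>M\<^esub> y \<oplus>\<^bsub>M\<^esub> y)"
        using c by (simp add: a_minus_def M.minus_add M.add.m_ac del: M.l_neg)
      then show ?thesis using c by (simp add: y_def M.l_neg a_minus_def)
    qed
    then have "h \<ominus>\<^bsub>M\<^esub> g' \<in> ?W" using \<open>h \<ominus>\<^bsub>M\<^esub> r \<odot>\<^bsub>M\<^esub> x \<in> ?W\<close> g' submodule_minus[OF W] by simp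
    then have "h \<ominus>\<^bsub>M\<^esub> g' \<in> ?G" using TG submodule_minus[OF H(1) h g'H] by blast
    then have "h \<ominus>\<^bsub>M\<^esub> g' \<oplus>\<^bsub>M\<^esub> g' \<in> ?G" using g' submoduleE(5)[OF G] by blast
    then show "h \<in> ?G" using h g'H subH by (simp add: a_minus_def M.a_assoc M.l_neg)
  qed
  ultimately have "?G = H" using span_minimal[OF H(1) UH] by blast
  then show ?thesis using T A UH by (intro exI[of _ ?U]) auto
qed

lemma fin_gen_imp_noetherian_module:
  assumes noeth: "noetherian_ring R" and fg: "fin_gen_module R M"
  shows "noetherian_module R M"
proof -
  interpret module R M using fg by (simp add: fin_gen_module_def)
  obtain S where S: "finite S" "S \<subseteq> carrier M" "module_span R M S = carrier M"
    using fg by (auto simp: fin_gen_module_def)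
  \<comment> \<open>Claimed for submodules of the span of any finite \<open>S\<close>, so that
    generators can be added one at a time.\<close>
  have "\<exists>T. finite T \<and> T \<subseteq> H \<and> module_span R M T = H"
    if "submodule H R M" "H \<subseteq> module_span R M S" for H
    using S(1,2) that
  proof (induction S arbitrary: H rule: finite_induct)
    case empty
    have "module_span R M {} \<subseteq> {\<zero>\<^bsub>M\<^esub>}"
      by (rule span_minimal[OF submodule_zero_singleton]) simp
    moreover have "submodule (module_span R M {}) R M" by (rule submodule_span) simp
    ultimately have "H = {\<zero>\<^bsub>M\<^esub>}" "module_span R M {} = {\<zero>\<^bsub>M\<^esub>}"
      using empty submodule_zero by blast+
    then have "module_span R M {} = H" using submodule_zero[OF empty(2)] by simp
    then show ?case by blast
  next
    case (insert x S)
    show ?case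
    proof (rule span_insert_fin_gen[OF noeth _ _ _ insert.prems(2,3)])
      show "x \<in> carrier M" "S \<subseteq> carrier M" using insert.prems(1) by auto
      then show "\<exists>T. finite T \<and> T \<subseteq> K \<and> module_span R M T = K"
        if "submodule K R M" "K \<subseteq> module_span R M S" for K
        using insert.IH that by blast
    qed
  qed
  then show ?thesis
    using S(3) submoduleE(1) module_axioms unfolding noetherian_module_def by metis
qed

text \<open>The union of a chain of submodules is finitely generated, and finitely many generators
  already lie in one member; so the union belongs to the chain and Zorn's lemma applies.\<close>

lemma noetherian_module_maximal:
  fixes R (structure) and M (structure)
  assumes M: "noetherian_module R M" and C: "C \<noteq> {}" "\<And>H. H \<in> C \<Longrightarrow> submodule H R M"
  shows "\<exists>H\<in>C. \<forall>K\<in>C. H \<subseteq> K \<longrightarrow> K = H"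
proof (rule subset_Zorn_nonempty[OF C(1)])
  interpret module R M using M by (simp add: noetherian_module_def)
  fix D assume D: "D \<noteq> {}" "subset.chain C D"
  have DC: "D \<subseteq> C" using D unfolding subset_chain_def by blast
  have dir: "\<exists>W\<in>D. V \<subseteq> W \<and> V' \<subseteq> W" if V: "V \<in> D" "V' \<in> D" for V V'
  proof -
    have "V \<subseteq> V' \<or> V' \<subseteq> V"
      using D(2) V unfolding subset_chain_def by simp
    then show ?thesis using V by (elim disjE) (rule bexI[OF _ V(2)], simp, rule bexI[OF _ V(1)], simp)
  qed
  have U: "submodule (\<Union>D) R M"
  proof (rule submoduleI)
    show "a \<oplus>\<^bsub>M\<^esub> b \<in> \<Union> D" if ab: "a \<in> \<Union> D" "b \<in> \<Union> D" for a b
    proof -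
      obtain V V' where "V \<in> D" "V' \<in> D" "a \<in> V" "b \<in> V'" using ab by blast
      then obtain V'' where "V'' \<in> D" "a \<in> V''" "b \<in> V''" using dir[of V V'] by blast
      then show ?thesis using submoduleE(5) C(2) DC by blast
    qed
    show "\<Union> D \<subseteq> carrier M" using DC C(2) submodule_subset by blast
    show "\<zero>\<^bsub>M\<^esub> \<in> \<Union> D" using D(1) DC C(2) submodule_zero by blast
    show "\<ominus>\<^bsub>M\<^esub> a \<in> \<Union> D" if "a \<in> \<Union> D" for a using that DC C(2) submoduleE(3) by blast
    show "a \<odot>\<^bsub>M\<^esub> x \<in> \<Union> D" if "a \<in> carrier R" "x \<in> \<Union> D" for a x
      using that DC C(2) submoduleE(4) by blast
  qed
  obtain T where T: "finite T" "T \<subseteq> \<Union>D" "module_span R M T = \<Union>D"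
    using M U unfolding noetherian_module_def by blast
  obtain V where V: "V \<in> D" "T \<subseteq> V"
    using finite_subset_Union_chain[OF T(1,2) D] by blast
  then have "\<Union>D \<subseteq> V" using T span_minimal C DC by blast
  then have "\<Union>D = V" using V by blast
  then show "\<Union>D \<in> C" using V DC by blast
qed

section \<open>Maximal elements among ideals, and prime ideals avoiding a multiplicative set\<close>

lemma noetherian_ring_maximal:
  assumes R: "noetherian_ring R" and C: "C \<noteq> {}" "\<And>I. I \<in> C \<Longrightarrow> ideal I R"
  shows "\<exists>I\<in>C. \<forall>J\<in>C. I \<subseteq> J \<longrightarrow> J = I"
proof (rule subset_Zorn_nonempty[OF C(1)])
  fix D assume D: "D \<noteq> {}" "subset.chain C D"
  then have "D \<subseteq> C" and "\<forall>I\<in>D. \<forall>J\<in>D. I \<subseteq> J \<or> J \<subseteq> I"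
    unfolding subset_chain_def by simp_all
  then have "subset.chain {I. ideal I R} D" using C(2) unfolding subset_chain_def by blast
  then have "\<Union>D \<in> D" using noetherian_ring.ideal_chain_is_trivial[OF R D(1)] by blast
  then show "\<Union>D \<in> C" using \<open>D \<subseteq> C\<close> by blast
qed

text \<open>An ideal maximal among those containing \<open>I\<close> and missing \<open>S\<close> is
  prime: if \<open>a\<close> and \<open>b\<close> lie outside, adding either of them produces an
  element of \<open>S\<close>, and the product of these two elements falls back into the ideal as
  soon as \<open>a \<otimes> b\<close> does.\<close>

lemma exists_prime_avoiding:
  fixes R (structure)
  assumes cr: "cring R" and R: "noetherian_ring R" and I: "ideal I R"
    and S: "S \<subseteq> carrier R" "\<one>\<^bsub>R\<^esub> \<in> S" "\<And>s t. s \<in> S \<Longrightarrow> t \<in> S \<Longrightarrow> s \<otimes>\<^bsub>R\<^esub> t \<in> S"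
    and dis: "I \<inter> S = {}"
  shows "\<exists>P. primeideal P R \<and> I \<subseteq> P \<and> P \<inter> S = {}"
proof -
  interpret cring R by fact
  let ?C = "{J. ideal J R \<and> I \<subseteq> J \<and> J \<inter> S = {}}"
  obtain P where P: "P \<in> ?C" and max: "\<And>J. J \<in> ?C \<Longrightarrow> P \<subseteq> J \<Longrightarrow> J = P"
  proof -
    have "I \<in> ?C" using I dis by blast
    then have ne: "?C \<noteq> {}" by (metis empty_iff)
    have "\<exists>P\<in>?C. \<forall>J\<in>?C. P \<subseteq> J \<longrightarrow> J = P"
      by (rule noetherian_ring_maximal[OF R ne]) simp
    then show thesis using that by meson
  qed
  interpret P: ideal P R using P by blast
  have meet: "\<exists>p\<in>P. \<exists>r\<in>carrier R. p \<oplus>\<^bsub>R\<^esub> r \<otimes>\<^bsub>R\<^esub> a \<in> S" if a: "a \<in> carrier R" "a \<notin> P" for a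
  proof (rule ccontr)
    assume neg: "\<not> ?thesis"
    let ?J = "P <+>\<^bsub>R\<^esub> (PIdl a)"
    have J: "ideal ?J R" using add_ideals P.is_ideal cgenideal_ideal a by blast
    have PJ: "P \<subseteq> ?J"
    proof
      fix p assume "p \<in> P"
      moreover have "\<zero> \<in> PIdl a" using a by (metis additive_subgroup.zero_closed cgenideal_ideal ideal.axioms(1))
      ultimately show "p \<in> ?J" unfolding set_add_iff
        using P.Icarr r_zero by (metis)
    qed
    have "a \<in> ?J" unfolding set_add_iff
      using cgenideal_self[OF a(1)] P.zero_closed l_zero a by metis
    moreover have "x \<notin> S" if "x \<in> ?J" for x
      using neg that unfolding set_add_iff cgenideal_def by blast
    then have "?J \<inter> S = {}" by blast
    ultimately show False using max[of ?J] J PJ P a by simp blast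
  qed
  have "primeideal P R"
  proof (rule primeidealI[OF P.is_ideal cr])
    show "carrier R \<noteq> P" using P S by blast
    fix a b assume ab: "a \<in> carrier R" "b \<in> carrier R" "a \<otimes> b \<in> P"
    show "a \<in> P \<or> b \<in> P"
    proof (rule ccontr)
      assume "\<not> ?thesis"
      then obtain p r q s where e: "p \<in> P" "r \<in> carrier R" "p \<oplus> r \<otimes> a \<in> S"
        "q \<in> P" "s \<in> carrier R" "q \<oplus> s \<otimes> b \<in> S" using meet ab by metis
      then have "(p \<oplus> r \<otimes> a) \<otimes> (q \<oplus> s \<otimes> b) \<in> S" using S by blast
      moreover have "(p \<oplus> r \<otimes> a) \<otimes> (q \<oplus> s \<otimes> b) = p \<otimes> (q \<oplus> s \<otimes> b) \<oplus> ((r \<otimes> a) \<otimes> q \<oplus> (r \<otimes> s) \<otimes> (a \<otimes> b))"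
        using e ab P.Icarr by (simp add: l_distr r_distr m_ac a_ac)
      moreover have "\<dots> \<in> P" using e ab P.Icarr P.I_l_closed P.I_r_closed by (intro P.a_closed) auto
      ultimately show False using P by auto
    qed
  qed
  then show ?thesis using P by blast
qed

section \<open>Regular sequences and chains of primes\<close>

lemma local_ring_ideal_subset:
  assumes loc: "local_ring R \<mm>" and R: "noetherian_ring R" and I: "ideal I R" "I \<noteq> carrier R"
  shows "I \<subseteq> \<mm>"
proof -
  interpret cring R using loc by (simp add: local_ring_def)
  let ?C = "{J. ideal J R \<and> I \<subseteq> J \<and> J \<noteq> carrier R}"
  have "I \<in> ?C" using I by simp
  then have ne: "?C \<noteq> {}" by (metis empty_iff)
  have "\<exists>P\<in>?C. \<forall>J\<in>?C. P \<subseteq> J \<longrightarrow> J = P"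
    by (rule noetherian_ring_maximal[OF R ne]) simp
  then obtain P where P: "P \<in> ?C" "\<forall>J\<in>?C. P \<subseteq> J \<longrightarrow> J = P" by (elim bexE)
  have "maximalideal P R"
  proof (rule maximalidealI)
    fix J assume "ideal J R" "P \<subseteq> J" "J \<subseteq> carrier R"
    then show "J = P \<or> J = carrier R" using P subset_trans[of I P J] by (cases "J = carrier R") simp_all
  qed (use P in \<open>simp_all add: eq_commute\<close>)
  then have "P = \<mm>" using loc by (simp add: local_ring_def)
  then show ?thesis using P by auto
qed

lemma local_ring_unit:
  assumes loc: "local_ring R \<mm>" and R: "noetherian_ring R" and a: "a \<in> carrier R" "a \<notin> \<mm>"
  shows "a \<in> Units R"
proof -
  interpret cring R using loc by (simp add: local_ring_def)
  have "PIdl\<^bsub>R\<^esub> a = carrier R"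
    using local_ring_ideal_subset[OF loc R cgenideal_ideal[OF a(1)]] cgenideal_self[OF a(1)] a(2) by blast
  then have "\<one>\<^bsub>R\<^esub> \<in> PIdl\<^bsub>R\<^esub> a" by simp
  then obtain b where "b \<in> carrier R" "\<one>\<^bsub>R\<^esub> = b \<otimes>\<^bsub>R\<^esub> a" by (auto simp: cgenideal_def)
  then show ?thesis using a m_comm unfolding Units_def by force
qed

lemma local_ring_proper:
  assumes "local_ring R \<mm>"
  shows "ideal \<mm> R" "\<mm> \<subseteq> carrier R" "\<one>\<^bsub>R\<^esub> \<notin> \<mm>" "primeideal \<mm> R"
proof -
  interpret cring R using assms by (simp add: local_ring_def)
  interpret maximalideal \<mm> R using assms by (simp add: local_ring_def)
  show "ideal \<mm> R" "\<mm> \<subseteq> carrier R" by (rule is_ideal, rule a_subset)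
  show "\<one>\<^bsub>R\<^esub> \<notin> \<mm>" using one_imp_carrier I_notcarr by blast
  show "primeideal \<mm> R" by (rule maximalideal_prime) unfold_locales
qed

section \<open>Dimension of a ring modulo an ideal\<close>

definition prime_chain :: "('a, 'r) ring_scheme \<Rightarrow> 'a set \<Rightarrow> nat \<Rightarrow> bool" where
  "prime_chain R I n \<longleftrightarrow> (\<exists>P :: nat \<Rightarrow> 'a set.
     (\<forall>i\<le>n. primeideal (P i) R \<and> I \<subseteq> P i) \<and> (\<forall>i<n. P i \<subset> P (Suc i)))"

text \<open>The Krull dimension of \<open>R / I\<close>. Detached from modules, it applies equally
  to annihilators of subquotients and of single elements.\<close>

definition ideal_dim :: "('a, 'r) ring_scheme \<Rightarrow> 'a set \<Rightarrow> enat" where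
  "ideal_dim R I = Sup {enat n | n. prime_chain R I n}"

lemma module_dim_eq: "module_dim R M = ideal_dim R (module_annihilator R M)"
  by (simp add: module_dim_def ideal_dim_def prime_chain_def)

lemma prime_chain_mono:
  assumes "prime_chain R J n" and "\<And>P. primeideal P R \<Longrightarrow> J \<subseteq> P \<Longrightarrow> I \<subseteq> P"
  shows "prime_chain R I n"
  using assms unfolding prime_chain_def by metis

text \<open>The comparison is made through primes, that is, between radicals: this is what remains
  available when an inclusion of annihilators holds only up to nilpotents.\<close>

lemma ideal_dim_mono:
  assumes "\<And>P. primeideal P R \<Longrightarrow> J \<subseteq> P \<Longrightarrow> I \<subseteq> P"
  shows "ideal_dim R J \<le> ideal_dim R I"
  unfolding ideal_dim_def by (rule Sup_subset_mono) (use prime_chain_mono[OF _ assms] in auto)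

lemma ideal_dim_upper: "prime_chain R I n \<Longrightarrow> enat n \<le> ideal_dim R I"
  unfolding ideal_dim_def by (rule Sup_upper) auto

text \<open>Regular sequences on \<open>F / K\<close> for submodules \<open>K \<subseteq> F\<close> of \<open>M\<close>, expressed inside \<open>M\<close>.\<close>

definition add_multiples :: "('a, 'm, 's) module_scheme \<Rightarrow> 'm set \<Rightarrow> 'a \<Rightarrow> 'm set \<Rightarrow> 'm set" where
  "add_multiples M F x K = K <+>\<^bsub>M\<^esub> ((\<lambda>z. x \<odot>\<^bsub>M\<^esub> z) ` F)"

primrec regular_on :: "('a, 'm, 's) module_scheme \<Rightarrow> 'm set \<Rightarrow> 'm set \<Rightarrow> 'a list \<Rightarrow> bool" where
  "regular_on M F K [] \<longleftrightarrow> K \<noteq> F"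
| "regular_on M F K (x # xs) \<longleftrightarrow> (\<forall>z\<in>F. x \<odot>\<^bsub>M\<^esub> z \<in> K \<longrightarrow> z \<in> K) \<and>
     regular_on M F (add_multiples M F x K) xs"

lemma add_multiples_iff:
  "y \<in> add_multiples M F x K \<longleftrightarrow> (\<exists>k\<in>K. \<exists>z\<in>F. y = k \<oplus>\<^bsub>M\<^esub> x \<odot>\<^bsub>M\<^esub> z)"
  by (auto simp: add_multiples_def set_add_iff)

context module
begin

lemma submodule_add_multiples:
  "submodule K R M \<Longrightarrow> submodule F R M \<Longrightarrow> x \<in> carrier R \<Longrightarrow> submodule (add_multiples M F x K) R M"
  unfolding add_multiples_def by (intro submodule_add_sets submodule_smult_image)

lemma add_multiples_mult:
  assumes "submodule K R M" "submodule F R M" "x \<in> carrier R" "z \<in> F"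
  shows "x \<odot>\<^bsub>M\<^esub> z \<in> add_multiples M F x K"
  unfolding add_multiples_iff
  using assms submodule_zero[OF assms(1)] submodule_subset[OF assms(2)]
  by (intro bexI[of _ "\<zero>\<^bsub>M\<^esub>"] bexI[of _ z]) auto

lemma add_multiples_superset:
  assumes "submodule K R M" "submodule F R M" "x \<in> carrier R" "k \<in> K"
  shows "k \<in> add_multiples M F x K"
  unfolding add_multiples_iff
  using assms submodule_zero[OF assms(2)] submodule_subset[OF assms(1)]
  by (intro bexI[of _ k] bexI[of _ "\<zero>\<^bsub>M\<^esub>"]) auto

lemma add_multiples_subset:
  assumes "submodule F R M" "K \<subseteq> F" "x \<in> carrier R"
  shows "add_multiples M F x K \<subseteq> F"
proof
  fix y assume "y \<in> add_multiples M F x K"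
  then obtain k z where "k \<in> F" "z \<in> F" "y = k \<oplus>\<^bsub>M\<^esub> x \<odot>\<^bsub>M\<^esub> z"
    using assms unfolding add_multiples_iff by blast
  then show "y \<in> F" using assms submoduleE(4,5)[OF assms(1)] by simp
qed

lemma add_multiples_commute_subset:
  assumes "submodule K R M" "submodule F R M" "x \<in> carrier R" "y \<in> carrier R"
  shows "add_multiples M F x (add_multiples M F y K) \<subseteq> add_multiples M F y (add_multiples M F x K)"
proof
  fix w assume "w \<in> add_multiples M F x (add_multiples M F y K)"
  then obtain v z' where v: "v \<in> add_multiples M F y K" "z' \<in> F" "w = v \<oplus>\<^bsub>M\<^esub> x \<odot>\<^bsub>M\<^esub> z'"
    unfolding add_multiples_iff[of w] by (elim bexE)
  then obtain k z where "k \<in> K" "z \<in> F" "v = k \<oplus>\<^bsub>M\<^esub> y \<odot>\<^bsub>M\<^esub> z"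
    unfolding add_multiples_iff by blast
  with v have e: "k \<in> K" "z \<in> F" "z' \<in> F" "w = (k \<oplus>\<^bsub>M\<^esub> y \<odot>\<^bsub>M\<^esub> z) \<oplus>\<^bsub>M\<^esub> x \<odot>\<^bsub>M\<^esub> z'"
    by simp_all
  then have "w = (k \<oplus>\<^bsub>M\<^esub> x \<odot>\<^bsub>M\<^esub> z') \<oplus>\<^bsub>M\<^esub> y \<odot>\<^bsub>M\<^esub> z"
    using assms(3,4) submodule_subset[OF assms(1)] submodule_subset[OF assms(2)]
    by (simp add: M.add.m_ac)
  moreover have "k \<oplus>\<^bsub>M\<^esub> x \<odot>\<^bsub>M\<^esub> z' \<in> add_multiples M F x K"
    using e unfolding add_multiples_iff by blast
  ultimately show "w \<in> add_multiples M F y (add_multiples M F x K)"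
    using e unfolding add_multiples_iff[of w] by blast
qed

lemma add_multiples_commute:
  assumes "submodule K R M" "submodule F R M" "x \<in> carrier R" "y \<in> carrier R"
  shows "add_multiples M F x (add_multiples M F y K) = add_multiples M F y (add_multiples M F x K)"
  by (intro equalityI add_multiples_commute_subset assms)

text \<open>For submodules \<open>K \<subseteq> F\<close> this is the annihilator of
  \<open>F / K\<close>; for \<open>F = {z}\<close> it is the annihilator of the coset of
  \<open>z\<close>.\<close>

definition colon :: "'c set \<Rightarrow> 'c set \<Rightarrow> 'a set" where
  "colon K F = {r \<in> carrier R. \<forall>x\<in>F. r \<odot>\<^bsub>M\<^esub> x \<in> K}"

lemma colon_ideal: "submodule K R M \<Longrightarrow> F \<subseteq> carrier M \<Longrightarrow> ideal (colon K F) R"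
  unfolding colon_def by (rule ideal_colon)

end

section \<open>Nakayama's lemma, prime chains and exchange of elements in regular sequences\<close>

locale local_noetherian_module = module +
  fixes \<mm>
  assumes noetherian: "noetherian_ring R" and local: "local_ring R \<mm>"
    and noetherian_M: "noetherian_module R M"
begin

lemmas max_ideal = local_ring_proper[OF local]

lemma max_carrier: "x \<in> \<mm> \<Longrightarrow> x \<in> carrier R"
  using max_ideal(2) by blast

lemma one_minus_unit:
  assumes "x \<in> \<mm>" "r \<in> carrier R"
  shows "\<one> \<ominus> r \<otimes> x \<in> Units R"
proof (rule local_ring_unit[OF local noetherian])
  have x: "x \<in> carrier R" using assms max_carrier by simp
  then show "\<one> \<ominus> r \<otimes> x \<in> carrier R" using assms by simp
  interpret I: ideal \<mm> R by (rule max_ideal(1))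
  show "\<one> \<ominus> r \<otimes> x \<notin> \<mm>"
  proof
    assume "\<one> \<ominus> r \<otimes> x \<in> \<mm>"
    then have "(\<one> \<ominus> r \<otimes> x) \<oplus> r \<otimes> x \<in> \<mm>" using assms I.I_l_closed by simp
    moreover have "(\<one> \<ominus> r \<otimes> x) \<oplus> r \<otimes> x = \<one>" using assms x by (simp add: R.minus_eq R.a_assoc R.l_neg)
    ultimately show False using max_ideal(3) by simp
  qed
qed

text \<open>Nakayama's lemma for one element \<open>x\<close>, with \<open>U\<close> a mere set, so
  that sets cut out by a condition need not be shown to be submodules. Replacing \<open>u\<close> by
  \<open>y\<close> enlarges \<open>K + R u\<close>; choose \<open>u\<close> outside \<open>K\<close>
  with \<open>K + R u\<close> maximal. Then \<open>y\<close> lies in \<open>K + R u\<close> as well,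
  and this puts a unit multiple of \<open>y\<close> into \<open>K\<close>.\<close>

lemma nakayama:
  assumes K: "submodule K R M" and U: "U \<subseteq> carrier M" and x: "x \<in> \<mm>"
    and step: "\<And>u. u \<in> U \<Longrightarrow> \<exists>k\<in>K. \<exists>y\<in>U. u = k \<oplus>\<^bsub>M\<^esub> x \<odot>\<^bsub>M\<^esub> y"
  shows "U \<subseteq> K"
proof (rule ccontr)
  assume "\<not> U \<subseteq> K"
  then obtain u0 where u0: "u0 \<in> U" "u0 \<notin> K" by blast
  let ?S = "\<lambda>u. K <+>\<^bsub>M\<^esub> ((\<lambda>r. r \<odot>\<^bsub>M\<^esub> u) ` carrier R)"
  have sub: "submodule (?S u) R M" if "u \<in> U" for u
    using that U K by (intro submodule_add_sets submodule_cyclic) auto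
  have xR: "x \<in> carrier R" using x max_carrier by simp
  have "?S ` (U - K) \<noteq> {}" using u0 by blast
  moreover have "submodule H R M" if "H \<in> ?S ` (U - K)" for H using that sub by blast
  ultimately obtain H where H: "H \<in> ?S ` (U - K)" "\<forall>H'\<in>?S ` (U - K). H \<subseteq> H' \<longrightarrow> H' = H"
    using noetherian_module_maximal[OF noetherian_M, of "?S ` (U - K)"] by metis
  then obtain u where u: "u \<in> U" "u \<notin> K" "H = ?S u" by blast
  obtain k y where ky: "k \<in> K" "y \<in> U" "u = k \<oplus>\<^bsub>M\<^esub> x \<odot>\<^bsub>M\<^esub> y" using step[OF u(1)] by blast
  have c: "u \<in> carrier M" "y \<in> carrier M" "k \<in> carrier M" using u ky U submodule_subset[OF K] by auto
  have yK: "y \<notin> K" using ky u xR submoduleE(4,5)[OF K] by blast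
  have "?S u \<subseteq> ?S y"
  proof
    fix v assume "v \<in> ?S u"
    then obtain k' r where v: "k' \<in> K" "r \<in> carrier R" "v = k' \<oplus>\<^bsub>M\<^esub> r \<odot>\<^bsub>M\<^esub> u"
      unfolding set_add_iff by blast
    have "v = (k' \<oplus>\<^bsub>M\<^esub> r \<odot>\<^bsub>M\<^esub> k) \<oplus>\<^bsub>M\<^esub> (r \<otimes> x) \<odot>\<^bsub>M\<^esub> y"
      using v ky(3) c xR submodule_subset[OF K] by (simp add: smult_r_distr smult_assoc1 M.a_assoc)
    moreover have "k' \<oplus>\<^bsub>M\<^esub> r \<odot>\<^bsub>M\<^esub> k \<in> K" using v ky submoduleE(4,5)[OF K] by simp
    ultimately show "v \<in> ?S y" unfolding set_add_iff using v xR by blast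
  qed
  then have "?S y = ?S u" using H(2) u ky yK by blast
  moreover have "y \<in> ?S y" unfolding set_add_iff
  proof (intro bexI)
    show "y = \<zero>\<^bsub>M\<^esub> \<oplus>\<^bsub>M\<^esub> \<one> \<odot>\<^bsub>M\<^esub> y" using c by simp
    show "\<one> \<odot>\<^bsub>M\<^esub> y \<in> (\<lambda>r. r \<odot>\<^bsub>M\<^esub> y) ` carrier R" by (rule imageI) simp
  qed (rule submodule_zero[OF K])
  ultimately have "y \<in> ?S u" by simp
  then obtain k' r where v: "k' \<in> K" "r \<in> carrier R" "y = k' \<oplus>\<^bsub>M\<^esub> r \<odot>\<^bsub>M\<^esub> u"
    unfolding set_add_iff by blast
  have c': "k' \<in> carrier M" using v submodule_subset[OF K] by simp
  \<comment> \<open>Substituting \<open>u = k + x y\<close> into \<open>y = k' + r u\<close> gives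
    \<open>(1 - r x) y \<in> K\<close>.\<close>
  let ?e = "\<one> \<ominus> r \<otimes> x"
  have y_eq: "y = (k' \<oplus>\<^bsub>M\<^esub> r \<odot>\<^bsub>M\<^esub> k) \<oplus>\<^bsub>M\<^esub> (r \<otimes> x) \<odot>\<^bsub>M\<^esub> y"
  proof -
    have "r \<odot>\<^bsub>M\<^esub> u = r \<odot>\<^bsub>M\<^esub> k \<oplus>\<^bsub>M\<^esub> (r \<otimes> x) \<odot>\<^bsub>M\<^esub> y"
      unfolding ky(3) using v(2) c xR by (simp add: smult_r_distr smult_assoc1)
    then show ?thesis using v c c' xR by (simp add: M.a_assoc)
  qed
  have "?e \<odot>\<^bsub>M\<^esub> y = y \<oplus>\<^bsub>M\<^esub> \<ominus>\<^bsub>M\<^esub> ((r \<otimes> x) \<odot>\<^bsub>M\<^esub> y)"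
    using c xR v by (simp add: R.minus_eq smult_l_distr smult_l_minus)
  also have "\<dots> = k' \<oplus>\<^bsub>M\<^esub> r \<odot>\<^bsub>M\<^esub> k"
  proof -
    define t where "t = (r \<otimes> x) \<odot>\<^bsub>M\<^esub> y"
    define s where "s = k' \<oplus>\<^bsub>M\<^esub> r \<odot>\<^bsub>M\<^esub> k"
    have "y = s \<oplus>\<^bsub>M\<^esub> t" using y_eq by (simp add: t_def s_def)
    moreover have "t \<in> carrier M" "s \<in> carrier M" using c c' v xR by (auto simp: t_def s_def)
    ultimately show ?thesis unfolding t_def[symmetric] s_def[symmetric] by (simp add: M.a_assoc M.r_neg)
  qed
  finally have eK: "?e \<odot>\<^bsub>M\<^esub> y \<in> K" using v(1,2) ky(1) submoduleE(4,5)[OF K] by simp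
  have eu: "?e \<in> Units R" using one_minus_unit[OF x v(2)] .
  have "inv ?e \<odot>\<^bsub>M\<^esub> (?e \<odot>\<^bsub>M\<^esub> y) = (inv ?e \<otimes> ?e) \<odot>\<^bsub>M\<^esub> y"
    by (rule smult_assoc1[symmetric]) (use eu c R.Units_closed R.Units_inv_closed in blast)+
  then have "y = inv ?e \<odot>\<^bsub>M\<^esub> (?e \<odot>\<^bsub>M\<^esub> y)"
    using c by (simp only: R.Units_l_inv[OF eu] smult_one)
  moreover have "inv ?e \<odot>\<^bsub>M\<^esub> (?e \<odot>\<^bsub>M\<^esub> y) \<in> K"
    by (rule submoduleE(4)[OF K R.Units_inv_closed[OF eu] eK])
  ultimately show False using yK by simp
qed

text \<open>Replacing \<open>z\<close> by an element \<open>w\<close> with a larger annihilator modulo \<open>K\<close> that survives modulo \<open>x F\<close>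
  raises the annihilator by \<open>x\<close>; as \<open>x\<close> is a nonzerodivisor modulo the annihilator of \<open>z\<close>, this costs
  one step in a chain of primes.\<close>

lemma regular_on_prime_chain:
  assumes "regular_on M F K xs" "set xs \<subseteq> \<mm>" "submodule K R M" and F: "submodule F R M"
    and "K \<subseteq> F" "z \<in> F" "z \<notin> K"
  shows "prime_chain R (colon K {z}) (length xs)"
  using assms(1-3,5-)
proof (induction xs arbitrary: K z)
  case Nil
  have "ideal (colon K {z}) R" using Nil submodule_subset[OF F] by (intro colon_ideal) auto
  moreover have "\<one> \<notin> colon K {z}" using Nil submodule_subset[OF F] by (simp add: colon_def)
  then have "colon K {z} \<noteq> carrier R" by auto
  ultimately have "colon K {z} \<subseteq> \<mm>" by (rule local_ring_ideal_subset[OF local noetherian])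
  then show ?case unfolding prime_chain_def using max_ideal(4) by (intro exI[of _ "\<lambda>_. \<mm>"]) simp
next
  case (Cons x xs)
  note K = Cons.prems(3)
  note subF = submodule_subset[OF F] and subK = submodule_subset[OF K]
  have xm: "x \<in> \<mm>" and x: "x \<in> carrier R" using Cons.prems(2) max_carrier by auto
  have xreg: "z' \<in> K" if "z' \<in> F" "x \<odot>\<^bsub>M\<^esub> z' \<in> K" for z' using Cons.prems(1) that by simp
  let ?I = "colon K {z}" and ?K' = "add_multiples M F x K"
  \<comment> \<open>Elements of \<open>F\<close> whose annihilator modulo \<open>K\<close> contains
    that of \<open>z\<close>.\<close>
  define U where "U = {u \<in> F. \<forall>r\<in>?I. r \<odot>\<^bsub>M\<^esub> u \<in> K}"
  have zU: "z \<in> U" using Cons.prems(5) by (simp add: U_def colon_def)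
  have K': "submodule ?K' R M" using submodule_add_multiples[OF K F x] .
  \<comment> \<open>If \<open>U\<close> were inside \<open>K + x F\<close>, then dividing by
    \<open>x\<close> would stay in \<open>U\<close>, since \<open>x\<close> is a nonzerodivisor
    modulo \<open>K\<close>; Nakayama would give \<open>U \<subseteq> K\<close>, although
    \<open>z\<close> is in \<open>U\<close>.\<close>
  have "\<exists>w\<in>U. w \<notin> ?K'"
  proof (rule ccontr)
    assume neg: "\<not> ?thesis"
    have "U \<subseteq> K"
    proof (rule nakayama[OF K _ xm])
      show "U \<subseteq> carrier M" using subF by (auto simp: U_def)
      fix u assume u: "u \<in> U"
      then have "u \<in> ?K'" using neg by blast
      then obtain k y where ky: "k \<in> K" "y \<in> F" "u = k \<oplus>\<^bsub>M\<^esub> x \<odot>\<^bsub>M\<^esub> y"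
        unfolding add_multiples_iff by blast
      have "r \<odot>\<^bsub>M\<^esub> y \<in> K" if r: "r \<in> ?I" for r
      proof -
        have rc: "r \<in> carrier R" using r by (simp add: colon_def)
        have "r \<odot>\<^bsub>M\<^esub> u = r \<odot>\<^bsub>M\<^esub> k \<oplus>\<^bsub>M\<^esub> x \<odot>\<^bsub>M\<^esub> (r \<odot>\<^bsub>M\<^esub> y)"
          using ky rc x subF subK R.m_comm[OF rc x]
          by (simp add: smult_r_distr smult_assoc1[symmetric])
        moreover have "r \<odot>\<^bsub>M\<^esub> u \<in> K" using u r by (simp add: U_def)
        ultimately have "r \<odot>\<^bsub>M\<^esub> k \<oplus>\<^bsub>M\<^esub> x \<odot>\<^bsub>M\<^esub> (r \<odot>\<^bsub>M\<^esub> y) \<in> K" by simp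
        then have "x \<odot>\<^bsub>M\<^esub> (r \<odot>\<^bsub>M\<^esub> y) \<in> K"
          by (rule submodule_add_cancel[OF K, rotated 2])
            (use ky rc x subF submoduleE(4)[OF K] in auto)
        then show ?thesis using xreg submoduleE(4)[OF F rc ky(2)] by simp
      qed
      then have "y \<in> U" using ky by (simp add: U_def)
      then show "\<exists>k\<in>K. \<exists>y\<in>U. u = k \<oplus>\<^bsub>M\<^esub> x \<odot>\<^bsub>M\<^esub> y" using ky by blast
    qed
    then show False using zU Cons.prems(6) by blast
  qed
  then obtain w where w: "w \<in> U" "w \<notin> ?K'" by blast
  have wF: "w \<in> F" using w by (simp add: U_def)
  have "prime_chain R (colon ?K' {w}) (length xs)"
    by (rule Cons.IH) (use Cons.prems(1,2) K' add_multiples_subset[OF F Cons.prems(4) x] w wF in auto)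
  then obtain P where P: "\<And>i. i \<le> length xs \<Longrightarrow> primeideal (P i) R \<and> colon ?K' {w} \<subseteq> P i"
    and Ps: "\<And>i. i < length xs \<Longrightarrow> P i \<subset> P (Suc i)" unfolding prime_chain_def by blast
  interpret P0: primeideal "P 0" R using P by simp
  have IP: "?I \<subseteq> P i" if "i \<le> length xs" for i
  proof -
    have "?I \<subseteq> colon ?K' {w}"
      using w add_multiples_superset[OF K F x] by (auto simp: U_def colon_def)
    then show ?thesis using P[OF that] by (meson subset_trans)
  qed
  have xP: "x \<in> P 0"
  proof -
    have "x \<in> colon ?K' {w}" using x add_multiples_mult[OF K F x wF] by (simp add: colon_def)
    then show ?thesis using P[of 0] by auto
  qed
  \<comment> \<open>A prime missing \<open>S\<close> is contained in \<open>P 0\<close> and avoids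
    \<open>x\<close>, so it is strictly smaller and can be put in front of the chain.\<close>
  define S where "S = {x [^] n \<otimes> s | (n::nat) s. s \<in> carrier R - P 0}"
  have oneP: "\<one> \<notin> P 0" using P0.one_imp_carrier P0.I_notcarr by blast
  have "\<exists>Q. primeideal Q R \<and> ?I \<subseteq> Q \<and> Q \<inter> S = {}"
  proof (rule exists_prime_avoiding[OF R.is_cring noetherian])
    show "ideal ?I R" using K subF Cons.prems(5) by (intro colon_ideal) auto
    show "S \<subseteq> carrier R" using x by (auto simp: S_def)
    show "\<one> \<in> S" unfolding S_def using oneP x
      by (intro CollectI exI[of _ "0::nat"] exI[of _ \<one>]) simp
    show "s \<otimes> t \<in> S" if st: "s \<in> S" "t \<in> S" for s t
    proof -
      obtain n a m b where e: "s = x [^] (n::nat) \<otimes> a" "t = x [^] (m::nat) \<otimes> b"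
        "a \<in> carrier R" "b \<in> carrier R" "a \<notin> P 0" "b \<notin> P 0" using st by (auto simp: S_def)
      have "s \<otimes> t = x [^] (n + m) \<otimes> (a \<otimes> b)"
        using e x by (simp add: R.m_ac R.nat_pow_mult[symmetric])
      moreover have "a \<otimes> b \<notin> P 0" using e P0.I_prime by blast
      ultimately show ?thesis unfolding S_def using e by blast
    qed
    show "?I \<inter> S = {}"
    proof (rule equals0I)
      fix a assume "a \<in> ?I \<inter> S"
      then obtain n s where a: "a \<in> ?I" "a = x [^] (n::nat) \<otimes> s" "s \<in> carrier R" "s \<notin> P 0"
        by (auto simp: S_def)
      \<comment> \<open>Powers of \<open>x\<close> cancel modulo \<open>K\<close>; hence
        \<open>x^n s \<in> ?I\<close> would force \<open>s \<in> ?I \<subseteq> P 0\<close>.\<close>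
      have "y \<in> K" if "y \<in> F" "x [^] (n::nat) \<odot>\<^bsub>M\<^esub> y \<in> K" for y n
        using that
      proof (induction n arbitrary: y)
        case 0 then show ?case using subF by simp
      next
        case (Suc n)
        have "x [^] n \<odot>\<^bsub>M\<^esub> (x \<odot>\<^bsub>M\<^esub> y) \<in> K" using Suc.prems x subF by (simp add: smult_assoc1)
        then have "x \<odot>\<^bsub>M\<^esub> y \<in> K" using Suc.IH Suc.prems(1) submoduleE(4)[OF F x] by simp
        then show ?case using xreg Suc.prems(1) by simp
      qed
      moreover have "x [^] n \<odot>\<^bsub>M\<^esub> (s \<odot>\<^bsub>M\<^esub> z) \<in> K"
        using a x subF Cons.prems(5) by (simp add: colon_def smult_assoc1)
      ultimately have "s \<odot>\<^bsub>M\<^esub> z \<in> K" using submoduleE(4)[OF F a(3) Cons.prems(5)] by blast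
      then have "s \<in> ?I" using a by (simp add: colon_def)
      then show False using IP[of 0] a by blast
    qed
  qed
  then obtain Q where Q: "primeideal Q R" "?I \<subseteq> Q" "Q \<inter> S = {}" by blast
  have xS: "x \<in> S" unfolding S_def using oneP x
    by (intro CollectI exI[of _ "1::nat"] exI[of _ \<one>]) simp
  have QP: "Q \<subset> P 0"
  proof (rule psubsetI)
    show "Q \<subseteq> P 0"
    proof (rule subsetI, rule ccontr)
      fix a assume a: "a \<in> Q" "a \<notin> P 0"
      then have "a \<in> carrier R" using primeideal.axioms(1)[OF Q(1)] ideal.Icarr by metis
      then have "a \<in> S" unfolding S_def using a
        by (intro CollectI exI[of _ "0::nat"] exI[of _ a]) simp
      then show False using a Q by blast
    qed
    show "Q \<noteq> P 0" using xS xP Q(3) by blast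
  qed
  let ?P = "\<lambda>i. case i of 0 \<Rightarrow> Q | Suc j \<Rightarrow> P j"
  have "primeideal (?P i) R \<and> ?I \<subseteq> ?P i" if "i \<le> length (x # xs)" for i
    using that Q P IP by (cases i) simp_all
  moreover have "?P i \<subset> ?P (Suc i)" if "i < length (x # xs)" for i
    using that QP Ps by (cases i) simp_all
  ultimately show ?case unfolding prime_chain_def by (intro exI[of _ ?P]) simp
qed

text \<open>The elements of \<open>F\<close> that \<open>b\<close> sends into \<open>K\<close> form
  a set closed under division by \<open>a\<close> modulo \<open>K\<close>, so Nakayama places them
  in \<open>K\<close> and \<open>b\<close> is regular first. That \<open>a\<close> stays regular
  modulo \<open>K + b F\<close> needs only cancellation.\<close>

lemma regular_on_swap:
  assumes reg: "regular_on M F K (a # b # xs)" and ab: "a \<in> \<mm>" "b \<in> \<mm>"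
    and K: "submodule K R M" and F: "submodule F R M"
  shows "regular_on M F K (b # a # xs)"
proof -
  note sub = submodule_subset[OF K] submodule_subset[OF F]
  have c: "a \<in> carrier R" "b \<in> carrier R" using ab max_carrier by auto
  have ra: "z \<in> K" if "z \<in> F" "a \<odot>\<^bsub>M\<^esub> z \<in> K" for z using reg that by simp
  have rb: "z \<in> add_multiples M F a K" if "z \<in> F" "b \<odot>\<^bsub>M\<^esub> z \<in> add_multiples M F a K" for z
    using reg that by simp
  define U where "U = {z \<in> F. b \<odot>\<^bsub>M\<^esub> z \<in> K}"
  have comm: "b \<odot>\<^bsub>M\<^esub> (a \<odot>\<^bsub>M\<^esub> y) = a \<odot>\<^bsub>M\<^esub> (b \<odot>\<^bsub>M\<^esub> y)" if "y \<in> F" for y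
    using that c sub R.m_comm[OF c] by (simp add: smult_assoc1[symmetric])
  have "U \<subseteq> K"
  proof (rule nakayama[OF K _ ab(1)])
    show "U \<subseteq> carrier M" using sub by (auto simp: U_def)
    fix u assume u: "u \<in> U"
    then have "u \<in> add_multiples M F a K"
      using rb add_multiples_superset[OF K F c(1)] by (simp add: U_def)
    then obtain k y where ky: "k \<in> K" "y \<in> F" "u = k \<oplus>\<^bsub>M\<^esub> a \<odot>\<^bsub>M\<^esub> y"
      unfolding add_multiples_iff by blast
    have "b \<odot>\<^bsub>M\<^esub> k \<oplus>\<^bsub>M\<^esub> a \<odot>\<^bsub>M\<^esub> (b \<odot>\<^bsub>M\<^esub> y) \<in> K"
      using u ky c sub comm by (simp add: U_def smult_r_distr)
    then have "a \<odot>\<^bsub>M\<^esub> (b \<odot>\<^bsub>M\<^esub> y) \<in> K"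
      by (rule submodule_add_cancel[OF K, rotated 2]) (use ky c sub submoduleE(4)[OF K] in auto)
    then have "y \<in> U" using ra ky submoduleE(4)[OF F c(2)] by (simp add: U_def)
    then show "\<exists>k\<in>K. \<exists>y\<in>U. u = k \<oplus>\<^bsub>M\<^esub> a \<odot>\<^bsub>M\<^esub> y" using ky by blast
  qed
  then have 1: "\<forall>z\<in>F. b \<odot>\<^bsub>M\<^esub> z \<in> K \<longrightarrow> z \<in> K" by (auto simp: U_def)
  have 2: "z \<in> add_multiples M F b K" if z: "z \<in> F" "a \<odot>\<^bsub>M\<^esub> z \<in> add_multiples M F b K" for z
  proof -
    \<comment> \<open>From \<open>a z = k + b w\<close> the regularity of \<open>b\<close> modulo
      \<open>K + a F\<close> gives \<open>w = k' + a w'\<close>; then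
      \<open>a (z - b w') \<in> K\<close>, and \<open>a\<close> cancels.\<close>
    obtain k w where kw: "k \<in> K" "w \<in> F" "a \<odot>\<^bsub>M\<^esub> z = k \<oplus>\<^bsub>M\<^esub> b \<odot>\<^bsub>M\<^esub> w"
      using z unfolding add_multiples_iff by blast
    have "k \<oplus>\<^bsub>M\<^esub> b \<odot>\<^bsub>M\<^esub> w \<in> add_multiples M F a K"
      using add_multiples_mult[OF K F c(1) z(1)] kw by simp
    then have "b \<odot>\<^bsub>M\<^esub> w \<in> add_multiples M F a K"
      by (rule submodule_add_cancel[OF submodule_add_multiples[OF K F c(1)], rotated 2])
        (use kw c sub add_multiples_superset[OF K F c(1)] in auto)
    then have "w \<in> add_multiples M F a K" using rb kw by simp
    then obtain k' w' where kw': "k' \<in> K" "w' \<in> F" "w = k' \<oplus>\<^bsub>M\<^esub> a \<odot>\<^bsub>M\<^esub> w'"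
      unfolding add_multiples_iff by blast
    have cc: "k \<in> carrier M" "k' \<in> carrier M" "w' \<in> carrier M" "z \<in> carrier M" using kw kw' z sub by auto
    let ?v = "z \<ominus>\<^bsub>M\<^esub> b \<odot>\<^bsub>M\<^esub> w'"
    have "a \<odot>\<^bsub>M\<^esub> z = (k \<oplus>\<^bsub>M\<^esub> b \<odot>\<^bsub>M\<^esub> k') \<oplus>\<^bsub>M\<^esub> a \<odot>\<^bsub>M\<^esub> (b \<odot>\<^bsub>M\<^esub> w')"
      using kw kw' cc c comm by (simp add: smult_r_distr M.a_assoc)
    then have "a \<odot>\<^bsub>M\<^esub> ?v = k \<oplus>\<^bsub>M\<^esub> b \<odot>\<^bsub>M\<^esub> k'"
      using cc c by (simp add: a_minus_def smult_r_distr smult_r_minus M.a_assoc M.r_neg)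
    then have "a \<odot>\<^bsub>M\<^esub> ?v \<in> K" using kw kw' c submoduleE(4,5)[OF K] by simp
    moreover have "?v \<in> F" using z kw' c submodule_minus[OF F] submoduleE(4)[OF F] by simp
    ultimately have "?v \<in> K" using ra by simp
    moreover have "z = ?v \<oplus>\<^bsub>M\<^esub> b \<odot>\<^bsub>M\<^esub> w'" using cc c by (simp add: a_minus_def M.a_assoc M.l_neg)
    ultimately show ?thesis using kw' unfolding add_multiples_iff by blast
  qed
  show ?thesis using 1 2 reg add_multiples_commute[OF K F c] by simp
qed

lemma regular_on_rotate:
  assumes "regular_on M F K (xs @ [y])" "set xs \<subseteq> \<mm>" and y: "y \<in> \<mm>"
    and "submodule K R M" and F: "submodule F R M" and "K \<subseteq> F"
  shows "regular_on M F K (y # xs)"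
  using assms(1,2,4,6)
proof (induction xs arbitrary: K)
  case (Cons x xs)
  have xm: "x \<in> \<mm>" and x: "x \<in> carrier R" using Cons.prems(2) max_carrier by auto
  have "regular_on M F (add_multiples M F x K) (y # xs)"
    by (rule Cons.IH)
      (use Cons.prems submodule_add_multiples[OF Cons.prems(3) F x] add_multiples_subset[OF F Cons.prems(4) x] in auto)
  then have "regular_on M F K (x # y # xs)" using Cons.prems(1) by simp
  then show ?case by (rule regular_on_swap[OF _ xm y Cons.prems(3) F])
qed simp

text \<open>At the last position nothing but the quotient by the earlier elements is involved:
  \<open>y z \<in> K\<close> implies \<open>x^q z \<in> K\<close>, hence \<open>z \<in> K\<close>.
  In the middle of a sequence the replacement would also change the later quotients.\<close>

lemma regular_on_replace_last:
  assumes "regular_on M F K (xs @ [x])" "set xs \<subseteq> \<mm>" and x: "x \<in> \<mm>" and y: "y \<in> \<mm>"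
    and d: "d \<in> carrier R" "x [^] (q::nat) = d \<otimes> y"
    and "submodule K R M" and F: "submodule F R M" and "K \<subseteq> F"
  shows "regular_on M F K (xs @ [y])"
  using assms(1,2,7,9)
proof (induction xs arbitrary: K)
  case Nil
  note subF = submodule_subset[OF F]
  have c: "x \<in> carrier R" "y \<in> carrier R" using x y max_carrier by auto
  have reg: "z \<in> K" if "z \<in> F" "x \<odot>\<^bsub>M\<^esub> z \<in> K" for z using Nil(1) that by simp
  have pow: "z \<in> K" if "z \<in> F" "x [^] (n::nat) \<odot>\<^bsub>M\<^esub> z \<in> K" for z n
    using that
  proof (induction n arbitrary: z)
    case 0 then show ?case using subF by simp
  next
    case (Suc n)
    have "x [^] n \<odot>\<^bsub>M\<^esub> (x \<odot>\<^bsub>M\<^esub> z) \<in> K" using Suc.prems c subF by (simp add: smult_assoc1)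
    then have "x \<odot>\<^bsub>M\<^esub> z \<in> K" using Suc.IH Suc.prems(1) submoduleE(4)[OF F c(1)] by simp
    then show ?case using reg Suc.prems(1) by simp
  qed
  have "z \<in> K" if z: "z \<in> F" "y \<odot>\<^bsub>M\<^esub> z \<in> K" for z
  proof (rule pow[OF z(1)])
    show "x [^] q \<odot>\<^bsub>M\<^esub> z \<in> K"
      unfolding d(2) using z c d(1) subF submoduleE(4)[OF Nil(3)] by (simp add: smult_assoc1)
  qed
  \<comment> \<open>If \<open>K + y F = F\<close>, Nakayama gives \<open>F = K\<close>,
    contradicting \<open>K + x F \<noteq> F\<close>.\<close>
  moreover have "add_multiples M F y K \<noteq> F"
  proof
    assume eq: "add_multiples M F y K = F"
    have "F \<subseteq> K"
    proof (rule nakayama[OF Nil(3) _ y])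
      show "F \<subseteq> carrier M" using subF by blast
      show "\<exists>k\<in>K. \<exists>v\<in>F. u = k \<oplus>\<^bsub>M\<^esub> y \<odot>\<^bsub>M\<^esub> v" if "u \<in> F" for u
        using that eq add_multiples_iff[of u M F y K] by simp
    qed
    then have "add_multiples M F x K = F"
      using Nil(4) add_multiples_superset[OF Nil(3) F c(1)] add_multiples_subset[OF F Nil(4) c(1)] by blast
    then show False using Nil(1) by simp
  qed
  ultimately show ?case by simp
next
  case (Cons w xs)
  have w: "w \<in> carrier R" using Cons.prems(2) max_carrier by auto
  have "regular_on M F (add_multiples M F w K) (xs @ [y])"
    by (rule Cons.IH)
      (use Cons.prems submodule_add_multiples[OF Cons.prems(3) F w] add_multiples_subset[OF F Cons.prems(4) w] in auto)
  then show ?case using Cons.prems(1) by simp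
qed

text \<open>Only the radical of the last element of a regular sequence matters, so the elements can be replaced
  one after the other at the end and rotated to the front.\<close>

lemma regular_on_map:
  assumes "regular_on M F K (ys @ xs)" "set ys \<subseteq> \<mm>" "set xs \<subseteq> \<mm>"
    and f: "\<And>x. x \<in> \<mm> \<Longrightarrow> f x \<in> \<mm>" "\<And>x. x \<in> \<mm> \<Longrightarrow> \<exists>d\<in>carrier R. \<exists>q::nat. x [^] q = d \<otimes> f x"
    and K: "submodule K R M" and F: "submodule F R M" and KF: "K \<subseteq> F"
  shows "regular_on M F K (map f xs @ ys)"
  using assms(1-3)
\<comment> \<open>\<open>ys\<close> holds the elements already replaced and moved to the front, so
  the last element of the whole list is always the next one to replace.\<close>
proof (induction xs arbitrary: ys rule: rev_induct)
  case (snoc x xs)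
  have x: "x \<in> \<mm>" using snoc.prems by simp
  obtain d q where d: "d \<in> carrier R" "x [^] (q::nat) = d \<otimes> f x" using f(2)[OF x] by blast
  have "regular_on M F K ((ys @ xs) @ [f x])"
    by (rule regular_on_replace_last[OF _ _ x f(1)[OF x] d K F KF]) (use snoc.prems in auto)
  then have "regular_on M F K (f x # (ys @ xs))"
    by (rule regular_on_rotate[OF _ _ f(1)[OF x] K F KF]) (use snoc.prems in auto)
  then have "regular_on M F K (map f xs @ (f x # ys))"
    by (intro snoc.IH) (use snoc.prems f(1)[OF x] in auto)
  then show ?case by simp
qed simp

end

section \<open>Quotient modules and filtrations\<close>

text \<open>\<open>Q\<close> is presented as \<open>F / K\<close> by a linear surjection
  \<open>p\<close> on \<open>F\<close> with kernel \<open>K\<close>. The coset construction enters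
  only through \<open>quotient_module_is_quotient\<close>.\<close>

locale module_quotient = M: module R M + Q: module R Q
  for R (structure) and M (structure) and Q (structure) +
  fixes F K and p
  assumes F: "submodule F R M" and K: "submodule K R M" and KF: "K \<subseteq> F"
    and surj: "p ` F = carrier Q"
    and p_add: "x \<in> F \<Longrightarrow> y \<in> F \<Longrightarrow> p (x \<oplus>\<^bsub>M\<^esub> y) = p x \<oplus>\<^bsub>Q\<^esub> p y"
    and p_smult: "r \<in> carrier R \<Longrightarrow> x \<in> F \<Longrightarrow> p (r \<odot>\<^bsub>M\<^esub> x) = r \<odot>\<^bsub>Q\<^esub> p x"
    and p_zero_iff: "x \<in> F \<Longrightarrow> p x = \<zero>\<^bsub>Q\<^esub> \<longleftrightarrow> x \<in> K"
begin

lemma p_closed: "x \<in> F \<Longrightarrow> p x \<in> carrier Q"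
  using surj by blast

lemma F_closed: "x \<in> F \<Longrightarrow> y \<in> F \<Longrightarrow> x \<oplus>\<^bsub>M\<^esub> y \<in> F" "r \<in> carrier R \<Longrightarrow> x \<in> F \<Longrightarrow> r \<odot>\<^bsub>M\<^esub> x \<in> F"
  using M.submoduleE(4,5)[OF F] by blast+

text \<open>Two elements of \<open>F\<close> with the same image differ by an element of the kernel
  \<open>K\<close>, and \<open>K \<subseteq> H\<close>.\<close>

lemma p_mem_image:
  assumes H: "submodule H R M" "K \<subseteq> H" "H \<subseteq> F" and z: "z \<in> F"
  shows "p z \<in> p ` H \<longleftrightarrow> z \<in> H"
proof
  assume "p z \<in> p ` H"
  then obtain h where h: "h \<in> H" "p z = p h" by blast
  have c: "h \<in> F" "h \<in> carrier M" "z \<in> carrier M" "\<ominus>\<^bsub>M\<^esub> h \<in> F"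
    using h H z M.submodule_subset[OF F] M.submoduleE(3)[OF F] by auto
  have "p (\<ominus>\<^bsub>M\<^esub> h \<oplus>\<^bsub>M\<^esub> z) = p (\<ominus>\<^bsub>M\<^esub> h \<oplus>\<^bsub>M\<^esub> h)" using p_add c z h(2) by metis
  also have "\<dots> = \<zero>\<^bsub>Q\<^esub>"
    using c M.submodule_zero[OF F] M.submodule_zero[OF K] p_zero_iff by (simp add: M.M.l_neg)
  finally have "\<ominus>\<^bsub>M\<^esub> h \<oplus>\<^bsub>M\<^esub> z \<in> K" using p_zero_iff F_closed(1) c z by blast
  then have "h \<oplus>\<^bsub>M\<^esub> (\<ominus>\<^bsub>M\<^esub> h \<oplus>\<^bsub>M\<^esub> z) \<in> H" using H h M.submoduleE(5)[OF H(1)] by blast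
  then show "z \<in> H" using c by (simp add: M.M.r_neg2)
qed (rule imageI)

lemma image_add_multiples:
  assumes "H \<subseteq> F" "x \<in> carrier R"
  shows "p ` add_multiples M F x H = add_multiples Q (carrier Q) x (p ` H)"
proof (intro equalityI subsetI)
  fix q assume "q \<in> p ` add_multiples M F x H"
  then obtain k z where e: "k \<in> H" "z \<in> F" "q = p (k \<oplus>\<^bsub>M\<^esub> x \<odot>\<^bsub>M\<^esub> z)" by (auto simp: add_multiples_iff)
  then have "q = p k \<oplus>\<^bsub>Q\<^esub> x \<odot>\<^bsub>Q\<^esub> p z" using p_add p_smult F_closed(2) assms by auto
  then show "q \<in> add_multiples Q (carrier Q) x (p ` H)"
    unfolding add_multiples_iff using e p_closed by blast
next
  fix q assume "q \<in> add_multiples Q (carrier Q) x (p ` H)"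
  then obtain k z where e: "k \<in> H" "z \<in> F" "q = p k \<oplus>\<^bsub>Q\<^esub> x \<odot>\<^bsub>Q\<^esub> p z"
    unfolding add_multiples_iff surj[symmetric] by blast
  then have "q = p (k \<oplus>\<^bsub>M\<^esub> x \<odot>\<^bsub>M\<^esub> z)" using p_add p_smult F_closed(2) assms by auto
  then show "q \<in> p ` add_multiples M F x H"
    using e add_multiples_iff[of _ M F x H] by blast
qed

text \<open>Needed for every \<open>H\<close> between \<open>K\<close> and \<open>F\<close>, because
  the base submodule grows along the sequence.\<close>

lemma regular_on_image:
  assumes "submodule H R M" "K \<subseteq> H" "H \<subseteq> F" "set xs \<subseteq> carrier R"
  shows "regular_on Q (carrier Q) (p ` H) xs \<longleftrightarrow> regular_on M F H xs"
  using assms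
proof (induction xs arbitrary: H)
  case Nil
  have "p ` H = carrier Q \<longleftrightarrow> H = F"
  proof
    assume eq: "p ` H = carrier Q"
    have "z \<in> H" if "z \<in> F" for z using p_mem_image[OF Nil(1-3) that] eq p_closed[OF that] by simp
    then show "H = F" using Nil by blast
  qed (simp add: surj)
  then show ?case by simp
next
  case (Cons x xs)
  note H = Cons.prems(1-3)
  have x: "x \<in> carrier R" using Cons.prems by simp
  have "(\<forall>z\<in>carrier Q. x \<odot>\<^bsub>Q\<^esub> z \<in> p ` H \<longrightarrow> z \<in> p ` H) \<longleftrightarrow>
        (\<forall>z\<in>F. p (x \<odot>\<^bsub>M\<^esub> z) \<in> p ` H \<longrightarrow> p z \<in> p ` H)"
    unfolding surj[symmetric] by (simp add: p_smult[OF x])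
  also have "\<dots> \<longleftrightarrow> (\<forall>z\<in>F. x \<odot>\<^bsub>M\<^esub> z \<in> H \<longrightarrow> z \<in> H)"
    using p_mem_image[OF H] F_closed(2)[OF x] by simp
  moreover have "regular_on Q (carrier Q) (p ` add_multiples M F x H) xs \<longleftrightarrow>
      regular_on M F (add_multiples M F x H) xs"
  proof (rule Cons.IH)
    show "submodule (add_multiples M F x H) R M" by (rule M.submodule_add_multiples[OF H(1) F x])
    show "K \<subseteq> add_multiples M F x H" using M.add_multiples_superset[OF H(1) F x] H(2) by blast
    show "add_multiples M F x H \<subseteq> F" by (rule M.add_multiples_subset[OF F H(3) x])
  qed (use Cons.prems in simp)
  ultimately show ?case by (simp add: image_add_multiples[OF H(3) x])
qed

lemma image_K: "p ` K = {\<zero>\<^bsub>Q\<^esub>}"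
proof -
  have "\<zero>\<^bsub>M\<^esub> \<in> K" using M.submodule_zero[OF K] .
  moreover have "p x = \<zero>\<^bsub>Q\<^esub>" if "x \<in> K" for x using that KF p_zero_iff by blast
  ultimately show ?thesis by force
qed

lemma annihilator_eq: "module_annihilator R Q = M.colon K F"
proof -
  have "(\<forall>x\<in>carrier Q. r \<odot>\<^bsub>Q\<^esub> x = \<zero>\<^bsub>Q\<^esub>) \<longleftrightarrow> (\<forall>x\<in>F. r \<odot>\<^bsub>M\<^esub> x \<in> K)" if r: "r \<in> carrier R" for r
    unfolding surj[symmetric] using p_zero_iff F_closed(2)[OF r] by (simp add: p_smult[OF r, symmetric])
  then show ?thesis by (auto simp: module_annihilator_def M.colon_def)
qed

lemma fin_gen_quotient:
  assumes "noetherian_module R M"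
  shows "fin_gen_module R Q"
proof -
  obtain T where T: "finite T" "T \<subseteq> F" "module_span R M T = F"
    using assms F unfolding noetherian_module_def by blast
  have pT: "p ` T \<subseteq> carrier Q" using T p_closed by blast
  have "carrier Q \<subseteq> H" if H: "submodule H R Q" "p ` T \<subseteq> H" for H
  proof -
    let ?G = "{x \<in> F. p x \<in> H}"
    have "submodule ?G R M"
    proof (rule M.submoduleI)
      show "?G \<subseteq> carrier M" using M.submodule_subset[OF F] by blast
      show z: "\<zero>\<^bsub>M\<^esub> \<in> ?G" using M.submodule_zero[OF F] Q.submodule_zero[OF H(1)]
          p_zero_iff[OF M.submodule_zero[OF F]] M.submodule_zero[OF K] by simp
      show s: "a \<odot>\<^bsub>M\<^esub> x \<in> ?G" if "a \<in> carrier R" "x \<in> ?G" for a x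
        using that F_closed(2) p_smult Q.submoduleE(4)[OF H(1)] by simp
      show "a \<oplus>\<^bsub>M\<^esub> b \<in> ?G" if "a \<in> ?G" "b \<in> ?G" for a b
        using that F_closed(1) p_add Q.submoduleE(5)[OF H(1)] by simp
      show "\<ominus>\<^bsub>M\<^esub> a \<in> ?G" if a: "a \<in> ?G" for a
      proof -
        have "\<ominus>\<^bsub>M\<^esub> a = (\<ominus> \<one>) \<odot>\<^bsub>M\<^esub> a" using a M.submodule_subset[OF F] by (simp add: M.smult_l_minus)
        then show ?thesis using s[of "\<ominus> \<one>" a] a by simp
      qed
    qed
    moreover have "T \<subseteq> ?G" using T H by blast
    ultimately have "F \<subseteq> ?G" using M.span_minimal T(3) by blast
    then have "p ` F \<subseteq> H" by auto
    then show ?thesis using surj by simp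
  qed
  then have "carrier Q \<subseteq> module_span R Q (p ` T)" by (auto simp: module_span_def)
  moreover have "module_span R Q (p ` T) \<subseteq> carrier Q" by (rule Q.span_minimal[OF Q.carrier_is_submodule pT])
  ultimately have "module_span R Q (p ` T) = carrier Q" by blast
  then show ?thesis
    unfolding fin_gen_module_def using T(1) pT Q.module_axioms by blast
qed

end

section \<open>Indexed regular sequences and quotients by cosets\<close>

context module
begin

lemma seq_multiples_Nil: "seq_multiples R M [] = {\<zero>\<^bsub>M\<^esub>}"
proof -
  have "module_span R M {} \<subseteq> {\<zero>\<^bsub>M\<^esub>}" by (rule span_minimal[OF submodule_zero_singleton]) simp
  moreover have "\<zero>\<^bsub>M\<^esub> \<in> module_span R M {}" by (rule submodule_zero[OF submodule_span]) simp
  ultimately show ?thesis by (auto simp: seq_multiples_def)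
qed

lemma submodule_seq_multiples:
  assumes "set xs \<subseteq> carrier R"
  shows "submodule (seq_multiples R M xs) R M"
  unfolding seq_multiples_def by (rule submodule_span) (use assms in auto)

lemma seq_multiples_snoc:
  assumes "set (xs @ [x]) \<subseteq> carrier R"
  shows "seq_multiples R M (xs @ [x]) = add_multiples M (carrier M) x (seq_multiples R M xs)"
proof -
  have x: "x \<in> carrier R" and xs: "set xs \<subseteq> carrier R" using assms by auto
  note S = submodule_seq_multiples[OF xs] and S' = submodule_seq_multiples[OF assms]
  note C = carrier_is_submodule
  have gen: "y \<odot>\<^bsub>M\<^esub> z \<in> seq_multiples R M ys" if "y \<in> set ys" "z \<in> carrier M" for y z ys
    unfolding seq_multiples_def by (rule subsetD[OF span_superset]) (use that in blast)
  show ?thesis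
  proof
    show "seq_multiples R M (xs @ [x]) \<subseteq> add_multiples M (carrier M) x (seq_multiples R M xs)"
      unfolding seq_multiples_def[of _ _ "xs @ [x]"]
    proof (rule span_minimal[OF submodule_add_multiples[OF S C x]], rule subsetI)
      fix v assume "v \<in> {y \<odot>\<^bsub>M\<^esub> z |y z. y \<in> set (xs @ [x]) \<and> z \<in> carrier M}"
      then obtain y z where v: "v = y \<odot>\<^bsub>M\<^esub> z" "y \<in> set (xs @ [x])" "z \<in> carrier M" by blast
      show "v \<in> add_multiples M (carrier M) x (seq_multiples R M xs)"
      proof (cases "y = x")
        case True then show ?thesis using add_multiples_mult[OF S C x v(3)] v(1) by simp
      next
        case False
        then have "v \<in> seq_multiples R M xs" using gen v by simp
        then show ?thesis by (rule add_multiples_superset[OF S C x])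
      qed
    qed
    have "{y \<odot>\<^bsub>M\<^esub> z |y z. y \<in> set xs \<and> z \<in> carrier M} \<subseteq> seq_multiples R M (xs @ [x])"
    proof
      fix v assume "v \<in> {y \<odot>\<^bsub>M\<^esub> z |y z. y \<in> set xs \<and> z \<in> carrier M}"
      then obtain y z where "v = y \<odot>\<^bsub>M\<^esub> z" "y \<in> set xs" "z \<in> carrier M" by blast
      then show "v \<in> seq_multiples R M (xs @ [x])" using gen[of y "xs @ [x]" z] by simp
    qed
    then have "seq_multiples R M xs \<subseteq> seq_multiples R M (xs @ [x])"
      unfolding seq_multiples_def[of _ _ xs] by (rule span_minimal[OF S'])
    then show "add_multiples M (carrier M) x (seq_multiples R M xs) \<subseteq> seq_multiples R M (xs @ [x])"
    proof (intro subsetI)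
      fix v assume sub: "seq_multiples R M xs \<subseteq> seq_multiples R M (xs @ [x])"
        and "v \<in> add_multiples M (carrier M) x (seq_multiples R M xs)"
      then obtain k z where v: "k \<in> seq_multiples R M xs" "z \<in> carrier M" "v = k \<oplus>\<^bsub>M\<^esub> x \<odot>\<^bsub>M\<^esub> z"
        unfolding add_multiples_iff by blast
      show "v \<in> seq_multiples R M (xs @ [x])"
        unfolding v(3) by (rule submoduleE(5)[OF S' subsetD[OF sub v(1)] gen[OF _ v(2)]]) simp
    qed
  qed
qed

text \<open>The list \<open>ys\<close> is the prefix already divided out; it turns the indexed
  condition into the recursive one.\<close>

lemma regular_on_seq_multiples:
  assumes "set (ys @ xs) \<subseteq> carrier R"
  shows "regular_on M (carrier M) (seq_multiples R M ys) xs \<longleftrightarrow>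
    (\<forall>i < length xs. \<forall>z \<in> carrier M. (xs ! i) \<odot>\<^bsub>M\<^esub> z \<in> seq_multiples R M (ys @ take i xs)
        \<longrightarrow> z \<in> seq_multiples R M (ys @ take i xs)) \<and>
     seq_multiples R M (ys @ xs) \<noteq> carrier M"
  using assms
proof (induction xs arbitrary: ys)
  case (Cons x xs)
  have "regular_on M (carrier M) (seq_multiples R M ys) (x # xs) \<longleftrightarrow>
    (\<forall>z\<in>carrier M. x \<odot>\<^bsub>M\<^esub> z \<in> seq_multiples R M ys \<longrightarrow> z \<in> seq_multiples R M ys) \<and>
    regular_on M (carrier M) (seq_multiples R M (ys @ [x])) xs"
    using Cons.prems by (simp add: seq_multiples_snoc)
  also have "regular_on M (carrier M) (seq_multiples R M (ys @ [x])) xs \<longleftrightarrow>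
    (\<forall>i < length xs. \<forall>z \<in> carrier M. (xs ! i) \<odot>\<^bsub>M\<^esub> z \<in> seq_multiples R M ((ys @ [x]) @ take i xs)
        \<longrightarrow> z \<in> seq_multiples R M ((ys @ [x]) @ take i xs)) \<and>
     seq_multiples R M ((ys @ [x]) @ xs) \<noteq> carrier M"
    by (rule Cons.IH) (use Cons.prems in simp)
  finally show ?case by (simp add: All_less_Suc2 conj_assoc)
qed simp

lemma regular_sequence_iff:
  "regular_sequence R M xs \<longleftrightarrow> set xs \<subseteq> carrier R \<and> regular_on M (carrier M) {\<zero>\<^bsub>M\<^esub>} xs"
  unfolding regular_sequence_def
  using regular_on_seq_multiples[of "[]" xs] by (auto simp: seq_multiples_Nil)

lemma coset_iff: "u \<in> K +>\<^bsub>M\<^esub> x \<longleftrightarrow> (\<exists>k\<in>K. u = k \<oplus>\<^bsub>M\<^esub> x)"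
  by (auto simp: a_r_coset_def r_coset_def)

lemma coset_eqI:
  assumes K: "submodule K R M" and "k \<in> K" "x \<in> carrier M" "y = k \<oplus>\<^bsub>M\<^esub> x"
  shows "K +>\<^bsub>M\<^esub> y = K +>\<^bsub>M\<^esub> x"
proof (intro equalityI subsetI)
  note sub = submodule_subset[OF K]
  fix u
  show "u \<in> K +>\<^bsub>M\<^esub> x" if "u \<in> K +>\<^bsub>M\<^esub> y"
  proof -
    obtain h where "h \<in> K" "u = h \<oplus>\<^bsub>M\<^esub> y" using \<open>u \<in> K +>\<^bsub>M\<^esub> y\<close> unfolding coset_iff by blast
    then have "u = (h \<oplus>\<^bsub>M\<^esub> k) \<oplus>\<^bsub>M\<^esub> x" "h \<oplus>\<^bsub>M\<^esub> k \<in> K"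
      using assms sub submoduleE(5)[OF K] by (simp_all add: M.a_assoc)
    then show ?thesis unfolding coset_iff by blast
  qed
  show "u \<in> K +>\<^bsub>M\<^esub> y" if "u \<in> K +>\<^bsub>M\<^esub> x"
  proof -
    obtain h where h: "h \<in> K" "u = h \<oplus>\<^bsub>M\<^esub> x" using \<open>u \<in> K +>\<^bsub>M\<^esub> x\<close> unfolding coset_iff by blast
    have "(h \<ominus>\<^bsub>M\<^esub> k) \<oplus>\<^bsub>M\<^esub> (k \<oplus>\<^bsub>M\<^esub> x) = h \<oplus>\<^bsub>M\<^esub> x"
      using h assms sub by (simp add: a_minus_def M.a_assoc M.r_neg1)
    then have "u = (h \<ominus>\<^bsub>M\<^esub> k) \<oplus>\<^bsub>M\<^esub> y" using h assms by simp
    then show ?thesis unfolding coset_iff using submodule_minus[OF K] h assms by blast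
  qed
qed

lemma coset_eqD:
  assumes K: "submodule K R M" and "x \<in> carrier M" "K +>\<^bsub>M\<^esub> x = K +>\<^bsub>M\<^esub> y"
  shows "\<exists>k\<in>K. x = k \<oplus>\<^bsub>M\<^esub> y"
proof -
  have "x \<in> K +>\<^bsub>M\<^esub> x" unfolding coset_iff using submodule_zero[OF K] assms(2) by (metis M.l_zero)
  then show ?thesis using assms(3) coset_iff by simp
qed

lemma quotient_module_is_quotient:
  assumes F: "submodule F R M" and K: "submodule K R M" and KF: "K \<subseteq> F"
  shows "module_quotient R M (quotient_module (M\<lparr>carrier := F\<rparr>) K) F K (\<lambda>x. K +>\<^bsub>M\<^esub> x)"
proof -
  let ?Q = "quotient_module (M\<lparr>carrier := F\<rparr>) K" and ?p = "\<lambda>x. K +>\<^bsub>M\<^esub> x"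
  note sub = submodule_subset[OF F] submodule_subset[OF K]
  note Fc = submoduleE(3-5)[OF F]
  \<comment> \<open>Cosets are computed from the addition alone, so restricting the carrier to
    \<open>F\<close> does not change them.\<close>
  have coset: "K +>\<^bsub>M\<lparr>carrier := F\<rparr>\<^esub> x = ?p x" for x by (simp add: a_r_coset_def r_coset_def)
  have carr: "carrier ?Q = ?p ` F"
    by (auto simp: quotient_module_def A_RCOSETS_def RCOSETS_def a_r_coset_def r_coset_def)
  have add: "?p x \<oplus>\<^bsub>?Q\<^esub> ?p y = ?p (x \<oplus>\<^bsub>M\<^esub> y)" if xy: "x \<in> F" "y \<in> F" for x y
  proof -
    have "?p x \<oplus>\<^bsub>?Q\<^esub> ?p y = {u \<oplus>\<^bsub>M\<^esub> v | u v. u \<in> ?p x \<and> v \<in> ?p y}"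
      by (auto simp: quotient_module_def set_add_def set_mult_def)
    also have "\<dots> = ?p (x \<oplus>\<^bsub>M\<^esub> y)"
    proof (intro equalityI subsetI)
      fix w assume "w \<in> {u \<oplus>\<^bsub>M\<^esub> v | u v. u \<in> ?p x \<and> v \<in> ?p y}"
      then obtain h k where hk: "h \<in> K" "k \<in> K" "w = (h \<oplus>\<^bsub>M\<^esub> x) \<oplus>\<^bsub>M\<^esub> (k \<oplus>\<^bsub>M\<^esub> y)"
        unfolding coset_iff by blast
      then have "w = (h \<oplus>\<^bsub>M\<^esub> k) \<oplus>\<^bsub>M\<^esub> (x \<oplus>\<^bsub>M\<^esub> y)" using xy sub by (simp add: M.add.m_ac)
      then show "w \<in> ?p (x \<oplus>\<^bsub>M\<^esub> y)" unfolding coset_iff using submoduleE(5)[OF K] hk by blast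
    next
      fix w assume "w \<in> ?p (x \<oplus>\<^bsub>M\<^esub> y)"
      then obtain k where k: "k \<in> K" "w = k \<oplus>\<^bsub>M\<^esub> (x \<oplus>\<^bsub>M\<^esub> y)" unfolding coset_iff by blast
      then have w: "w = (k \<oplus>\<^bsub>M\<^esub> x) \<oplus>\<^bsub>M\<^esub> (\<zero>\<^bsub>M\<^esub> \<oplus>\<^bsub>M\<^esub> y)" using xy sub by (simp add: M.a_assoc)
      have "k \<oplus>\<^bsub>M\<^esub> x \<in> ?p x" "\<zero>\<^bsub>M\<^esub> \<oplus>\<^bsub>M\<^esub> y \<in> ?p y"
        unfolding coset_iff using k submodule_zero[OF K] by blast+
      then show "w \<in> {u \<oplus>\<^bsub>M\<^esub> v | u v. u \<in> ?p x \<and> v \<in> ?p y}" using w by blast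
    qed
    finally show ?thesis .
  qed
  have smult: "r \<odot>\<^bsub>?Q\<^esub> ?p x = ?p (r \<odot>\<^bsub>M\<^esub> x)" if rx: "r \<in> carrier R" "x \<in> F" for r x
  proof -
    have "?p (r \<odot>\<^bsub>M\<^esub> u) = ?p (r \<odot>\<^bsub>M\<^esub> x)" if u: "u \<in> ?p x" for u
    proof -
      obtain k where k: "k \<in> K" "u = k \<oplus>\<^bsub>M\<^esub> x" using u unfolding coset_iff by blast
      show ?thesis
      proof (rule coset_eqI[OF K])
        show "r \<odot>\<^bsub>M\<^esub> k \<in> K" using submoduleE(4)[OF K] k rx by blast
        show "r \<odot>\<^bsub>M\<^esub> u = r \<odot>\<^bsub>M\<^esub> k \<oplus>\<^bsub>M\<^esub> r \<odot>\<^bsub>M\<^esub> x" using k rx sub by (simp add: smult_r_distr)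
      qed (use rx sub in auto)
    qed
    moreover have "\<zero>\<^bsub>M\<^esub> \<oplus>\<^bsub>M\<^esub> x \<in> ?p x" unfolding coset_iff using submodule_zero[OF K] by blast
    moreover have "r \<odot>\<^bsub>?Q\<^esub> ?p x = (\<Union>u\<in>?p x. ?p (r \<odot>\<^bsub>M\<^esub> u))"
      by (simp add: quotient_module_def coset)
    ultimately show ?thesis by blast
  qed
  have zero: "\<zero>\<^bsub>?Q\<^esub> = ?p \<zero>\<^bsub>M\<^esub>"
    using sub by (auto simp: quotient_module_def coset_iff intro!: bexI)
  have Fz: "\<zero>\<^bsub>M\<^esub> \<in> F" using submodule_zero[OF F] .
  have mod: "module R ?Q"
  proof (rule moduleI[OF R.is_cring])
    show "abelian_group ?Q"
    proof (rule abelian_groupI)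
      fix x y z assume "x \<in> carrier ?Q" "y \<in> carrier ?Q" "z \<in> carrier ?Q"
      then obtain a b c where e: "a \<in> F" "b \<in> F" "c \<in> F" "x = ?p a" "y = ?p b" "z = ?p c"
        unfolding carr by blast
      show "x \<oplus>\<^bsub>?Q\<^esub> y \<in> carrier ?Q" using e Fc by (simp add: add carr)
      show "x \<oplus>\<^bsub>?Q\<^esub> y \<oplus>\<^bsub>?Q\<^esub> z = x \<oplus>\<^bsub>?Q\<^esub> (y \<oplus>\<^bsub>?Q\<^esub> z)"
        using e Fc sub by (simp add: add M.a_assoc)
      show "x \<oplus>\<^bsub>?Q\<^esub> y = y \<oplus>\<^bsub>?Q\<^esub> x" using e sub by (simp add: add M.a_comm)
      show "\<zero>\<^bsub>?Q\<^esub> \<oplus>\<^bsub>?Q\<^esub> x = x" using e sub Fz by (simp add: add zero)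
      show "\<exists>y\<in>carrier ?Q. y \<oplus>\<^bsub>?Q\<^esub> x = \<zero>\<^bsub>?Q\<^esub>"
        using e Fc sub by (intro bexI[of _ "?p (\<ominus>\<^bsub>M\<^esub> a)"]) (simp_all add: add zero carr M.l_neg)
    next
      show "\<zero>\<^bsub>?Q\<^esub> \<in> carrier ?Q" unfolding zero carr using Fz by blast
    qed
  next
    fix r s x y assume rs: "r \<in> carrier R" "s \<in> carrier R" and "x \<in> carrier ?Q" "y \<in> carrier ?Q"
    then obtain a b where e: "a \<in> F" "b \<in> F" "x = ?p a" "y = ?p b" unfolding carr by blast
    show "r \<odot>\<^bsub>?Q\<^esub> x \<in> carrier ?Q" using e rs Fc by (simp add: smult carr)
    show "(r \<oplus> s) \<odot>\<^bsub>?Q\<^esub> x = r \<odot>\<^bsub>?Q\<^esub> x \<oplus>\<^bsub>?Q\<^esub> s \<odot>\<^bsub>?Q\<^esub> x"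
      using e rs Fc sub by (simp add: smult add smult_l_distr)
    show "r \<odot>\<^bsub>?Q\<^esub> (x \<oplus>\<^bsub>?Q\<^esub> y) = r \<odot>\<^bsub>?Q\<^esub> x \<oplus>\<^bsub>?Q\<^esub> r \<odot>\<^bsub>?Q\<^esub> y"
      using e rs Fc sub by (simp add: smult add smult_r_distr)
    show "(r \<otimes> s) \<odot>\<^bsub>?Q\<^esub> x = r \<odot>\<^bsub>?Q\<^esub> (s \<odot>\<^bsub>?Q\<^esub> x)"
      using e rs Fc sub by (simp add: smult smult_assoc1)
  next
    fix x assume "x \<in> carrier ?Q"
    then obtain a where e: "a \<in> F" "x = ?p a" unfolding carr by blast
    then show "\<one> \<odot>\<^bsub>?Q\<^esub> x = x" using sub by (simp add: smult)
  qed
  have "?p x = \<zero>\<^bsub>?Q\<^esub> \<longleftrightarrow> x \<in> K" if x: "x \<in> F" for x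
  proof
    assume "?p x = \<zero>\<^bsub>?Q\<^esub>"
    then obtain k where "k \<in> K" "x = k \<oplus>\<^bsub>M\<^esub> \<zero>\<^bsub>M\<^esub>"
      using coset_eqD[OF K, of x "\<zero>\<^bsub>M\<^esub>"] x sub zero by auto
    then show "x \<in> K" using sub by simp
  next
    assume "x \<in> K"
    then show "?p x = \<zero>\<^bsub>?Q\<^esub>" unfolding zero using coset_eqI[OF K, of x "\<zero>\<^bsub>M\<^esub>" x] sub by simp
  qed
  then show ?thesis
    using mod module_axioms F K KF carr add smult
    by (intro module_quotient.intro module_quotient_axioms.intro) simp_all
qed

end

section \<open>Cohen-Macaulay factors and filtrations inside a module\<close>

definition depth_on :: "('a, 'm, 's) module_scheme \<Rightarrow> 'a set \<Rightarrow> 'm set \<Rightarrow> 'm set \<Rightarrow> enat" where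
  "depth_on M I F K = Sup {enat (length xs) | xs. set xs \<subseteq> I \<and> regular_on M F K xs}"

context local_noetherian_module
begin

lemma noetherian_fin_gen: "fin_gen_module R M"
proof -
  obtain T where "finite T" "T \<subseteq> carrier M" "module_span R M T = carrier M"
    using noetherian_M carrier_is_submodule unfolding noetherian_module_def by blast
  then show ?thesis unfolding fin_gen_module_def using module_axioms by blast
qed

lemma factor_dim:
  assumes "submodule F R M" "submodule K R M" "K \<subseteq> F"
  shows "module_dim R (quotient_module (M\<lparr>carrier := F\<rparr>) K) = ideal_dim R (colon K F)"
  using module_quotient.annihilator_eq[OF quotient_module_is_quotient[OF assms]] by (simp add: module_dim_eq)

lemma factor_cohen_macaulay_iff:
  assumes "submodule F R M" "submodule K R M" "K \<subseteq> F"
  shows "cohen_macaulay R (quotient_module (M\<lparr>carrier := F\<rparr>) K) \<longleftrightarrow>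
    depth_on M \<mm> F K = ideal_dim R (colon K F)"
proof -
  interpret Q: module_quotient R M "quotient_module (M\<lparr>carrier := F\<rparr>) K" F K "\<lambda>x. K +>\<^bsub>M\<^esub> x"
    by (rule quotient_module_is_quotient[OF assms])
  let ?Q = "quotient_module (M\<lparr>carrier := F\<rparr>) K"
  have reg: "regular_sequence R ?Q xs \<longleftrightarrow> regular_on M F K xs" if "set xs \<subseteq> \<mm>" for xs
  proof -
    have c: "set xs \<subseteq> carrier R" using that max_ideal(2) by blast
    show ?thesis using Q.regular_on_image[OF assms(2) order_refl assms(3) c] c
      by (simp add: Q.Q.regular_sequence_iff Q.image_K)
  qed
  have "module_depth R \<mm> ?Q = depth_on M \<mm> F K"
    unfolding module_depth_def depth_on_def using reg by metis
  \<comment> \<open>\<open>cohen_macaulay\<close> asks for some maximal ideal; by uniqueness it can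
    only be \<open>\<mm>\<close>.\<close>
  moreover have "\<mm>' = \<mm>" if "local_ring R \<mm>'" for \<mm>'
    using that local by (simp add: local_ring_def)
  ultimately show ?thesis
    unfolding cohen_macaulay_def factor_dim[OF assms]
    using noetherian local Q.fin_gen_quotient[OF noetherian_M] by metis
qed

text \<open>The filtration demanded by \<open>sequentially_cohen_macaulay\<close>, with depth and
  dimension of the factors measured by pairs of submodules of \<open>M\<close>. This is the form in
  which filtrations of two different modules are compared.\<close>

definition cm_filtration :: "nat \<Rightarrow> (nat \<Rightarrow> 'c set) \<Rightarrow> bool" where
  "cm_filtration r F \<longleftrightarrow> F 0 = {\<zero>\<^bsub>M\<^esub>} \<and> F r = carrier M \<and>
     (\<forall>i\<le>r. submodule (F i) R M) \<and> (\<forall>i<r. F i \<subset> F (Suc i)) \<and>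
     (\<forall>i<r. depth_on M \<mm> (F (Suc i)) (F i) = ideal_dim R (colon (F i) (F (Suc i)))) \<and>
     (\<forall>i. Suc i < r \<longrightarrow> ideal_dim R (colon (F i) (F (Suc i))) <
        ideal_dim R (colon (F (Suc i)) (F (Suc (Suc i)))))"

lemma cm_filtration_cong:
  assumes F: "cm_filtration r F" and eq: "\<And>i. i \<le> r \<Longrightarrow> F i = F' i"
  shows "cm_filtration r F'"
  unfolding cm_filtration_def
proof (intro conjI allI impI)
  show "F' 0 = {\<zero>\<^bsub>M\<^esub>}" "F' r = carrier M"
    using F eq[of 0] eq[of r] unfolding cm_filtration_def by simp_all
next
  fix i assume i: "i \<le> r"
  show "submodule (F' i) R M" using F eq[OF i] i unfolding cm_filtration_def by metis
next
  fix i assume i: "i < r"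
  then have e: "F' i = F i" "F' (Suc i) = F (Suc i)" using eq by simp_all
  show "F' i \<subset> F' (Suc i)" using F i unfolding cm_filtration_def e by blast
  show "depth_on M \<mm> (F' (Suc i)) (F' i) = ideal_dim R (colon (F' i) (F' (Suc i)))"
    using F i unfolding cm_filtration_def e by blast
next
  fix i assume i: "Suc i < r"
  then have e: "F' i = F i" "F' (Suc i) = F (Suc i)" "F' (Suc (Suc i)) = F (Suc (Suc i))"
    using eq by simp_all
  show "ideal_dim R (colon (F' i) (F' (Suc i))) <
      ideal_dim R (colon (F' (Suc i)) (F' (Suc (Suc i))))"
    using F i unfolding cm_filtration_def e by blast
qed

lemma sequentially_cohen_macaulay_iff:
  "sequentially_cohen_macaulay R M \<longleftrightarrow> (\<exists>r F. cm_filtration r F)"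
proof -
  have "F 0 = {\<zero>\<^bsub>M\<^esub>} \<and> F r = carrier M \<and> (\<forall>i\<le>r. submodule (F i) R M) \<and>
        (\<forall>i<r. F i \<subset> F (Suc i)) \<and>
        (\<forall>i<r. cohen_macaulay R (filtration_factor M F i)) \<and>
        (\<forall>i. Suc i < r \<longrightarrow>
           module_dim R (filtration_factor M F i) < module_dim R (filtration_factor M F (Suc i)))
     \<longleftrightarrow> cm_filtration r F" for r F
  \<comment> \<open>The factors can be translated only when the \<open>F i\<close> are increasing
    submodules; otherwise both sides fail.\<close>
  proof (cases "(\<forall>i\<le>r. submodule (F i) R M) \<and> (\<forall>i<r. F i \<subset> F (Suc i))")
    case True
    have cm: "cohen_macaulay R (filtration_factor M F i) \<longleftrightarrow>
        depth_on M \<mm> (F (Suc i)) (F i) = ideal_dim R (colon (F i) (F (Suc i)))"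
      and dim: "module_dim R (filtration_factor M F i) = ideal_dim R (colon (F i) (F (Suc i)))"
      if i: "i < r" for i
    proof -
      have s: "submodule (F (Suc i)) R M" "submodule (F i) R M" "F i \<subseteq> F (Suc i)"
        using True i by simp_all blast
      show "cohen_macaulay R (filtration_factor M F i) \<longleftrightarrow>
        depth_on M \<mm> (F (Suc i)) (F i) = ideal_dim R (colon (F i) (F (Suc i)))"
        unfolding filtration_factor_def by (rule factor_cohen_macaulay_iff[OF s])
      show "module_dim R (filtration_factor M F i) = ideal_dim R (colon (F i) (F (Suc i)))"
        unfolding filtration_factor_def by (rule factor_dim[OF s])
    qed
    show ?thesis unfolding cm_filtration_def using cm dim by (auto simp: Suc_lessD)
  next
    case False
    then show ?thesis unfolding cm_filtration_def by blast
  qed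
  then have "sequentially_cohen_macaulay R M \<longleftrightarrow> noetherian_ring R \<and> (\<exists>\<mm>. local_ring R \<mm>) \<and>
      fin_gen_module R M \<and> (\<exists>r F. cm_filtration r F)"
    unfolding sequentially_cohen_macaulay_def by simp
  then show ?thesis using noetherian local noetherian_fin_gen by metis
qed

text \<open>A sharper form of depth at most dimension: the annihilator of any single nonzero coset
  bounds the depth. For a Cohen-Macaulay factor it follows that every nonzero cyclic submodule has
  full dimension.\<close>

lemma depth_on_le_dim:
  assumes "submodule F R M" "submodule K R M" "K \<subseteq> F" "z \<in> F" "z \<notin> K"
  shows "depth_on M \<mm> F K \<le> ideal_dim R (colon K {z})"
  unfolding depth_on_def
proof (rule Sup_least)
  fix n assume "n \<in> {enat (length xs) |xs. set xs \<subseteq> \<mm> \<and> regular_on M F K xs}"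
  then obtain xs where xs: "n = enat (length xs)" "set xs \<subseteq> \<mm>" "regular_on M F K xs" by blast
  show "n \<le> ideal_dim R (colon K {z})"
    unfolding xs(1) by (intro ideal_dim_upper regular_on_prime_chain[OF xs(3,2) assms(2,1,3-5)])
qed

text \<open>The modules of the filtration are characterised by dimensions of cyclic submodules, because every
  nonzero cyclic submodule of a Cohen--Macaulay module has full dimension.\<close>

lemma cm_filtration_mem:
  assumes F: "cm_filtration r F" and i: "i \<le> r" and x: "x \<in> F i" and y: "y \<in> carrier M"
    and ann: "\<And>P. primeideal P R \<Longrightarrow> colon {\<zero>\<^bsub>M\<^esub>} {y} \<subseteq> P \<Longrightarrow> colon {\<zero>\<^bsub>M\<^esub>} {x} \<subseteq> P"
  shows "y \<in> F i"
proof (rule ccontr)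
  assume yi: "y \<notin> F i"
  let ?d = "\<lambda>i. ideal_dim R (colon (F i) (F (Suc i)))" and ?A = "\<lambda>x. colon {\<zero>\<^bsub>M\<^esub>} {x}"
  have F0: "F 0 = {\<zero>\<^bsub>M\<^esub>}" and Fr: "F r = carrier M" using F by (auto simp: cm_filtration_def)
  have Fsub: "submodule (F i) R M" if "i \<le> r" for i using F that by (simp add: cm_filtration_def)
  have Finc: "F i \<subseteq> F (Suc i)" if "i < r" for i using F that unfolding cm_filtration_def by blast
  have dstep: "?d i < ?d (Suc i)" if "Suc i < r" for i using F that by (simp add: cm_filtration_def)
  have dlt: "j < r \<Longrightarrow> i \<le> j \<Longrightarrow> ?d i \<le> ?d j" for i j
  proof (induction j)
    case (Suc j)
    show ?case
    proof (cases "i = Suc j")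
      case False
      then have "?d i \<le> ?d j" using Suc by simp
      also have "\<dots> \<le> ?d (Suc j)" using dstep[of j] Suc by simp
      finally show ?thesis .
    qed simp
  qed simp
  \<comment> \<open>A prime above the annihilator of an element of \<open>F i\<close> lies above the
    annihilator of one of the first \<open>i\<close> factors: otherwise elements outside
    \<open>P\<close> would push \<open>x\<close> down the filtration to zero.\<close>
  have prime_above: "\<exists>j<i. colon (F j) (F (Suc j)) \<subseteq> P"
    if "i \<le> r" "x \<in> F i" "primeideal P R" "?A x \<subseteq> P" for i x P
    using that
  proof (induction i arbitrary: x)
    case 0
    interpret P: primeideal P R by fact
    have "\<one> \<in> ?A x" using 0 F0 by (simp add: colon_def)
    then have False using 0 P.one_imp_carrier P.I_notcarr by blast
    then show ?case ..
  next
    case (Suc i)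
    interpret P: primeideal P R by fact
    show ?case
    proof (cases "colon (F i) (F (Suc i)) \<subseteq> P")
      case False
      \<comment> \<open>Multiplication by \<open>a\<close> moves \<open>x\<close> one step down, and
        the annihilator of \<open>a x\<close> is still inside \<open>P\<close> because
        \<open>a\<close> is outside \<open>P\<close>.\<close>
      then obtain a where a: "a \<in> colon (F i) (F (Suc i))" "a \<notin> P" by blast
      have aR: "a \<in> carrier R" and ax: "a \<odot>\<^bsub>M\<^esub> x \<in> F i" using a Suc.prems by (auto simp: colon_def)
      have xM: "x \<in> carrier M" using submodule_subset[OF Fsub[OF Suc.prems(1)] Suc.prems(2)] .
      have "?A (a \<odot>\<^bsub>M\<^esub> x) \<subseteq> P"
      proof
        fix s assume "s \<in> ?A (a \<odot>\<^bsub>M\<^esub> x)"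
        then have s: "s \<in> carrier R" "s \<otimes> a \<in> ?A x" using aR xM by (auto simp: colon_def smult_assoc1)
        then have "s \<otimes> a \<in> P" using Suc.prems by blast
        then show "s \<in> P" using P.I_prime[OF s(1) aR] a by blast
      qed
      then have "\<exists>j<i. colon (F j) (F (Suc j)) \<subseteq> P"
        using Suc.IH[of "a \<odot>\<^bsub>M\<^esub> x"] Suc.prems ax by simp
      then show ?thesis using less_SucI by blast
    qed blast
  qed
  have Ay: "ideal (?A y) R" using y by (intro colon_ideal submodule_zero_singleton) simp
  have ynz: "y \<noteq> \<zero>\<^bsub>M\<^esub>" using yi submodule_zero[OF Fsub[OF i]] by blast
  have "\<one> \<notin> ?A y" using ynz y by (simp add: colon_def)
  then have "?A y \<noteq> carrier R" by auto
  then have "?A y \<subseteq> \<mm>" by (rule local_ring_ideal_subset[OF local noetherian Ay])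
  then have "?A x \<subseteq> \<mm>" by (rule ann[OF max_ideal(4)])
  then obtain j0 where j0: "j0 < i" using prime_above[OF i x max_ideal(4)] by blast
  then obtain i' where i': "i = Suc i'" by (cases i) auto
  \<comment> \<open>A chain of primes above the annihilator of \<open>x\<close> has its smallest
    member, hence all members, above the annihilator of one factor below \<open>i\<close>; the
    dimensions increase, so the last such factor gives the bound.\<close>
  have up: "ideal_dim R (?A x) \<le> ?d i'"
    unfolding ideal_dim_def[of R "?A x"]
  proof (rule Sup_least)
    fix n assume "n \<in> {enat n |n. prime_chain R (?A x) n}"
    then obtain m where m: "n = enat m" "prime_chain R (?A x) m" by blast
    then obtain P where P: "\<And>k. k \<le> m \<Longrightarrow> primeideal (P k) R \<and> ?A x \<subseteq> P k"
      and Ps: "\<And>k. k < m \<Longrightarrow> P k \<subset> P (Suc k)" unfolding prime_chain_def by blast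
    have "P 0 \<subseteq> P k" if "k \<le> m" for k
      using that
    proof (induction k)
      case (Suc k) then show ?case using Ps[of k] by simp
    qed simp
    moreover obtain j where j: "j < i" "colon (F j) (F (Suc j)) \<subseteq> P 0"
      using prime_above[OF i x, of "P 0"] P[of 0] by auto
    ultimately have "prime_chain R (colon (F j) (F (Suc j))) m"
      unfolding prime_chain_def using P Ps by (intro exI[of _ P]) (meson subset_trans)
    then have "n \<le> ?d j" unfolding m(1) by (rule ideal_dim_upper)
    also have "\<dots> \<le> ?d i'" using dlt[of i' j] j i i' by simp
    finally show "n \<le> ?d i'" .
  qed
  \<comment> \<open>A factor in which the class of \<open>y\<close> is nonzero. It comes after the
    first \<open>i\<close> factors, so its dimension exceeds the bound just found for
    \<open>x\<close>.\<close>
  have "\<exists>j. i \<le> j \<and> j < r \<and> y \<in> F (Suc j) \<and> y \<notin> F j"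
  proof (rule ccontr)
    assume neg: "\<not> ?thesis"
    have "y \<notin> F j" if "i \<le> j" "j \<le> r" for j
      using that
    proof (induction j rule: dec_induct)
      case (step n) then show ?case using neg by auto
    qed (rule yi)
    from this[OF i order_refl] show False using Fr y by simp
  qed
  then obtain j where j: "i \<le> j" "j < r" "y \<in> F (Suc j)" "y \<notin> F j" by blast
  \<comment> \<open>The contradiction runs from \<open>?d i'\<close> through the factor containing
    \<open>y\<close>, whose depth is bounded by the cyclic module of \<open>y\<close>, to the cyclic
    module of \<open>x\<close> and back to \<open>?d i'\<close>.\<close>
  have "?d i' < ?d i" using dstep[of i'] j i' by simp
  also have "\<dots> \<le> ?d j" using dlt j by simp
  also have "\<dots> = depth_on M \<mm> (F (Suc j)) (F j)" using F j by (simp add: cm_filtration_def)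
  also have "\<dots> \<le> ideal_dim R (colon (F j) {y})"
    using depth_on_le_dim[OF Fsub Fsub Finc] j by simp
  also have "\<dots> \<le> ideal_dim R (?A y)"
  proof (rule ideal_dim_mono)
    fix P assume "colon (F j) {y} \<subseteq> P"
    moreover have "?A y \<subseteq> colon (F j) {y}"
      using submodule_zero[OF Fsub[of j]] j by (auto simp: colon_def)
    ultimately show "?A y \<subseteq> P" by blast
  qed
  also have "\<dots> \<le> ideal_dim R (?A x)" by (rule ideal_dim_mono[OF ann])
  also have "\<dots> \<le> ?d i'" by (rule up)
  finally show False by simp
qed

end

section \<open>Extensions by nilpotents\<close>

lemma (in cring) pow_add_multiple:
  assumes "c \<in> carrier R" "b \<in> carrier R"
  shows "\<exists>d\<in>carrier R. (c \<oplus> b) [^] (n::nat) = c [^] n \<oplus> d \<otimes> b"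
proof (induction n)
  case 0
  show ?case using assms by (intro bexI[of _ \<zero>]) simp_all
next
  case (Suc n)
  then obtain d where d: "d \<in> carrier R" "(c \<oplus> b) [^] n = c [^] n \<oplus> d \<otimes> b" by blast
  have "(c \<oplus> b) [^] Suc n = c [^] Suc n \<oplus> (c [^] n \<oplus> d \<otimes> c \<oplus> d \<otimes> b) \<otimes> b"
    using assms d by (simp add: l_distr r_distr m_ac a_ac)
  then show ?case using assms d by (intro bexI[of _ "c [^] n \<oplus> d \<otimes> c \<oplus> d \<otimes> b"]) simp_all
qed

text \<open>Expand \<open>a = (a - b) + b\<close>: modulo multiples of \<open>b\<close> only the
  power of \<open>a - b\<close> is left, and it vanishes.\<close>

lemma (in cring) pow_multiple_if_nilpotent_diff:
  assumes "a \<in> carrier R" "b \<in> carrier R" "(a \<ominus> b) [^] (n::nat) = \<zero>"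
  shows "\<exists>d\<in>carrier R. a [^] n = d \<otimes> b"
proof -
  obtain d where "d \<in> carrier R" "((a \<ominus> b) \<oplus> b) [^] n = (a \<ominus> b) [^] n \<oplus> d \<otimes> b"
    using pow_add_multiple[of "a \<ominus> b" b n] assms by auto
  moreover have "(a \<ominus> b) \<oplus> b = a" using assms by (simp add: minus_eq a_assoc l_neg)
  ultimately show ?thesis using assms by auto
qed

lemma (in cring) nilpotent_diff_commute:
  assumes "a \<in> carrier R" "b \<in> carrier R" "(a \<ominus> b) [^] (n::nat) = \<zero>"
  shows "(b \<ominus> a) [^] n = \<zero>"
proof -
  have "b \<ominus> a = (\<ominus> \<one>) \<otimes> (a \<ominus> b)"
    using assms by (simp add: minus_eq l_minus minus_add a_comm)
  then show ?thesis using assms by (simp add: nat_pow_distrib)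
qed

lemma (in primeideal) pow_mem_imp_mem:
  "x \<in> carrier R \<Longrightarrow> x [^] (n::nat) \<in> I \<Longrightarrow> x \<in> I"
proof (induction n)
  case 0
  then show ?case using one_imp_carrier I_notcarr by simp
next
  case (Suc n)
  then show ?case using I_prime[of "x [^] n" x] by auto
qed

text \<open>The setting of the theorem with the Artinian factor abstracted away: \<open>S\<close> is \<open>R\<close> up to nilpotents,
  and \<open>M\<close> is, over \<open>R\<close>, a direct sum of \<open>l\<close> copies of \<open>N\<close> with injections \<open>\<iota>\<close> and projections \<open>\<pi>\<close>;
  that \<open>\<pi>\<close> and \<open>\<iota>\<close> decompose \<open>M\<close> is stated as the induction principle \<open>decomp\<close>.\<close>

locale nilpotent_extension =
  N: local_noetherian_module R N \<mm> + M: module S M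
  for R (structure) and N (structure) and \<mm> and S (structure) and M (structure) +
  fixes \<phi> and \<psi> and \<iota> and \<pi> and l :: nat
  assumes noetherian_S: "noetherian_ring S"
    and \<phi>: "\<phi> \<in> ring_hom R S" and \<psi>: "\<psi> \<in> ring_hom S R"
    and \<psi>\<phi>: "r \<in> carrier R \<Longrightarrow> \<psi> (\<phi> r) = r"
    and nilpotent: "s \<in> carrier S \<Longrightarrow> \<exists>n::nat. (s \<ominus>\<^bsub>S\<^esub> \<phi> (\<psi> s)) [^]\<^bsub>S\<^esub> n = \<zero>\<^bsub>S\<^esub>"
    and \<iota>_closed: "j < l \<Longrightarrow> n \<in> carrier N \<Longrightarrow> \<iota> j n \<in> carrier M"
    and \<iota>_add: "j < l \<Longrightarrow> n \<in> carrier N \<Longrightarrow> n' \<in> carrier N \<Longrightarrow> \<iota> j (n \<oplus>\<^bsub>N\<^esub> n') = \<iota> j n \<oplus>\<^bsub>M\<^esub> \<iota> j n'"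
    and \<iota>_smult: "j < l \<Longrightarrow> n \<in> carrier N \<Longrightarrow> r \<in> carrier R \<Longrightarrow> \<iota> j (r \<odot>\<^bsub>N\<^esub> n) = \<phi> r \<odot>\<^bsub>M\<^esub> \<iota> j n"
    and \<pi>_closed: "j < l \<Longrightarrow> m \<in> carrier M \<Longrightarrow> \<pi> j m \<in> carrier N"
    and \<pi>_add: "j < l \<Longrightarrow> m \<in> carrier M \<Longrightarrow> m' \<in> carrier M \<Longrightarrow> \<pi> j (m \<oplus>\<^bsub>M\<^esub> m') = \<pi> j m \<oplus>\<^bsub>N\<^esub> \<pi> j m'"
    and \<pi>_smult: "j < l \<Longrightarrow> m \<in> carrier M \<Longrightarrow> r \<in> carrier R \<Longrightarrow> \<pi> j (\<phi> r \<odot>\<^bsub>M\<^esub> m) = r \<odot>\<^bsub>N\<^esub> \<pi> j m"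
    and \<pi>\<iota>: "i < l \<Longrightarrow> j < l \<Longrightarrow> n \<in> carrier N \<Longrightarrow> \<pi> i (\<iota> j n) = (if i = j then n else \<zero>\<^bsub>N\<^esub>)"
    and decomp: "m \<in> carrier M \<Longrightarrow> \<zero>\<^bsub>M\<^esub> \<in> H \<Longrightarrow> (\<And>a b. a \<in> H \<Longrightarrow> b \<in> H \<Longrightarrow> a \<oplus>\<^bsub>M\<^esub> b \<in> H) \<Longrightarrow>
        (\<And>j. j < l \<Longrightarrow> \<iota> j (\<pi> j m) \<in> H) \<Longrightarrow> m \<in> H"
    and l_pos: "0 < l"
begin

section \<open>Primes, dimension and units of the extension\<close>

lemma \<phi>_closed: "r \<in> carrier R \<Longrightarrow> \<phi> r \<in> carrier S"
  and \<psi>_closed: "s \<in> carrier S \<Longrightarrow> \<psi> s \<in> carrier R"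
  using ring_hom_closed[OF \<phi>] ring_hom_closed[OF \<psi>] by auto

text \<open>Thus \<open>s\<close> and \<open>\<phi> (\<psi> s)\<close> generate ideals with the same
  radical. This is the only way in which the nilpotent difference is used from here on.\<close>

lemma power_multiple:
  assumes "s \<in> carrier S"
  shows "\<exists>d\<in>carrier S. \<exists>n::nat. s [^]\<^bsub>S\<^esub> n = d \<otimes>\<^bsub>S\<^esub> \<phi> (\<psi> s)"
    and "\<exists>d\<in>carrier S. \<exists>n::nat. \<phi> (\<psi> s) [^]\<^bsub>S\<^esub> n = d \<otimes>\<^bsub>S\<^esub> s"
proof -
  obtain n where n: "(s \<ominus>\<^bsub>S\<^esub> \<phi> (\<psi> s)) [^]\<^bsub>S\<^esub> (n::nat) = \<zero>\<^bsub>S\<^esub>" using nilpotent[OF assms] by blast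
  have t: "\<phi> (\<psi> s) \<in> carrier S" using assms \<phi>_closed \<psi>_closed by simp
  show "\<exists>d\<in>carrier S. \<exists>n::nat. s [^]\<^bsub>S\<^esub> n = d \<otimes>\<^bsub>S\<^esub> \<phi> (\<psi> s)"
    using M.R.pow_multiple_if_nilpotent_diff[OF assms t n] by blast
  show "\<exists>d\<in>carrier S. \<exists>n::nat. \<phi> (\<psi> s) [^]\<^bsub>S\<^esub> n = d \<otimes>\<^bsub>S\<^esub> s"
    using M.R.pow_multiple_if_nilpotent_diff[OF t assms M.R.nilpotent_diff_commute[OF assms t n]] by blast
qed

lemma \<phi>_pow: "r \<in> carrier R \<Longrightarrow> \<phi> (r [^]\<^bsub>R\<^esub> (n::nat)) = \<phi> r [^]\<^bsub>S\<^esub> n"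
  by (induction n) (simp_all add: ring_hom_one[OF \<phi>] ring_hom_mult[OF \<phi>])

lemma prime_mem_iff:
  assumes P: "primeideal P S" and s: "s \<in> carrier S"
  shows "s \<in> P \<longleftrightarrow> \<phi> (\<psi> s) \<in> P"
proof -
  interpret P: primeideal P S by (rule P)
  have t: "\<phi> (\<psi> s) \<in> carrier S" using s \<phi>_closed \<psi>_closed by simp
  obtain d n d' n' where d: "d \<in> carrier S" "s [^]\<^bsub>S\<^esub> (n::nat) = d \<otimes>\<^bsub>S\<^esub> \<phi> (\<psi> s)"
    "d' \<in> carrier S" "\<phi> (\<psi> s) [^]\<^bsub>S\<^esub> (n'::nat) = d' \<otimes>\<^bsub>S\<^esub> s"
    using power_multiple[OF s] by blast
  show ?thesis
  proof
    assume "s \<in> P"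
    then have "\<phi> (\<psi> s) [^]\<^bsub>S\<^esub> n' \<in> P" unfolding d(4) using d P.I_l_closed by blast
    then show "\<phi> (\<psi> s) \<in> P" using P.pow_mem_imp_mem[OF t] by blast
  next
    assume "\<phi> (\<psi> s) \<in> P"
    then have "s [^]\<^bsub>S\<^esub> n \<in> P" unfolding d(2) using d P.I_l_closed by blast
    then show "s \<in> P" using P.pow_mem_imp_mem[OF s] by blast
  qed
qed

lemma ring_homs: "ring_hom_ring R S \<phi>" "ring_hom_ring S R \<psi>"
  by (rule ring_hom_ringI2[OF N.R.ring_axioms M.R.ring_axioms \<phi>],
      rule ring_hom_ringI2[OF M.R.ring_axioms N.R.ring_axioms \<psi>])

lemma prime_\<phi>_vimage: "primeideal P S \<Longrightarrow> primeideal {r \<in> carrier R. \<phi> r \<in> P} R"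
  by (rule ring_hom_ring.primeideal_vimage[OF ring_homs(1) N.R.is_cring])

lemma prime_\<psi>_vimage: "primeideal p R \<Longrightarrow> primeideal {s \<in> carrier S. \<psi> s \<in> p} S"
  by (rule ring_hom_ring.primeideal_vimage[OF ring_homs(2) M.R.is_cring])

text \<open>Contraction along \<open>\<phi>\<close> and contraction along \<open>\<psi>\<close>
  carry chains of primes back and forth between the two rings with strict inclusions
  preserved.\<close>

lemma ideal_dim_vimage:
  assumes I: "ideal I S"
  shows "ideal_dim S I = ideal_dim R {r \<in> carrier R. \<phi> r \<in> I}"
proof -
  interpret I: ideal I S by (rule I)
  have "prime_chain S I n \<longleftrightarrow> prime_chain R {r \<in> carrier R. \<phi> r \<in> I} n" for n
  proof
    assume "prime_chain S I n"
    then obtain P where P: "\<And>i. i \<le> n \<Longrightarrow> primeideal (P i) S \<and> I \<subseteq> P i"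
      and Ps: "\<And>i. i < n \<Longrightarrow> P i \<subset> P (Suc i)" unfolding prime_chain_def by blast
    let ?Q = "\<lambda>i. {r \<in> carrier R. \<phi> r \<in> P i}"
    \<comment> \<open>An \<open>s\<close> separating two primes may be replaced by
      \<open>\<phi> (\<psi> s)\<close>, so \<open>\<psi> s\<close> separates their
      contractions.\<close>
    have "?Q i \<subset> ?Q (Suc i)" if i: "i < n" for i
    proof -
      obtain s where s: "s \<in> P (Suc i)" "s \<notin> P i" using Ps[OF i] by blast
      have pr: "primeideal (P i) S" "primeideal (P (Suc i)) S" using P i by auto
      have sS: "s \<in> carrier S" using primeideal.axioms(1)[OF pr(2)] s ideal.Icarr by metis
      have "\<psi> s \<in> ?Q (Suc i)" "\<psi> s \<notin> ?Q i"
        using prime_mem_iff[OF pr(1) sS] prime_mem_iff[OF pr(2) sS] s \<psi>_closed[OF sS] by auto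
      then show ?thesis using Ps[OF i] by blast
    qed
    moreover have "primeideal (?Q i) R \<and> {r \<in> carrier R. \<phi> r \<in> I} \<subseteq> ?Q i" if i: "i \<le> n" for i
      using prime_\<phi>_vimage P[OF i] by blast
    ultimately show "prime_chain R {r \<in> carrier R. \<phi> r \<in> I} n"
      unfolding prime_chain_def by (intro exI[of _ ?Q]) simp
  next
    assume "prime_chain R {r \<in> carrier R. \<phi> r \<in> I} n"
    then obtain P where P: "\<And>i. i \<le> n \<Longrightarrow> primeideal (P i) R \<and> {r \<in> carrier R. \<phi> r \<in> I} \<subseteq> P i"
      and Ps: "\<And>i. i < n \<Longrightarrow> P i \<subset> P (Suc i)" unfolding prime_chain_def by blast
    let ?Q = "\<lambda>i. {s \<in> carrier S. \<psi> s \<in> P i}"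
    have "?Q i \<subset> ?Q (Suc i)" if i: "i < n" for i
    proof -
      obtain r where r: "r \<in> P (Suc i)" "r \<notin> P i" using Ps[OF i] by blast
      have pr: "primeideal (P (Suc i)) R" using P i by auto
      have rR: "r \<in> carrier R" using primeideal.axioms(1)[OF pr] r ideal.Icarr by metis
      have "\<phi> r \<in> ?Q (Suc i)" "\<phi> r \<notin> ?Q i"
        using r \<phi>_closed[OF rR] \<psi>\<phi>[OF rR] by auto
      then show ?thesis using Ps[OF i] by blast
    qed
    moreover have "primeideal (?Q i) S \<and> I \<subseteq> ?Q i" if i: "i \<le> n" for i
    proof
      show "primeideal (?Q i) S" using prime_\<psi>_vimage P[OF i] by blast
      interpret Pi: primeideal "P i" R using P[OF i] by blast
      show "I \<subseteq> ?Q i"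
      proof
        fix s assume s: "s \<in> I"
        then have sS: "s \<in> carrier S" by (rule I.Icarr)
        \<comment> \<open>\<open>\<phi> (\<psi> s)\<close> itself need not lie in \<open>I\<close>,
          only a power of it; the prime \<open>P i\<close> then takes the root.\<close>
        obtain d n where d: "d \<in> carrier S" "\<phi> (\<psi> s) [^]\<^bsub>S\<^esub> (n::nat) = d \<otimes>\<^bsub>S\<^esub> s"
          using power_multiple(2)[OF sS] by blast
        have "\<phi> (\<psi> s [^]\<^bsub>R\<^esub> n) \<in> I"
          unfolding \<phi>_pow[OF \<psi>_closed[OF sS]] d(2) using I.I_l_closed[OF s d(1)] .
        then have "\<psi> s [^]\<^bsub>R\<^esub> n \<in> P i" using P[OF i] \<psi>_closed[OF sS] by blast
        then have "\<psi> s \<in> P i" using Pi.pow_mem_imp_mem[OF \<psi>_closed[OF sS]] by blast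
        then show "s \<in> ?Q i" using sS by simp
      qed
    qed
    ultimately show "prime_chain S I n"
      unfolding prime_chain_def by (intro exI[of _ ?Q]) simp
  qed
  then show ?thesis by (simp add: ideal_dim_def)
qed

definition max_S where "max_S = {s \<in> carrier S. \<psi> s \<in> \<mm>}"

text \<open>If \<open>r\<close> inverts \<open>\<psi> s\<close>, then the \<open>n\<close>-th power
  of \<open>\<phi> r \<otimes> \<phi> (\<psi> s) = 1\<close> exhibits \<open>1\<close> as a multiple
  of \<open>s\<close>, since a power of \<open>\<phi> (\<psi> s)\<close> is one.\<close>

lemma unit_outside_max_S:
  assumes s: "s \<in> carrier S" "s \<notin> max_S"
  shows "s \<in> Units S"
proof -
  have "\<psi> s \<in> Units R"
    using local_ring_unit[OF N.local N.noetherian \<psi>_closed[OF s(1)]] s by (simp add: max_S_def)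
  then obtain r where r: "r \<in> carrier R" "r \<otimes>\<^bsub>R\<^esub> \<psi> s = \<one>\<^bsub>R\<^esub>" by (auto simp: Units_def)
  have t: "\<phi> (\<psi> s) \<in> carrier S" using s \<phi>_closed \<psi>_closed by simp
  have rt: "\<phi> r \<otimes>\<^bsub>S\<^esub> \<phi> (\<psi> s) = \<one>\<^bsub>S\<^esub>"
    using r \<psi>_closed[OF s(1)] ring_hom_mult[OF \<phi>, of r "\<psi> s"] ring_hom_one[OF \<phi>] by simp
  obtain d n where d: "d \<in> carrier S" "\<phi> (\<psi> s) [^]\<^bsub>S\<^esub> (n::nat) = d \<otimes>\<^bsub>S\<^esub> s"
    using power_multiple(2)[OF s(1)] by blast
  have "\<one>\<^bsub>S\<^esub> = (\<phi> r \<otimes>\<^bsub>S\<^esub> \<phi> (\<psi> s)) [^]\<^bsub>S\<^esub> n" by (simp add: rt)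
  also have "\<dots> = \<phi> r [^]\<^bsub>S\<^esub> n \<otimes>\<^bsub>S\<^esub> (d \<otimes>\<^bsub>S\<^esub> s)"
    using \<phi>_closed[OF r(1)] t d by (simp add: M.R.nat_pow_distrib)
  also have "\<dots> = (\<phi> r [^]\<^bsub>S\<^esub> n \<otimes>\<^bsub>S\<^esub> d) \<otimes>\<^bsub>S\<^esub> s"
    using \<phi>_closed[OF r(1)] d s by (simp add: M.R.m_assoc)
  finally have e: "\<one>\<^bsub>S\<^esub> = (\<phi> r [^]\<^bsub>S\<^esub> n \<otimes>\<^bsub>S\<^esub> d) \<otimes>\<^bsub>S\<^esub> s" .
  have c: "\<phi> r [^]\<^bsub>S\<^esub> n \<otimes>\<^bsub>S\<^esub> d \<in> carrier S" using \<phi>_closed[OF r(1)] d by simp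
  show ?thesis unfolding Units_def
    using e c s(1) M.R.m_comm[OF c s(1)] by (intro CollectI conjI bexI[OF _ c]) simp_all
qed

lemma local_S: "local_ring S max_S"
proof -
  interpret m: primeideal max_S S
    unfolding max_S_def by (rule prime_\<psi>_vimage[OF N.max_ideal(4)])
  have sub: "I \<subseteq> max_S" if I: "ideal I S" "I \<noteq> carrier S" for I
  proof (rule subsetI, rule ccontr)
    interpret I: ideal I S by (rule I(1))
    fix x assume x: "x \<in> I" "x \<notin> max_S"
    then have u: "x \<in> Units S" using unit_outside_max_S I.Icarr by blast
    have "inv\<^bsub>S\<^esub> x \<otimes>\<^bsub>S\<^esub> x \<in> I" by (rule I.I_l_closed[OF x(1) M.R.Units_inv_closed[OF u]])
    then have "\<one>\<^bsub>S\<^esub> \<in> I" using M.R.Units_l_inv[OF u] by simp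
    then show False using I.one_imp_carrier I(2) by blast
  qed
  have max: "maximalideal max_S S"
  proof (rule maximalidealI[OF m.is_ideal m.I_notcarr])
    fix J assume J: "ideal J S" "max_S \<subseteq> J" "J \<subseteq> carrier S"
    show "J = max_S \<or> J = carrier S"
    proof (cases "J = carrier S")
      case False
      from sub[OF J(1) False] J(2) show ?thesis by simp
    qed simp
  qed
  have "I = max_S" if I: "maximalideal I S" for I
  proof -
    interpret I: maximalideal I S by (rule I)
    have "I \<subseteq> max_S" using sub[OF I.is_ideal] I.I_notcarr by simp
    then show ?thesis
      using I.I_maximal[OF m.is_ideal _ m.a_subset] m.I_notcarr by simp
  qed
  then have "\<forall>I. maximalideal I S \<longrightarrow> I = max_S" by (intro allI impI)
  then show ?thesis unfolding local_ring_def by (intro conjI M.R.is_cring max)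
qed

section \<open>Submodules, depth and filtrations of a sum of copies\<close>

lemma zero_maps:
  assumes "j < l"
  shows "\<iota> j \<zero>\<^bsub>N\<^esub> = \<zero>\<^bsub>M\<^esub>" "\<pi> j \<zero>\<^bsub>M\<^esub> = \<zero>\<^bsub>N\<^esub>"
proof -
  have "\<iota> j \<zero>\<^bsub>N\<^esub> \<oplus>\<^bsub>M\<^esub> \<iota> j \<zero>\<^bsub>N\<^esub> = \<iota> j \<zero>\<^bsub>N\<^esub>" using \<iota>_add[OF assms, of "\<zero>\<^bsub>N\<^esub>" "\<zero>\<^bsub>N\<^esub>"] by simp
  then show "\<iota> j \<zero>\<^bsub>N\<^esub> = \<zero>\<^bsub>M\<^esub>" using \<iota>_closed[OF assms N.M.zero_closed] by simp
  have "\<pi> j \<zero>\<^bsub>M\<^esub> \<oplus>\<^bsub>N\<^esub> \<pi> j \<zero>\<^bsub>M\<^esub> = \<pi> j \<zero>\<^bsub>M\<^esub>" using \<pi>_add[OF assms, of "\<zero>\<^bsub>M\<^esub>" "\<zero>\<^bsub>M\<^esub>"] by simp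
  then show "\<pi> j \<zero>\<^bsub>M\<^esub> = \<zero>\<^bsub>N\<^esub>" using \<pi>_closed[OF assms M.M.zero_closed] by simp
qed

lemma \<iota>_vimage_submodule:
  assumes j: "j < l" and H: "submodule H S M"
  shows "submodule {n \<in> carrier N. \<iota> j n \<in> H} R N"
proof (rule N.submoduleI)
  let ?G = "{n \<in> carrier N. \<iota> j n \<in> H}"
  show "?G \<subseteq> carrier N" by blast
  show "\<zero>\<^bsub>N\<^esub> \<in> ?G" using M.submodule_zero[OF H] zero_maps[OF j] by simp
  show s: "a \<odot>\<^bsub>N\<^esub> x \<in> ?G" if "a \<in> carrier R" "x \<in> ?G" for a x
    using that \<iota>_smult[OF j] M.submoduleE(4)[OF H \<phi>_closed] by simp
  show "a \<oplus>\<^bsub>N\<^esub> b \<in> ?G" if "a \<in> ?G" "b \<in> ?G" for a b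
    using that \<iota>_add[OF j] M.submoduleE(5)[OF H] by simp
  show "\<ominus>\<^bsub>N\<^esub> a \<in> ?G" if a: "a \<in> ?G" for a
  proof -
    have "\<ominus>\<^bsub>N\<^esub> a = (\<ominus>\<^bsub>R\<^esub> \<one>\<^bsub>R\<^esub>) \<odot>\<^bsub>N\<^esub> a" using a by (simp add: N.smult_l_minus)
    then show ?thesis using s[of "\<ominus>\<^bsub>R\<^esub> \<one>\<^bsub>R\<^esub>" a] a by simp
  qed
qed

lemma fin_gen_M: "fin_gen_module S M"
proof -
  obtain T where T: "finite T" "T \<subseteq> carrier N" "module_span R N T = carrier N"
    using N.noetherian_fin_gen by (auto simp: fin_gen_module_def)
  let ?T = "\<Union>j\<in>{..<l}. \<iota> j ` T"
  have fin: "finite ?T" using T by simp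
  have sub: "?T \<subseteq> carrier M" using T \<iota>_closed by auto
  have span: "submodule (module_span S M ?T) S M" (is "submodule ?H S M") by (rule M.submodule_span[OF sub])
  have \<iota>H: "\<iota> j n \<in> ?H" if j: "j < l" and n: "n \<in> carrier N" for j n
  proof -
    let ?G = "{n \<in> carrier N. \<iota> j n \<in> ?H}"
    have "T \<subseteq> ?G"
    proof
      fix x assume x: "x \<in> T"
      then have "\<iota> j x \<in> ?T" using j by blast
      then have "\<iota> j x \<in> ?H" by (rule subsetD[OF M.span_superset])
      then show "x \<in> ?G" using x T by auto
    qed
    then have "module_span R N T \<subseteq> ?G" by (rule N.span_minimal[OF \<iota>_vimage_submodule[OF j span]])
    then show ?thesis using n T(3) by auto
  qed
  have "m \<in> ?H" if m: "m \<in> carrier M" for m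
    by (rule decomp[OF m]) (use M.submodule_zero[OF span] M.submoduleE(5)[OF span] \<iota>H \<pi>_closed m in auto)
  then have "module_span S M ?T = carrier M" using M.submodule_subset[OF span] by blast
  then show ?thesis unfolding fin_gen_module_def using fin sub M.module_axioms by blast
qed

lemma local_noetherian_M: "local_noetherian_module S M max_S"
  by (intro local_noetherian_module.intro local_noetherian_module_axioms.intro M.module_axioms
      noetherian_S local_S fin_gen_imp_noetherian_module[OF noetherian_S fin_gen_M])

sublocale M: local_noetherian_module S M max_S
  by (rule local_noetherian_M)

text \<open>Under the identification of \<open>M\<close> with a sum of \<open>l\<close> copies of
  \<open>N\<close> this is the sum of \<open>l\<close> copies of \<open>F\<close>. It is stable
  under \<open>R\<close>, but whether it is stable under \<open>S\<close>, which may mix the copies,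
  is a separate question.\<close>

definition hat where "hat F = {m \<in> carrier M. \<forall>j<l. \<pi> j m \<in> F}"

lemma hatI: "m \<in> carrier M \<Longrightarrow> (\<And>j. j < l \<Longrightarrow> \<pi> j m \<in> F) \<Longrightarrow> m \<in> hat F"
  by (simp add: hat_def)

lemma hatD: "m \<in> hat F \<Longrightarrow> m \<in> carrier M" "m \<in> hat F \<Longrightarrow> j < l \<Longrightarrow> \<pi> j m \<in> F"
  by (simp_all add: hat_def)

lemma hat_\<iota>_iff:
  assumes F: "submodule F R N" and j: "j < l" and n: "n \<in> carrier N"
  shows "\<iota> j n \<in> hat F \<longleftrightarrow> n \<in> F"
proof
  assume "\<iota> j n \<in> hat F"
  then have "\<pi> j (\<iota> j n) \<in> F" using j by (rule hatD)
  then show "n \<in> F" unfolding \<pi>\<iota>[OF j j n] by simp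
next
  assume nF: "n \<in> F"
  show "\<iota> j n \<in> hat F"
  proof (rule hatI[OF \<iota>_closed[OF j n]])
    fix i assume "i < l"
    then show "\<pi> i (\<iota> j n) \<in> F" unfolding \<pi>\<iota>[OF \<open>i < l\<close> j n]
      using nF N.submodule_zero[OF F] by (cases "i = j") simp_all
  qed
qed

lemma hat_add:
  assumes F: "submodule F R N" and x: "x \<in> hat F" and y: "y \<in> hat F"
  shows "x \<oplus>\<^bsub>M\<^esub> y \<in> hat F"
proof (rule hatI)
  show "x \<oplus>\<^bsub>M\<^esub> y \<in> carrier M" using hatD(1)[OF x] hatD(1)[OF y] by simp
  show "\<pi> j (x \<oplus>\<^bsub>M\<^esub> y) \<in> F" if j: "j < l" for j
    unfolding \<pi>_add[OF j hatD(1)[OF x] hatD(1)[OF y]]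
    by (rule N.submoduleE(5)[OF F hatD(2)[OF x j] hatD(2)[OF y j]])
qed

lemma hat_zero:
  assumes "submodule F R N" shows "\<zero>\<^bsub>M\<^esub> \<in> hat F"
  by (rule hatI) (simp_all add: zero_maps N.submodule_zero[OF assms])

lemma hat_subset_iff:
  assumes F: "submodule F R N" and K: "submodule K R N"
  shows "hat F \<subseteq> hat K \<longleftrightarrow> F \<subseteq> K"
proof
  assume sub: "hat F \<subseteq> hat K"
  show "F \<subseteq> K"
  proof
    fix n assume n: "n \<in> F"
    then have c: "n \<in> carrier N" by (rule N.submodule_subset[OF F])
    show "n \<in> K" using n sub hat_\<iota>_iff[OF F l_pos c] hat_\<iota>_iff[OF K l_pos c] by blast
  qed
qed (auto simp: hat_def)

lemma hat_eq_iff: "submodule F R N \<Longrightarrow> submodule K R N \<Longrightarrow> hat F = hat K \<longleftrightarrow> F = K"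
  by (simp only: set_eq_subset hat_subset_iff)

lemma hat_zero_submodule: "hat {\<zero>\<^bsub>N\<^esub>} = {\<zero>\<^bsub>M\<^esub>}"
proof -
  have "m = \<zero>\<^bsub>M\<^esub>" if m: "m \<in> hat {\<zero>\<^bsub>N\<^esub>}" for m
  proof -
    have "m \<in> {\<zero>\<^bsub>M\<^esub>}"
    proof (rule decomp[OF hatD(1)[OF m]])
      show "\<iota> j (\<pi> j m) \<in> {\<zero>\<^bsub>M\<^esub>}" if j: "j < l" for j
        using hatD(2)[OF m j] zero_maps(1)[OF j] by simp
    qed simp_all
    then show ?thesis by simp
  qed
  then show ?thesis using hat_zero[OF N.submodule_zero_singleton] by blast
qed

lemma hat_carrier: "hat (carrier N) = carrier M"
proof (intro equalityI subsetI)
  fix m assume m: "m \<in> carrier M"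
  show "m \<in> hat (carrier N)" by (rule hatI[OF m \<pi>_closed[OF _ m]])
qed (rule hatD(1))

lemma hat_add_multiples:
  assumes F: "submodule F R N" and K: "submodule K R N" and x: "x \<in> carrier R"
  shows "add_multiples M (hat F) (\<phi> x) (hat K) = hat (add_multiples N F x K)"
proof (intro equalityI subsetI)
  fix m assume "m \<in> add_multiples M (hat F) (\<phi> x) (hat K)"
  then obtain k z where e: "k \<in> hat K" "z \<in> hat F" "m = k \<oplus>\<^bsub>M\<^esub> \<phi> x \<odot>\<^bsub>M\<^esub> z"
    unfolding add_multiples_iff by blast
  have c: "k \<in> carrier M" "z \<in> carrier M" using e by (auto simp: hat_def)
  have "\<pi> j m \<in> add_multiples N F x K" if j: "j < l" for j
  proof -
    have "\<pi> j m = \<pi> j k \<oplus>\<^bsub>N\<^esub> x \<odot>\<^bsub>N\<^esub> \<pi> j z"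
      unfolding e(3) using c x \<phi>_closed j by (simp add: \<pi>_add \<pi>_smult)
    moreover have "\<pi> j k \<in> K" "\<pi> j z \<in> F" using e j by (auto simp: hat_def)
    ultimately show ?thesis unfolding add_multiples_iff by blast
  qed
  then show "m \<in> hat (add_multiples N F x K)" unfolding hat_def e(3) using c x \<phi>_closed by simp
next
  let ?H = "add_multiples M (hat F) (\<phi> x) (hat K)"
  fix m assume m: "m \<in> hat (add_multiples N F x K)"
  show "m \<in> ?H"
  \<comment> \<open>Membership is checked one component at a time; each component is split in
    \<open>N\<close> and carried back by \<open>\<iota> j\<close>.\<close>
  proof (rule decomp)
    show "m \<in> carrier M" using m by (simp add: hat_def)
    show "\<zero>\<^bsub>M\<^esub> \<in> ?H" unfolding add_multiples_iff
      using hat_zero[OF F] hat_zero[OF K] \<phi>_closed[OF x]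
      by (intro bexI[of _ "\<zero>\<^bsub>M\<^esub>"]) simp_all
    show "a \<oplus>\<^bsub>M\<^esub> b \<in> ?H" if ab: "a \<in> ?H" "b \<in> ?H" for a b
    proof -
      obtain k z k' z' where e: "k \<in> hat K" "z \<in> hat F" "a = k \<oplus>\<^bsub>M\<^esub> \<phi> x \<odot>\<^bsub>M\<^esub> z"
        "k' \<in> hat K" "z' \<in> hat F" "b = k' \<oplus>\<^bsub>M\<^esub> \<phi> x \<odot>\<^bsub>M\<^esub> z'"
        using ab unfolding add_multiples_iff by blast
      have c: "k \<in> carrier M" "z \<in> carrier M" "k' \<in> carrier M" "z' \<in> carrier M"
        using e by (auto simp: hat_def)
      have "a \<oplus>\<^bsub>M\<^esub> b = (k \<oplus>\<^bsub>M\<^esub> k') \<oplus>\<^bsub>M\<^esub> \<phi> x \<odot>\<^bsub>M\<^esub> (z \<oplus>\<^bsub>M\<^esub> z')"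
        unfolding e(3,6) using c \<phi>_closed[OF x] by (simp add: M.smult_r_distr M.M.add.m_ac)
      then show ?thesis unfolding add_multiples_iff
        using hat_add[OF K e(1,4)] hat_add[OF F e(2,5)] by blast
    qed
    show "\<iota> j (\<pi> j m) \<in> ?H" if j: "j < l" for j
    proof -
      have "\<pi> j m \<in> add_multiples N F x K" using m j by (simp add: hat_def)
      then obtain k z where e: "k \<in> K" "z \<in> F" "\<pi> j m = k \<oplus>\<^bsub>N\<^esub> x \<odot>\<^bsub>N\<^esub> z"
        unfolding add_multiples_iff by blast
      have c: "k \<in> carrier N" "z \<in> carrier N"
        using e N.submodule_subset[OF F] N.submodule_subset[OF K] by auto
      have "\<iota> j (\<pi> j m) = \<iota> j k \<oplus>\<^bsub>M\<^esub> \<phi> x \<odot>\<^bsub>M\<^esub> \<iota> j z"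
        unfolding e(3) using c x j by (simp add: \<iota>_add \<iota>_smult)
      moreover have "\<iota> j k \<in> hat K" "\<iota> j z \<in> hat F"
        using hat_\<iota>_iff[OF K j c(1)] hat_\<iota>_iff[OF F j c(2)] e by auto
      ultimately show ?thesis unfolding add_multiples_iff by blast
    qed
  qed
qed

lemma regular_on_hat:
  assumes F: "submodule F R N" and "submodule K R N" "K \<subseteq> F" "set xs \<subseteq> carrier R"
  shows "regular_on M (hat F) (hat K) (map \<phi> xs) \<longleftrightarrow> regular_on N F K xs"
  using assms(2-)
proof (induction xs arbitrary: K)
  case Nil
  then show ?case using hat_eq_iff[OF Nil(1) F] by simp
next
  case (Cons x xs)
  note K = Cons.prems(1)
  have x: "x \<in> carrier R" using Cons.prems by simp
  have "(\<forall>z\<in>hat F. \<phi> x \<odot>\<^bsub>M\<^esub> z \<in> hat K \<longrightarrow> z \<in> hat K) \<longleftrightarrow> (\<forall>z\<in>F. x \<odot>\<^bsub>N\<^esub> z \<in> K \<longrightarrow> z \<in> K)"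
  proof (intro iffI ballI impI)
    \<comment> \<open>Elements of \<open>N\<close> are tested through the copy with index 0, which
      exists because \<open>l\<close> is positive.\<close>
    fix z assume *: "\<forall>z\<in>hat F. \<phi> x \<odot>\<^bsub>M\<^esub> z \<in> hat K \<longrightarrow> z \<in> hat K" and z: "z \<in> F" "x \<odot>\<^bsub>N\<^esub> z \<in> K"
    have c: "z \<in> carrier N" "x \<odot>\<^bsub>N\<^esub> z \<in> carrier N" using N.submodule_subset[OF F z(1)] x by auto
    have "\<phi> x \<odot>\<^bsub>M\<^esub> \<iota> 0 z \<in> hat K"
      using hat_\<iota>_iff[OF K l_pos c(2)] z \<iota>_smult[OF l_pos c(1) x] by simp
    moreover have "\<iota> 0 z \<in> hat F" using hat_\<iota>_iff[OF F l_pos c(1)] z by simp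
    ultimately show "z \<in> K" using * hat_\<iota>_iff[OF K l_pos c(1)] by blast
  next
    fix z assume *: "\<forall>z\<in>F. x \<odot>\<^bsub>N\<^esub> z \<in> K \<longrightarrow> z \<in> K" and z: "z \<in> hat F" "\<phi> x \<odot>\<^bsub>M\<^esub> z \<in> hat K"
    have c: "z \<in> carrier M" using z by (simp add: hat_def)
    have "\<pi> j z \<in> K" if j: "j < l" for j
    proof -
      have "x \<odot>\<^bsub>N\<^esub> \<pi> j z \<in> K" using z(2) j \<pi>_smult[OF j c x] by (auto simp: hat_def)
      moreover have "\<pi> j z \<in> F" using z j by (simp add: hat_def)
      ultimately show ?thesis using * by blast
    qed
    then show "z \<in> hat K" using c by (simp add: hat_def)
  qed
  moreover have "regular_on M (hat F) (hat (add_multiples N F x K)) (map \<phi> xs) \<longleftrightarrow>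
      regular_on N F (add_multiples N F x K) xs"
    by (rule Cons.IH)
      (use Cons.prems N.submodule_add_multiples[OF K F x] N.add_multiples_subset[OF F Cons.prems(2) x] in auto)
  ultimately show ?case by (simp add: hat_add_multiples[OF F K x])
qed

text \<open>Sequences in \<open>\<mm>\<close> go up along \<open>\<phi>\<close>. Downwards
  \<open>\<psi>\<close> cannot be applied directly, as \<open>s\<close> and
  \<open>\<phi> (\<psi> s)\<close> act differently on \<open>M\<close>;
  \<open>M.regular_on_map\<close> first replaces every \<open>s\<close> by
  \<open>\<phi> (\<psi> s)\<close>, at no loss of length.\<close>

lemma depth_on_hat:
  assumes F: "submodule F R N" and K: "submodule K R N" and KF: "K \<subseteq> F"
    and hF: "submodule (hat F) S M" and hK: "submodule (hat K) S M"
  shows "depth_on M max_S (hat F) (hat K) = depth_on N \<mm> F K"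
proof -
  have hKF: "hat K \<subseteq> hat F" using hat_subset_iff[OF K F] KF by simp
  have \<phi>m: "\<phi> r \<in> max_S" if "r \<in> \<mm>" for r
    using that N.max_carrier \<phi>_closed \<psi>\<phi> by (simp add: max_S_def)
  have "\<exists>ys. length ys = length xs \<and> set ys \<subseteq> max_S \<and> regular_on M (hat F) (hat K) ys"
    if xs: "set xs \<subseteq> \<mm>" "regular_on N F K xs" for xs
  proof (intro exI conjI)
    show "set (map \<phi> xs) \<subseteq> max_S" using xs \<phi>m by auto
    show "regular_on M (hat F) (hat K) (map \<phi> xs)"
      using regular_on_hat[OF F K KF] xs N.max_ideal(2) by blast
  qed simp
  note 1 = this
  have 2: "\<exists>xs. length xs = length ys \<and> set xs \<subseteq> \<mm> \<and> regular_on N F K xs"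
    if ys: "set ys \<subseteq> max_S" "regular_on M (hat F) (hat K) ys" for ys
  proof (intro exI conjI)
    have \<psi>m: "set (map \<psi> ys) \<subseteq> \<mm>" using ys by (auto simp: max_S_def)
    then show "set (map \<psi> ys) \<subseteq> \<mm>" .
    have "regular_on M (hat F) (hat K) (map (\<lambda>s. \<phi> (\<psi> s)) ys @ [])"
    proof (rule M.regular_on_map[OF _ _ ys(1) _ _ hK hF hKF])
      show "\<phi> (\<psi> s) \<in> max_S" if "s \<in> max_S" for s using that \<phi>m by (simp add: max_S_def)
      show "\<exists>d\<in>carrier S. \<exists>q::nat. s [^]\<^bsub>S\<^esub> q = d \<otimes>\<^bsub>S\<^esub> \<phi> (\<psi> s)" if "s \<in> max_S" for s
        using that power_multiple(1) by (simp add: max_S_def)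
    qed (use ys in simp_all)
    then have "regular_on M (hat F) (hat K) (map \<phi> (map \<psi> ys))" by (simp add: comp_def)
    then show "regular_on N F K (map \<psi> ys)"
      using regular_on_hat[OF F K KF] \<psi>m N.max_ideal(2) by blast
  qed simp
  have "{enat (length xs) | xs. set xs \<subseteq> max_S \<and> regular_on M (hat F) (hat K) xs} =
      {enat (length xs) | xs. set xs \<subseteq> \<mm> \<and> regular_on N F K xs}" (is "?A = ?B")
  proof (intro equalityI subsetI)
    fix n assume "n \<in> ?A"
    then obtain ys where ys: "n = enat (length ys)" "set ys \<subseteq> max_S" "regular_on M (hat F) (hat K) ys"
      by blast
    from 2[OF ys(2,3)] obtain xs where "length xs = length ys" "set xs \<subseteq> \<mm>" "regular_on N F K xs"
      by blast
    then show "n \<in> ?B" using ys(1) by (intro CollectI exI[of _ xs]) (simp only: simp_thms)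
  next
    fix n assume "n \<in> ?B"
    then obtain xs where xs: "n = enat (length xs)" "set xs \<subseteq> \<mm>" "regular_on N F K xs"
      by blast
    from 1[OF xs(2,3)] obtain ys where "length ys = length xs" "set ys \<subseteq> max_S"
      "regular_on M (hat F) (hat K) ys" by blast
    then show "n \<in> ?A" using xs(1) by (intro CollectI exI[of _ ys]) (simp only: simp_thms)
  qed
  then show ?thesis unfolding depth_on_def by (rule arg_cong)
qed

lemma ideal_dim_colon_hat:
  assumes F: "submodule F R N" and K: "submodule K R N"
    and hF: "submodule (hat F) S M" and hK: "submodule (hat K) S M"
  shows "ideal_dim S (M.colon (hat K) (hat F)) = ideal_dim R (N.colon K F)"
proof -
  have "{r \<in> carrier R. \<phi> r \<in> M.colon (hat K) (hat F)} = N.colon K F"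
  proof (intro equalityI subsetI)
    fix r assume "r \<in> {r \<in> carrier R. \<phi> r \<in> M.colon (hat K) (hat F)}"
    then have r: "r \<in> carrier R" "\<forall>m\<in>hat F. \<phi> r \<odot>\<^bsub>M\<^esub> m \<in> hat K"
      unfolding M.colon_def by simp_all
    have "r \<odot>\<^bsub>N\<^esub> n \<in> K" if n: "n \<in> F" for n
    proof -
      have c: "n \<in> carrier N" "r \<odot>\<^bsub>N\<^esub> n \<in> carrier N"
        using N.submodule_subset[OF F n] r(1) by simp_all
      have "\<iota> 0 n \<in> hat F" using hat_\<iota>_iff[OF F l_pos c(1)] n by simp
      then have "\<phi> r \<odot>\<^bsub>M\<^esub> \<iota> 0 n \<in> hat K" by (rule bspec[OF r(2)])
      then have "\<iota> 0 (r \<odot>\<^bsub>N\<^esub> n) \<in> hat K" unfolding \<iota>_smult[OF l_pos c(1) r(1)] .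
      then show ?thesis using hat_\<iota>_iff[OF K l_pos c(2)] by simp
    qed
    then show "r \<in> N.colon K F" unfolding N.colon_def using r(1) by simp
  next
    fix r assume "r \<in> N.colon K F"
    then have r: "r \<in> carrier R" "\<forall>n\<in>F. r \<odot>\<^bsub>N\<^esub> n \<in> K" unfolding N.colon_def by simp_all
    have "\<phi> r \<odot>\<^bsub>M\<^esub> m \<in> hat K" if m: "m \<in> hat F" for m
    proof (rule hatI)
      show "\<phi> r \<odot>\<^bsub>M\<^esub> m \<in> carrier M" using hatD(1)[OF m] \<phi>_closed[OF r(1)] by simp
      show "\<pi> j (\<phi> r \<odot>\<^bsub>M\<^esub> m) \<in> K" if j: "j < l" for j
        unfolding \<pi>_smult[OF j hatD(1)[OF m] r(1)] using hatD(2)[OF m j] r(2) by blast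
    qed
    then show "r \<in> {r \<in> carrier R. \<phi> r \<in> M.colon (hat K) (hat F)}"
      unfolding M.colon_def using r(1) \<phi>_closed[OF r(1)] by simp
  qed
  moreover have "ideal (M.colon (hat K) (hat F)) S"
    using hK M.submoduleE(1)[OF hF] by (rule M.colon_ideal)
  ultimately show ?thesis using ideal_dim_vimage by simp
qed

lemma cm_filtration_hat_iff:
  assumes G: "\<And>i. i \<le> r \<Longrightarrow> submodule (G i) R N" and hG: "\<And>i. i \<le> r \<Longrightarrow> submodule (hat (G i)) S M"
  shows "M.cm_filtration r (\<lambda>i. hat (G i)) \<longleftrightarrow> N.cm_filtration r G"
proof -
  let ?dM = "\<lambda>i. ideal_dim S (M.colon (hat (G i)) (hat (G (Suc i))))"
    and ?dN = "\<lambda>i. ideal_dim R (N.colon (G i) (G (Suc i)))"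
  have e0: "hat (G 0) = {\<zero>\<^bsub>M\<^esub>} \<longleftrightarrow> G 0 = {\<zero>\<^bsub>N\<^esub>}"
    using hat_eq_iff[OF G[of 0] N.submodule_zero_singleton] hat_zero_submodule by simp
  have er: "hat (G r) = carrier M \<longleftrightarrow> G r = carrier N"
    using hat_eq_iff[OF G[of r] N.carrier_is_submodule] hat_carrier by simp
  have psub: "hat (G i) \<subset> hat (G (Suc i)) \<longleftrightarrow> G i \<subset> G (Suc i)" if "i < r" for i
    using hat_subset_iff[OF G[of i] G[of "Suc i"]] hat_subset_iff[OF G[of "Suc i"] G[of i]] that
    unfolding less_le_not_le by simp
  have dep: "depth_on M max_S (hat (G (Suc i))) (hat (G i)) = depth_on N \<mm> (G (Suc i)) (G i)"
    if "i < r" "G i \<subset> G (Suc i)" for i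
    using depth_on_hat[OF G[of "Suc i"] G[of i]] hG that by simp
  have dim: "?dM i = ?dN i" if "i < r" for i
    using ideal_dim_colon_hat[OF G[of "Suc i"] G[of i]] hG that by simp
  show ?thesis
  \<comment> \<open>Depths can be compared only along inclusions; if one of the strict inclusions
    fails, it fails on both sides.\<close>
  proof (cases "\<forall>i<r. G i \<subset> G (Suc i)")
    case True
    have A: "\<forall>i<r. hat (G i) \<subset> hat (G (Suc i))" using psub True by simp
    have "(depth_on M max_S (hat (G (Suc i))) (hat (G i)) = ?dM i) \<longleftrightarrow>
        (depth_on N \<mm> (G (Suc i)) (G i) = ?dN i)" if "i < r" for i
      using dep[OF that] dim[OF that] True that by simp
    then have B: "(\<forall>i<r. depth_on M max_S (hat (G (Suc i))) (hat (G i)) = ?dM i) \<longleftrightarrow>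
        (\<forall>i<r. depth_on N \<mm> (G (Suc i)) (G i) = ?dN i)" by (intro iff_allI imp_cong refl)
    have "?dM i < ?dM (Suc i) \<longleftrightarrow> ?dN i < ?dN (Suc i)" if "Suc i < r" for i
      using dim[of i] dim[of "Suc i"] that by simp
    then have C: "(\<forall>i. Suc i < r \<longrightarrow> ?dM i < ?dM (Suc i)) \<longleftrightarrow>
        (\<forall>i. Suc i < r \<longrightarrow> ?dN i < ?dN (Suc i))" by (intro iff_allI imp_cong refl)
    have D: "\<forall>i\<le>r. submodule (hat (G i)) S M" "\<forall>i\<le>r. submodule (G i) R N" using G hG by blast+
    show ?thesis unfolding M.cm_filtration_def N.cm_filtration_def e0 er B C using A D True by blast
  next
    case False
    then obtain i where i: "i < r" "\<not> G i \<subset> G (Suc i)" by blast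
    then have "\<not> hat (G i) \<subset> hat (G (Suc i))" using psub by simp
    then have "\<not> (\<forall>i<r. hat (G i) \<subset> hat (G (Suc i)))" using i(1) by blast
    then show ?thesis
      unfolding M.cm_filtration_def N.cm_filtration_def using False by (simp only: simp_thms)
  qed
qed

text \<open>Moving a component from copy \<open>b\<close> to copy \<open>a\<close> is linear over
  \<open>R\<close> but in general not over \<open>S\<close>, so annihilators are compared only up to
  radical: if \<open>s\<close> kills \<open>m\<close>, so does a power of
  \<open>\<phi> (\<psi> s)\<close>, and this power comes from \<open>R\<close> and commutes with the
  move.\<close>

lemma \<iota>\<pi>_annihilator:
  assumes P: "primeideal P S" and m: "m \<in> carrier M" and ab: "a < l" "b < l"
    and ann: "M.colon {\<zero>\<^bsub>M\<^esub>} {\<iota> a (\<pi> b m)} \<subseteq> P"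
  shows "M.colon {\<zero>\<^bsub>M\<^esub>} {m} \<subseteq> P"
proof
  interpret P: primeideal P S by (rule P)
  fix s assume "s \<in> M.colon {\<zero>\<^bsub>M\<^esub>} {m}"
  then have s: "s \<in> carrier S" "s \<odot>\<^bsub>M\<^esub> m = \<zero>\<^bsub>M\<^esub>" by (auto simp: M.colon_def)
  obtain d n where d: "d \<in> carrier S" "\<phi> (\<psi> s) [^]\<^bsub>S\<^esub> (n::nat) = d \<otimes>\<^bsub>S\<^esub> s"
    using power_multiple(2)[OF s(1)] by blast
  define r where "r = \<psi> s [^]\<^bsub>R\<^esub> n"
  have r: "r \<in> carrier R" and \<phi>r: "\<phi> r = d \<otimes>\<^bsub>S\<^esub> s"
    using \<psi>_closed[OF s(1)] d \<phi>_pow by (simp_all add: r_def)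
  have "\<phi> r \<odot>\<^bsub>M\<^esub> m = \<zero>\<^bsub>M\<^esub>" using \<phi>r d s m by (simp add: M.smult_assoc1)
  then have "r \<odot>\<^bsub>N\<^esub> \<pi> b m = \<zero>\<^bsub>N\<^esub>" using \<pi>_smult[OF ab(2) m r] zero_maps[OF ab(2)] by simp
  then have "\<phi> r \<odot>\<^bsub>M\<^esub> \<iota> a (\<pi> b m) = \<zero>\<^bsub>M\<^esub>"
    using \<iota>_smult[OF ab(1) \<pi>_closed[OF ab(2) m] r] zero_maps[OF ab(1)] by simp
  then have "\<phi> r \<in> M.colon {\<zero>\<^bsub>M\<^esub>} {\<iota> a (\<pi> b m)}"
    unfolding M.colon_def using \<phi>_closed[OF r] by simp
  then have "\<phi> r \<in> P" using ann by blast
  then have "\<phi> (\<psi> s) [^]\<^bsub>S\<^esub> n \<in> P" using \<phi>r d by simp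
  then have "\<phi> (\<psi> s) \<in> P" using P.pow_mem_imp_mem \<phi>_closed \<psi>_closed s by blast
  then show "s \<in> P" using prime_mem_iff[OF P s(1)] by simp
qed

text \<open>The maps \<open>n \<mapsto> \<pi> j (s \<odot> \<iota> k n)\<close> are the matrix
  entries of \<open>s\<close> acting on the copies of \<open>N\<close>; stability of
  \<open>G\<close> under all entries suffices.\<close>

lemma hat_submodule:
  assumes G: "submodule G R N"
    and stable: "\<And>j k s n. j < l \<Longrightarrow> k < l \<Longrightarrow> s \<in> carrier S \<Longrightarrow> n \<in> G \<Longrightarrow> \<pi> j (s \<odot>\<^bsub>M\<^esub> \<iota> k n) \<in> G"
  shows "submodule (hat G) S M"
proof (rule M.submoduleI)
  show "hat G \<subseteq> carrier M" by (auto simp: hat_def)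
  show "\<zero>\<^bsub>M\<^esub> \<in> hat G" by (rule hat_zero[OF G])
  show "a \<oplus>\<^bsub>M\<^esub> b \<in> hat G" if "a \<in> hat G" "b \<in> hat G" for a b by (rule hat_add[OF G that])
  show smult: "s \<odot>\<^bsub>M\<^esub> x \<in> hat G" if s: "s \<in> carrier S" and x: "x \<in> hat G" for s x
  proof -
    have xM: "x \<in> carrier M" using x by (simp add: hat_def)
    have "\<pi> j (s \<odot>\<^bsub>M\<^esub> x) \<in> G" if j: "j < l" for j
    proof -
      let ?H = "{m \<in> carrier M. \<pi> j (s \<odot>\<^bsub>M\<^esub> m) \<in> G}"
      have "x \<in> ?H"
      proof (rule decomp[OF xM])
        show "\<zero>\<^bsub>M\<^esub> \<in> ?H" using s zero_maps[OF j] N.submodule_zero[OF G] by simp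
        show "a \<oplus>\<^bsub>M\<^esub> b \<in> ?H" if "a \<in> ?H" "b \<in> ?H" for a b
          using that s \<pi>_add[OF j] N.submoduleE(5)[OF G] by (simp add: M.smult_r_distr)
        show "\<iota> k (\<pi> k x) \<in> ?H" if k: "k < l" for k
          using stable[OF j k s] x k \<iota>_closed[OF k] \<pi>_closed[OF k xM] by (simp add: hat_def)
      qed
      then show ?thesis by simp
    qed
    then show ?thesis using s xM by (simp add: hat_def)
  qed
  show "\<ominus>\<^bsub>M\<^esub> a \<in> hat G" if a: "a \<in> hat G" for a
  proof -
    have "a \<in> carrier M" using a by (simp add: hat_def)
    then have "\<ominus>\<^bsub>M\<^esub> a = (\<ominus>\<^bsub>S\<^esub> \<one>\<^bsub>S\<^esub>) \<odot>\<^bsub>M\<^esub> a" by (simp add: M.smult_l_minus)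
    then show ?thesis using smult[of "\<ominus>\<^bsub>S\<^esub> \<one>\<^bsub>S\<^esub>" a] a by simp
  qed
qed

theorem sequentially_cohen_macaulay_iff:
  "sequentially_cohen_macaulay S M \<longleftrightarrow> sequentially_cohen_macaulay R N"
  unfolding M.sequentially_cohen_macaulay_iff N.sequentially_cohen_macaulay_iff
proof (intro iffI)
  assume "\<exists>r F. M.cm_filtration r F"
  then obtain r F where F: "M.cm_filtration r F" by blast
  have Fsub: "submodule (F i) S M" if "i \<le> r" for i using F that by (simp add: M.cm_filtration_def)
  \<comment> \<open>One copy determines all the others, since by \<open>stable\<close> every copy
    meets \<open>F i\<close> in the same submodule of \<open>N\<close>.\<close>
  define G where "G i = {n \<in> carrier N. \<iota> 0 n \<in> F i}" for i
  have G: "submodule (G i) R N" if "i \<le> r" for i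
    unfolding G_def by (rule \<iota>_vimage_submodule[OF l_pos Fsub[OF that]])
  have stable: "\<iota> a (\<pi> b m) \<in> F i" if i: "i \<le> r" and m: "m \<in> F i" and ab: "a < l" "b < l" for a b m i
  proof (rule M.cm_filtration_mem[OF F i m])
    have mM: "m \<in> carrier M" by (rule M.submodule_subset[OF Fsub[OF i] m])
    then show "\<iota> a (\<pi> b m) \<in> carrier M" using \<iota>_closed \<pi>_closed ab by simp
    fix P assume "primeideal P S" "M.colon {\<zero>\<^bsub>M\<^esub>} {\<iota> a (\<pi> b m)} \<subseteq> P"
    then show "M.colon {\<zero>\<^bsub>M\<^esub>} {m} \<subseteq> P" using \<iota>\<pi>_annihilator mM ab by blast
  qed
  have hat_G: "hat (G i) = F i" if i: "i \<le> r" for i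
  proof (intro equalityI subsetI)
    fix m assume m: "m \<in> hat (G i)"
    show "m \<in> F i"
    proof (rule decomp)
      show "m \<in> carrier M" using m by (simp add: hat_def)
      show "\<zero>\<^bsub>M\<^esub> \<in> F i" by (rule M.submodule_zero[OF Fsub[OF i]])
      show "a \<oplus>\<^bsub>M\<^esub> b \<in> F i" if "a \<in> F i" "b \<in> F i" for a b by (rule M.submoduleE(5)[OF Fsub[OF i] that])
      fix j assume j: "j < l"
      have "\<iota> 0 (\<pi> j m) \<in> F i" "\<pi> j m \<in> carrier N" using m j by (auto simp: hat_def G_def)
      \<comment> \<open>\<open>\<pi> 0\<close> followed by \<open>\<iota> j\<close> carries copy 0
        onto copy \<open>j\<close> and preserves \<open>F i\<close>.\<close>
      then show "\<iota> j (\<pi> j m) \<in> F i"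
        using stable[OF i _ j l_pos, of "\<iota> 0 (\<pi> j m)"] \<pi>\<iota>[OF l_pos l_pos] by simp
    qed
  next
    fix m assume m: "m \<in> F i"
    have mM: "m \<in> carrier M" by (rule M.submodule_subset[OF Fsub[OF i] m])
    then show "m \<in> hat (G i)" using stable[OF i m l_pos] \<pi>_closed by (simp add: hat_def G_def)
  qed
  have "M.cm_filtration r (\<lambda>i. hat (G i))"
    by (rule M.cm_filtration_cong[OF F]) (rule hat_G[symmetric])
  then have "N.cm_filtration r G"
    using cm_filtration_hat_iff[of r G] G hat_G Fsub by simp
  then show "\<exists>r F. N.cm_filtration r F" by blast
next
  assume "\<exists>r F. N.cm_filtration r F"
  then obtain r G where F: "N.cm_filtration r G" by blast
  have G: "submodule (G i) R N" if "i \<le> r" for i using F that by (simp add: N.cm_filtration_def)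
  have "submodule (hat (G i)) S M" if i: "i \<le> r" for i
  proof (rule hat_submodule[OF G[OF i]])
    fix j k s n assume jk: "j < l" "k < l" and s: "s \<in> carrier S" and n: "n \<in> G i"
    have c: "n \<in> carrier N" "\<iota> k n \<in> carrier M" using N.submodule_subset[OF G[OF i] n] \<iota>_closed jk by auto
    show "\<pi> j (s \<odot>\<^bsub>M\<^esub> \<iota> k n) \<in> G i"
    \<comment> \<open>A matrix entry of \<open>s\<close> is linear over \<open>R\<close>, so
      whatever kills \<open>n\<close> kills its image, and the members of the filtration are closed
      under passing to such elements.\<close>
    proof (rule N.cm_filtration_mem[OF F i n])
      show "\<pi> j (s \<odot>\<^bsub>M\<^esub> \<iota> k n) \<in> carrier N" using \<pi>_closed jk c s by simp
      fix P assume P: "N.colon {\<zero>\<^bsub>N\<^esub>} {\<pi> j (s \<odot>\<^bsub>M\<^esub> \<iota> k n)} \<subseteq> P"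
      show "N.colon {\<zero>\<^bsub>N\<^esub>} {n} \<subseteq> P"
      proof
        fix q assume "q \<in> N.colon {\<zero>\<^bsub>N\<^esub>} {n}"
        then have q: "q \<in> carrier R" "q \<odot>\<^bsub>N\<^esub> n = \<zero>\<^bsub>N\<^esub>" by (auto simp: N.colon_def)
        have "q \<odot>\<^bsub>N\<^esub> \<pi> j (s \<odot>\<^bsub>M\<^esub> \<iota> k n) = \<pi> j (\<phi> q \<odot>\<^bsub>M\<^esub> (s \<odot>\<^bsub>M\<^esub> \<iota> k n))"
          using \<pi>_smult[OF jk(1) _ q(1)] c s by simp
        also have "\<phi> q \<odot>\<^bsub>M\<^esub> (s \<odot>\<^bsub>M\<^esub> \<iota> k n) = s \<odot>\<^bsub>M\<^esub> (\<phi> q \<odot>\<^bsub>M\<^esub> \<iota> k n)"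
          using M.R.m_comm[OF \<phi>_closed[OF q(1)] s] c s \<phi>_closed[OF q(1)] by (metis M.smult_assoc1)
        also have "\<phi> q \<odot>\<^bsub>M\<^esub> \<iota> k n = \<zero>\<^bsub>M\<^esub>"
          using \<iota>_smult[OF jk(2) c(1) q(1)] q(2) zero_maps[OF jk(2)] by simp
        finally have "q \<odot>\<^bsub>N\<^esub> \<pi> j (s \<odot>\<^bsub>M\<^esub> \<iota> k n) = \<zero>\<^bsub>N\<^esub>" using s zero_maps[OF jk(1)] by simp
        then show "q \<in> P" using P q by (auto simp: N.colon_def)
      qed
    qed
  qed
  then have "M.cm_filtration r (\<lambda>i. hat (G i))" using cm_filtration_hat_iff[of r G] G F by simp
  then show "\<exists>r F. M.cm_filtration r F" by blast
qed

end

section \<open>Tensor products\<close>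

lemma frag_extend_fun_diff:
  "frag_extend (\<lambda>i. u i - v i) c = frag_extend u c - frag_extend v c"
proof -
  have "Poly_Mapping.keys c \<subseteq> UNIV" by simp
  then show ?thesis
    by (induction c rule: frag_induction) (simp_all add: frag_extend_diff)
qed

lemma frag_act_diff_left: "frag_act f g (c - c') d = frag_act f g c d - frag_act f g c' d"
  by (simp add: frag_act_def frag_extend_diff)

lemma frag_act_diff_right: "frag_act f g c (d - d') = frag_act f g c d - frag_act f g c d'"
  by (simp add: frag_act_def frag_extend_diff case_prod_unfold frag_extend_fun_diff)

lemma frag_act_zero [simp]: "frag_act f g 0 d = 0" "frag_act f g c 0 = 0"
  using frag_act_diff_left[of f g 0 0 d] frag_act_diff_right[of f g c 0 0] by simp_all

lemma frag_act_minus: "frag_act f g (- c) d = - frag_act f g c d" "frag_act f g c (- d) = - frag_act f g c d"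
  using frag_act_diff_left[of f g 0 c d] frag_act_diff_right[of f g c 0 d] by simp_all

lemma frag_act_add_left: "frag_act f g (c + c') d = frag_act f g c d + frag_act f g c' d"
  using frag_act_diff_left[of f g c "- c'" d] by (simp add: frag_act_minus)

lemma frag_act_add_right: "frag_act f g c (d + d') = frag_act f g c d + frag_act f g c d'"
  using frag_act_diff_right[of f g c d "- d'"] by (simp add: frag_act_minus)

lemma frag_act_of [simp]: "frag_act f g (frag_of (a, b)) (frag_of (x, y)) = frag_of (f a x, g b y)"
  by (simp add: frag_act_def)

lemma frag_keys_diff: "Poly_Mapping.keys c \<subseteq> A \<Longrightarrow> Poly_Mapping.keys d \<subseteq> A \<Longrightarrow> Poly_Mapping.keys (c - d :: 'a \<Rightarrow>\<^sub>0 int) \<subseteq> A"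
  using keys_diff[of c d] by blast

lemmas frag_on_induct [consumes 1, case_names zero diff of] = free_Abelian_group_induct

section \<open>The tensor group and its universal property\<close>

locale tensor_product = M: module k M + N: module k N
  for k (structure) and M (structure) and N (structure)
begin

abbreviation (input) "fr \<equiv> free_Abelian_group (carrier M \<times> carrier N)"
abbreviation (input) "ker \<equiv> tensor_kernel k M N"
abbreviation (input) "tens \<equiv> tensor_group k M N"

definition pure where "pure x y = tensor_class k M N (frag_of (x, y))"

lemma fr_comm: "comm_group fr" and fr_group: "group fr"
  by (rule abelian_free_Abelian_group, rule group_free_Abelian_group)

lemma relation_cases:
  assumes "c \<in> tensor_relations k M N"
  obtains (left) x x' y where "x \<in> carrier M" "x' \<in> carrier M" "y \<in> carrier N"
      "c = frag_of (x \<oplus>\<^bsub>M\<^esub> x', y) - frag_of (x, y) - frag_of (x', y)"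
    | (right) x y y' where "x \<in> carrier M" "y \<in> carrier N" "y' \<in> carrier N"
      "c = frag_of (x, y \<oplus>\<^bsub>N\<^esub> y') - frag_of (x, y) - frag_of (x, y')"
    | (scalar) r x y where "r \<in> carrier k" "x \<in> carrier M" "y \<in> carrier N"
      "c = frag_of (r \<odot>\<^bsub>M\<^esub> x, y) - frag_of (x, r \<odot>\<^bsub>N\<^esub> y)"
  using assms unfolding tensor_relations_def Un_iff mem_Collect_eq
proof (elim disjE exE conjE)
  fix x x' y
  assume "c = frag_of (x \<oplus>\<^bsub>M\<^esub> x', y) - frag_of (x, y) - frag_of (x', y)"
    "x \<in> carrier M" "x' \<in> carrier M" "y \<in> carrier N"
  then show thesis by (intro left)
next
  fix x y y'
  assume "c = frag_of (x, y \<oplus>\<^bsub>N\<^esub> y') - frag_of (x, y) - frag_of (x, y')"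
    "x \<in> carrier M" "y \<in> carrier N" "y' \<in> carrier N"
  then show thesis by (intro right)
next
  fix r x y
  assume "c = frag_of (r \<odot>\<^bsub>M\<^esub> x, y) - frag_of (x, r \<odot>\<^bsub>N\<^esub> y)"
    "r \<in> carrier k" "x \<in> carrier M" "y \<in> carrier N"
  then show thesis by (intro scalar)
qed

lemma relations_closed: "tensor_relations k M N \<subseteq> carrier fr"
proof
  fix c assume "c \<in> tensor_relations k M N"
  then have "Poly_Mapping.keys c \<subseteq> carrier M \<times> carrier N"
  proof (cases rule: relation_cases)
    case left then show ?thesis unfolding left(4) by (intro frag_keys_diff) simp_all
  next
    case right then show ?thesis unfolding right(4) by (intro frag_keys_diff) simp_all
  next
    case scalar then show ?thesis unfolding scalar(4) by (intro frag_keys_diff) simp_all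
  qed
  then show "c \<in> carrier fr" by simp
qed

lemma ker_subgroup: "subgroup ker fr"
  unfolding tensor_kernel_def by (rule group.generate_is_subgroup[OF fr_group relations_closed])

lemma ker_normal: "ker \<lhd> fr"
  by (rule comm_group.subgroup_imp_normal[OF fr_comm ker_subgroup])

lemma ker_closed: "c \<in> ker \<Longrightarrow> Poly_Mapping.keys c \<subseteq> carrier M \<times> carrier N"
  using subgroup.mem_carrier[OF ker_subgroup] by simp

lemma ker_zero: "0 \<in> ker" using subgroup.one_closed[OF ker_subgroup] by simp

lemma ker_minus: "c \<in> ker \<Longrightarrow> - c \<in> ker"
  using subgroup.m_inv_closed[OF ker_subgroup] ker_closed by simp

lemma ker_add: "c \<in> ker \<Longrightarrow> d \<in> ker \<Longrightarrow> c + d \<in> ker"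
  using subgroup.m_closed[OF ker_subgroup] by simp

lemma ker_diff: "c \<in> ker \<Longrightarrow> d \<in> ker \<Longrightarrow> c - d \<in> ker"
  using ker_add[OF _ ker_minus, of c d] by simp

lemma ker_relation: "c \<in> tensor_relations k M N \<Longrightarrow> c \<in> ker"
  unfolding tensor_kernel_def by (rule generate.incl)

lemma ker_induct [consumes 1, case_names zero relation minus add]:
  assumes "c \<in> ker" "P 0" "\<And>c. c \<in> tensor_relations k M N \<Longrightarrow> P c"
    "\<And>c. P c \<Longrightarrow> P (- c)" "\<And>c d. P c \<Longrightarrow> P d \<Longrightarrow> P (c + d)"
  shows "P c"
  using assms(1) unfolding tensor_kernel_def
proof (induction rule: generate.induct)
  case (inv h)
  then have "h \<in> carrier fr" by (rule subsetD[OF relations_closed])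
  then have "inv\<^bsub>fr\<^esub> h = - h" by simp
  then show ?case using assms(3,4) inv by simp
qed (use assms in simp_all)

lemma mem_class_iff: "d \<in> tensor_class k M N c \<longleftrightarrow> (\<exists>h\<in>ker. d = h + c)"
  by (auto simp: tensor_class_def r_coset_def)

lemma class_self: "c \<in> tensor_class k M N c"
  unfolding mem_class_iff using ker_zero by (metis add_0)

lemma class_eqI: "c - d \<in> ker \<Longrightarrow> tensor_class k M N c = tensor_class k M N d"
proof (intro equalityI subsetI)
  assume cd: "c - d \<in> ker"
  fix e
  show "e \<in> tensor_class k M N d" if e: "e \<in> tensor_class k M N c"
  proof -
    obtain h where h: "h \<in> ker" "e = h + c" using e mem_class_iff by blast
    then have "e = (h + (c - d)) + d" by simp
    then show ?thesis using ker_add[OF h(1) cd] mem_class_iff by blast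
  qed
  show "e \<in> tensor_class k M N c" if e: "e \<in> tensor_class k M N d"
  proof -
    obtain h where h: "h \<in> ker" "e = h + d" using e mem_class_iff by blast
    then have "e = (h - (c - d)) + c" by simp
    then show ?thesis using ker_diff[OF h(1) cd] mem_class_iff by blast
  qed
qed

lemma tens_comm: "comm_group tens"
  unfolding tensor_group_def by (rule comm_group.abelian_FactGroup[OF fr_comm ker_subgroup])

lemma tens_carrier: "carrier tens = tensor_class k M N ` {c. Poly_Mapping.keys c \<subseteq> carrier M \<times> carrier N}"
  by (auto simp: tensor_group_def FactGroup_def RCOSETS_def tensor_class_def)

lemma class_closed: "Poly_Mapping.keys c \<subseteq> carrier M \<times> carrier N \<Longrightarrow> tensor_class k M N c \<in> carrier tens"
  unfolding tens_carrier by blast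

lemma class_add:
  "Poly_Mapping.keys c \<subseteq> carrier M \<times> carrier N \<Longrightarrow> Poly_Mapping.keys d \<subseteq> carrier M \<times> carrier N \<Longrightarrow>
    tensor_class k M N c \<otimes>\<^bsub>tens\<^esub> tensor_class k M N d = tensor_class k M N (c + d)"
  using normal.rcos_sum[OF ker_normal, of c d] by (simp add: tensor_group_def FactGroup_def tensor_class_def)

lemma tens_one: "\<one>\<^bsub>tens\<^esub> = tensor_class k M N 0"
proof -
  have "h \<in> tensor_class k M N 0 \<longleftrightarrow> h \<in> ker" for h by (simp add: mem_class_iff)
  then show ?thesis by (auto simp: tensor_group_def FactGroup_def)
qed

lemma pure_closed: "x \<in> carrier M \<Longrightarrow> y \<in> carrier N \<Longrightarrow> pure x y \<in> carrier tens"
  unfolding pure_def by (rule class_closed) simp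

lemma pure_add_left:
  assumes "x \<in> carrier M" "x' \<in> carrier M" "y \<in> carrier N"
  shows "pure (x \<oplus>\<^bsub>M\<^esub> x') y = pure x y \<otimes>\<^bsub>tens\<^esub> pure x' y"
proof -
  have "frag_of (x \<oplus>\<^bsub>M\<^esub> x', y) - frag_of (x, y) - frag_of (x', y) \<in> ker"
    by (rule ker_relation) (use assms in \<open>auto simp: tensor_relations_def\<close>)
  then have "tensor_class k M N (frag_of (x \<oplus>\<^bsub>M\<^esub> x', y)) = tensor_class k M N (frag_of (x, y) + frag_of (x', y))"
    by (intro class_eqI) (simp add: diff_diff_eq)
  then show ?thesis unfolding pure_def using assms by (simp add: class_add)
qed

lemma pure_add_right:
  assumes "x \<in> carrier M" "y \<in> carrier N" "y' \<in> carrier N"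
  shows "pure x (y \<oplus>\<^bsub>N\<^esub> y') = pure x y \<otimes>\<^bsub>tens\<^esub> pure x y'"
proof -
  have "frag_of (x, y \<oplus>\<^bsub>N\<^esub> y') - frag_of (x, y) - frag_of (x, y') \<in> ker"
    by (rule ker_relation) (use assms in \<open>auto simp: tensor_relations_def\<close>)
  then have "tensor_class k M N (frag_of (x, y \<oplus>\<^bsub>N\<^esub> y')) = tensor_class k M N (frag_of (x, y) + frag_of (x, y'))"
    by (intro class_eqI) (simp add: diff_diff_eq)
  then show ?thesis unfolding pure_def using assms by (simp add: class_add)
qed

lemma pure_smult:
  assumes "c \<in> carrier k" "x \<in> carrier M" "y \<in> carrier N"
  shows "pure (c \<odot>\<^bsub>M\<^esub> x) y = pure x (c \<odot>\<^bsub>N\<^esub> y)"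
  unfolding pure_def
proof (intro class_eqI ker_relation)
  have "frag_of (c \<odot>\<^bsub>M\<^esub> x, y) - frag_of (x, c \<odot>\<^bsub>N\<^esub> y) \<in>
     {frag_of (c \<odot>\<^bsub>M\<^esub> x, y) - frag_of (x, c \<odot>\<^bsub>N\<^esub> y) | c x y.
        c \<in> carrier k \<and> x \<in> carrier M \<and> y \<in> carrier N}" using assms by blast
  then show "frag_of (c \<odot>\<^bsub>M\<^esub> x, y) - frag_of (x, c \<odot>\<^bsub>N\<^esub> y) \<in> tensor_relations k M N"
    unfolding tensor_relations_def by blast
qed

lemma pure_zero:
  assumes "y \<in> carrier N"
  shows "pure \<zero>\<^bsub>M\<^esub> y = \<one>\<^bsub>tens\<^esub>"
proof -
  interpret T: comm_group tens by (rule tens_comm)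
  have "pure \<zero>\<^bsub>M\<^esub> y \<otimes>\<^bsub>tens\<^esub> pure \<zero>\<^bsub>M\<^esub> y = pure \<zero>\<^bsub>M\<^esub> y"
    using pure_add_left[of "\<zero>\<^bsub>M\<^esub>" "\<zero>\<^bsub>M\<^esub>" y] assms by simp
  then show ?thesis using pure_closed[OF _ assms, of "\<zero>\<^bsub>M\<^esub>"] by simp
qed

text \<open>No case for inverses is required, because the inverse of a pure tensor is again pure;
  this matches the additive closure used in \<open>tensor_map\<close>.\<close>

lemma tens_induct [consumes 1, case_names one pure mult]:
  assumes "U \<in> carrier tens" and one: "P \<one>\<^bsub>tens\<^esub>"
    and pure: "\<And>x y. x \<in> carrier M \<Longrightarrow> y \<in> carrier N \<Longrightarrow> P (pure x y)"
    and mult: "\<And>U V. U \<in> carrier tens \<Longrightarrow> V \<in> carrier tens \<Longrightarrow> P U \<Longrightarrow> P V \<Longrightarrow> P (U \<otimes>\<^bsub>tens\<^esub> V)"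
  shows "P U"
proof -
  interpret T: comm_group tens by (rule tens_comm)
  let ?Z = "carrier M \<times> carrier N" and ?cl = "tensor_class k M N"
  obtain c where c: "Poly_Mapping.keys c \<subseteq> ?Z" "U = ?cl c" using assms(1) unfolding tens_carrier by blast
  \<comment> \<open>Formal sums are built by differences, so the claim is carried for both
    signs.\<close>
  have "P (?cl c) \<and> P (?cl (- c))"
    using c(1)
  proof (induction c rule: frag_on_induct)
    case zero then show ?case using one by (simp add: tens_one)
  next
    case (diff a b)
    have k: "Poly_Mapping.keys (- b) \<subseteq> ?Z" "Poly_Mapping.keys (- a) \<subseteq> ?Z" using diff by (simp_all add: keys_minus)
    have "?cl (a - b) = ?cl a \<otimes>\<^bsub>tens\<^esub> ?cl (- b)" "?cl (- (a - b)) = ?cl b \<otimes>\<^bsub>tens\<^esub> ?cl (- a)"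
      using diff k by (simp_all add: class_add)
    then show ?case using mult class_closed diff k by simp
  next
    case (of z)
    then obtain x y where xy: "z = (x, y)" "x \<in> carrier M" "y \<in> carrier N" by blast
    have "?cl (frag_of (x, y)) \<otimes>\<^bsub>tens\<^esub> ?cl (- frag_of (x, y)) = \<one>\<^bsub>tens\<^esub>"
      using xy by (subst class_add) (simp_all add: tens_one keys_minus)
    moreover have "pure (\<ominus>\<^bsub>M\<^esub> x) y \<otimes>\<^bsub>tens\<^esub> pure x y = \<one>\<^bsub>tens\<^esub>"
      using pure_add_left[of "\<ominus>\<^bsub>M\<^esub> x" x y] xy pure_zero by (simp add: M.M.l_neg)
    moreover have "?cl (- frag_of (x, y)) \<in> carrier tens" using xy by (intro class_closed) (simp add: keys_minus)
    ultimately have "?cl (- frag_of (x, y)) = pure (\<ominus>\<^bsub>M\<^esub> x) y"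
      using xy pure_closed by (metis M.M.a_inv_closed T.inv_equality T.m_comm pure_def)
    then show ?case using pure[of x y] pure[of "\<ominus>\<^bsub>M\<^esub> x" y] xy by (simp add: pure_def)
  qed
  then show ?thesis using c by simp
qed

text \<open>A biadditive balanced \<open>f\<close> extends to the free abelian group, kills the
  defining relations, and therefore factors through the quotient.\<close>

lemma tens_lift:
  assumes T: "comm_group T"
    and cl: "\<And>x y. x \<in> carrier M \<Longrightarrow> y \<in> carrier N \<Longrightarrow> f x y \<in> carrier T"
    and add_l: "\<And>x x' y. x \<in> carrier M \<Longrightarrow> x' \<in> carrier M \<Longrightarrow> y \<in> carrier N \<Longrightarrow>
        f (x \<oplus>\<^bsub>M\<^esub> x') y = f x y \<otimes>\<^bsub>T\<^esub> f x' y"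
    and add_r: "\<And>x y y'. x \<in> carrier M \<Longrightarrow> y \<in> carrier N \<Longrightarrow> y' \<in> carrier N \<Longrightarrow>
        f x (y \<oplus>\<^bsub>N\<^esub> y') = f x y \<otimes>\<^bsub>T\<^esub> f x y'"
    and bal: "\<And>c x y. c \<in> carrier k \<Longrightarrow> x \<in> carrier M \<Longrightarrow> y \<in> carrier N \<Longrightarrow>
        f (c \<odot>\<^bsub>M\<^esub> x) y = f x (c \<odot>\<^bsub>N\<^esub> y)"
  shows "\<exists>h\<in>hom tens T. \<forall>x\<in>carrier M. \<forall>y\<in>carrier N. h (pure x y) = f x y"
proof -
  interpret T: comm_group T by (rule T)
  let ?Z = "carrier M \<times> carrier N"
  have "(\<lambda>(x, y). f x y) ` ?Z \<subseteq> carrier T" using cl by auto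
  then obtain h where h: "h \<in> hom fr T" "\<And>z. z \<in> ?Z \<Longrightarrow> h (frag_of z) = (\<lambda>(x, y). f x y) z"
    using T.free_Abelian_group_universal by blast
  interpret h: group_hom fr T h
    by (intro group_hom.intro group_hom_axioms.intro fr_group T.is_group h(1))
  have hof: "h (frag_of (x, y)) = f x y" if "x \<in> carrier M" "y \<in> carrier N" for x y
    using h(2)[of "(x, y)"] that by simp
  have hcl: "h c \<in> carrier T" if "Poly_Mapping.keys c \<subseteq> ?Z" for c using h.hom_closed that by simp
  have hadd: "h (c + d) = h c \<otimes>\<^bsub>T\<^esub> h d" if "Poly_Mapping.keys c \<subseteq> ?Z" "Poly_Mapping.keys d \<subseteq> ?Z" for c d
    using h.hom_mult[of c d] that by simp
  have hinv: "h (- c) = inv\<^bsub>T\<^esub> h c" if "Poly_Mapping.keys c \<subseteq> ?Z" for c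
    using h.hom_inv[of c] that by simp
  have hdiff: "h (c - d) = \<one>\<^bsub>T\<^esub>" if "Poly_Mapping.keys c \<subseteq> ?Z" "Poly_Mapping.keys d \<subseteq> ?Z" "h c = h d" for c d
    using hadd[of c "- d"] hinv[of d] hcl[of d] that by (simp add: keys_minus)
  have "h c = \<one>\<^bsub>T\<^esub>" if rel: "c \<in> tensor_relations k M N" for c
  proof -
    from rel show ?thesis
    proof (cases rule: relation_cases)
      case (left x x' y)
      have "Poly_Mapping.keys (frag_of (x, y) + frag_of (x', y)) \<subseteq> ?Z"
        using keys_add[of "frag_of (x, y)" "frag_of (x', y)"] left by auto
      then have "h (frag_of (x \<oplus>\<^bsub>M\<^esub> x', y) - (frag_of (x, y) + frag_of (x', y))) = \<one>\<^bsub>T\<^esub>"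
        using left by (intro hdiff) (simp_all add: hadd hof add_l)
      then show ?thesis using left by (simp add: diff_diff_eq)
    next
      case (right x y y')
      have "Poly_Mapping.keys (frag_of (x, y) + frag_of (x, y')) \<subseteq> ?Z"
        using keys_add[of "frag_of (x, y)" "frag_of (x, y')"] right by auto
      then have "h (frag_of (x, y \<oplus>\<^bsub>N\<^esub> y') - (frag_of (x, y) + frag_of (x, y'))) = \<one>\<^bsub>T\<^esub>"
        using right by (intro hdiff) (simp_all add: hadd hof add_r)
      then show ?thesis using right by (simp add: diff_diff_eq)
    next
      case (scalar r x y)
      then show ?thesis by (simp add: hdiff hof bal)
    qed
  qed
  then have "tensor_relations k M N \<subseteq> kernel fr T h"
    using subsetD[OF relations_closed] unfolding kernel_def by blast
  then have "ker \<subseteq> kernel fr T h"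
    unfolding tensor_kernel_def using group.generate_subgroup_incl[OF fr_group _ h.subgroup_kernel] by blast
  then obtain g where g: "g \<in> hom (fr Mod ker) T" "\<And>c. c \<in> carrier fr \<Longrightarrow> g (ker #>\<^bsub>fr\<^esub> c) = h c"
    using h.FactGroup_universal_kernel[OF ker_normal] by blast
  have "g (pure x y) = f x y" if "x \<in> carrier M" "y \<in> carrier N" for x y
    using g(2)[of "frag_of (x, y)"] hof that by (simp add: pure_def tensor_class_def)
  then show ?thesis using g(1) by (intro bexI[of _ g]) (simp_all add: tensor_group_def)
qed

end

text \<open>Common ground for the multiplication of \<open>A \<otimes> B\<close> and for its action
  on \<open>L \<otimes> N\<close>: both arise from a pair of \<open>k\<close>-bilinear operations
  \<open>f\<close> and \<open>g\<close>, so well-definedness is proved once.\<close>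

locale tensor_action = S: tensor_product k A B + T: tensor_product k M N
  for k (structure) and A (structure) and B (structure) and M (structure) and N (structure) +
  fixes f g
  assumes f_closed: "a \<in> carrier A \<Longrightarrow> x \<in> carrier M \<Longrightarrow> f a x \<in> carrier M"
    and f_add_l: "a \<in> carrier A \<Longrightarrow> a' \<in> carrier A \<Longrightarrow> x \<in> carrier M \<Longrightarrow> f (a \<oplus>\<^bsub>A\<^esub> a') x = f a x \<oplus>\<^bsub>M\<^esub> f a' x"
    and f_add_r: "a \<in> carrier A \<Longrightarrow> x \<in> carrier M \<Longrightarrow> x' \<in> carrier M \<Longrightarrow> f a (x \<oplus>\<^bsub>M\<^esub> x') = f a x \<oplus>\<^bsub>M\<^esub> f a x'"
    and f_smult_l: "c \<in> carrier k \<Longrightarrow> a \<in> carrier A \<Longrightarrow> x \<in> carrier M \<Longrightarrow> f (c \<odot>\<^bsub>A\<^esub> a) x = c \<odot>\<^bsub>M\<^esub> f a x"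
    and f_smult_r: "c \<in> carrier k \<Longrightarrow> a \<in> carrier A \<Longrightarrow> x \<in> carrier M \<Longrightarrow> f a (c \<odot>\<^bsub>M\<^esub> x) = c \<odot>\<^bsub>M\<^esub> f a x"
    and g_closed: "b \<in> carrier B \<Longrightarrow> y \<in> carrier N \<Longrightarrow> g b y \<in> carrier N"
    and g_add_l: "b \<in> carrier B \<Longrightarrow> b' \<in> carrier B \<Longrightarrow> y \<in> carrier N \<Longrightarrow> g (b \<oplus>\<^bsub>B\<^esub> b') y = g b y \<oplus>\<^bsub>N\<^esub> g b' y"
    and g_add_r: "b \<in> carrier B \<Longrightarrow> y \<in> carrier N \<Longrightarrow> y' \<in> carrier N \<Longrightarrow> g b (y \<oplus>\<^bsub>N\<^esub> y') = g b y \<oplus>\<^bsub>N\<^esub> g b y'"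
    and g_smult_l: "c \<in> carrier k \<Longrightarrow> b \<in> carrier B \<Longrightarrow> y \<in> carrier N \<Longrightarrow> g (c \<odot>\<^bsub>B\<^esub> b) y = c \<odot>\<^bsub>N\<^esub> g b y"
    and g_smult_r: "c \<in> carrier k \<Longrightarrow> b \<in> carrier B \<Longrightarrow> y \<in> carrier N \<Longrightarrow> g b (c \<odot>\<^bsub>N\<^esub> y) = c \<odot>\<^bsub>N\<^esub> g b y"
begin

lemma relation_intros:
  "x \<in> carrier M \<Longrightarrow> x' \<in> carrier M \<Longrightarrow> y \<in> carrier N \<Longrightarrow>
    frag_of (x \<oplus>\<^bsub>M\<^esub> x', y) - frag_of (x, y) - frag_of (x', y) \<in> tensor_kernel k M N"
  "x \<in> carrier M \<Longrightarrow> y \<in> carrier N \<Longrightarrow> y' \<in> carrier N \<Longrightarrow>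
    frag_of (x, y \<oplus>\<^bsub>N\<^esub> y') - frag_of (x, y) - frag_of (x, y') \<in> tensor_kernel k M N"
  "c \<in> carrier k \<Longrightarrow> x \<in> carrier M \<Longrightarrow> y \<in> carrier N \<Longrightarrow>
    frag_of (c \<odot>\<^bsub>M\<^esub> x, y) - frag_of (x, c \<odot>\<^bsub>N\<^esub> y) \<in> tensor_kernel k M N"
  by (rule T.ker_relation, unfold tensor_relations_def, blast)+

lemma act_closed:
  assumes "Poly_Mapping.keys c \<subseteq> carrier A \<times> carrier B" "Poly_Mapping.keys d \<subseteq> carrier M \<times> carrier N"
  shows "Poly_Mapping.keys (frag_act f g c d) \<subseteq> carrier M \<times> carrier N"
  using assms(1)
proof (induction c rule: frag_on_induct)
  case (of ab)
  show ?case using assms(2)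
  proof (induction d rule: frag_on_induct)
    case (of xy)
    then show ?case using \<open>ab \<in> carrier A \<times> carrier B\<close> f_closed g_closed by (cases ab; cases xy) simp
  qed (simp_all add: frag_act_diff_right frag_keys_diff)
qed (simp_all add: frag_act_diff_left frag_keys_diff)

lemma act_ker_right:
  assumes "Poly_Mapping.keys c \<subseteq> carrier A \<times> carrier B" "d \<in> tensor_kernel k M N"
  shows "frag_act f g c d \<in> tensor_kernel k M N"
  using assms(1)
proof (induction c rule: frag_on_induct)
  case (of ab)
  obtain a b where ab: "ab = (a, b)" "a \<in> carrier A" "b \<in> carrier B" using of by blast
  show ?case unfolding ab(1) using assms(2)
  proof (induction d rule: T.ker_induct)
    case (relation c)
    then show ?case
    proof (cases rule: T.relation_cases)
      case left then show ?thesis using ab by (simp add: frag_act_diff_right f_add_r relation_intros f_closed g_closed)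
    next
      case right then show ?thesis using ab by (simp add: frag_act_diff_right g_add_r relation_intros f_closed g_closed)
    next
      case scalar then show ?thesis
        using ab by (simp add: frag_act_diff_right f_smult_r g_smult_r relation_intros f_closed g_closed)
    qed
  qed (simp_all add: frag_act_minus frag_act_add_right T.ker_zero T.ker_minus T.ker_add)
qed (simp_all add: frag_act_diff_left T.ker_zero T.ker_diff)

lemma act_ker_left:
  assumes "c \<in> tensor_kernel k A B" "Poly_Mapping.keys d \<subseteq> carrier M \<times> carrier N"
  shows "frag_act f g c d \<in> tensor_kernel k M N"
  using assms(2)
proof (induction d rule: frag_on_induct)
  case (of xy)
  obtain x y where xy: "xy = (x, y)" "x \<in> carrier M" "y \<in> carrier N" using of by blast
  show ?case unfolding xy(1) using assms(1)
  proof (induction c rule: S.ker_induct)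
    case (relation c)
    then show ?case
    proof (cases rule: S.relation_cases)
      case left then show ?thesis using xy by (simp add: frag_act_diff_left f_add_l relation_intros f_closed g_closed)
    next
      case right then show ?thesis using xy by (simp add: frag_act_diff_left g_add_l relation_intros f_closed g_closed)
    next
      case scalar then show ?thesis
        using xy by (simp add: frag_act_diff_left f_smult_l g_smult_l relation_intros f_closed g_closed)
    qed
  qed (simp_all add: frag_act_minus frag_act_add_left T.ker_zero T.ker_minus T.ker_add)
qed (simp_all add: frag_act_diff_right T.ker_zero T.ker_diff)

definition act where
  "act U V = (\<Union>c\<in>U. \<Union>d\<in>V. tensor_class k M N (frag_act f g c d))"

text \<open>Changing representatives by kernel elements \<open>h\<close> and \<open>h'\<close>
  changes the result by \<open>h\<close> acting on the new right factor plus \<open>c\<close> acting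
  on \<open>h'\<close>, and both lie in the kernel. So the union over all representatives collapses
  to one class.\<close>

lemma act_class:
  assumes c: "Poly_Mapping.keys c \<subseteq> carrier A \<times> carrier B"
    and d: "Poly_Mapping.keys d \<subseteq> carrier M \<times> carrier N"
  shows "act (tensor_class k A B c) (tensor_class k M N d) = tensor_class k M N (frag_act f g c d)"
proof -
  have "tensor_class k M N (frag_act f g c' d') = tensor_class k M N (frag_act f g c d)"
    if cd: "c' \<in> tensor_class k A B c" "d' \<in> tensor_class k M N d" for c' d'
  proof -
    obtain h where h: "h \<in> tensor_kernel k A B" "c' = h + c" using cd S.mem_class_iff by blast
    obtain h' where h': "h' \<in> tensor_kernel k M N" "d' = h' + d" using cd T.mem_class_iff by blast
    have "Poly_Mapping.keys d' \<subseteq> carrier M \<times> carrier N"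
      using keys_add[of h' d] T.ker_closed[OF h'(1)] d h'(2) by blast
    then have "frag_act f g h d' + frag_act f g c h' \<in> tensor_kernel k M N"
      using act_ker_left[OF h(1)] act_ker_right[OF c h'(1)] T.ker_add by blast
    moreover have "frag_act f g h d' + frag_act f g c h' = frag_act f g c' d' - frag_act f g c d"
      unfolding h(2) by (simp add: frag_act_add_left) (simp add: h'(2) frag_act_add_right)
    ultimately show ?thesis by (intro T.class_eqI) simp
  qed
  then have "act (tensor_class k A B c) (tensor_class k M N d) =
      (\<Union>c'\<in>tensor_class k A B c. \<Union>d'\<in>tensor_class k M N d. tensor_class k M N (frag_act f g c d))"
    unfolding act_def by (intro SUP_cong refl)
  also have "\<dots> = tensor_class k M N (frag_act f g c d)"
    using S.class_self[of c] T.class_self[of d] by auto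
  finally show ?thesis .
qed

lemma act_mem:
  assumes "U \<in> carrier (tensor_group k A B)" "V \<in> carrier (tensor_group k M N)"
  shows "act U V \<in> carrier (tensor_group k M N)"
proof -
  obtain c where c: "Poly_Mapping.keys c \<subseteq> carrier A \<times> carrier B" "U = tensor_class k A B c"
    using assms(1) S.tens_carrier by auto
  obtain d where d: "Poly_Mapping.keys d \<subseteq> carrier M \<times> carrier N" "V = tensor_class k M N d"
    using assms(2) T.tens_carrier by auto
  show ?thesis unfolding c(2) d(2) act_class[OF c(1) d(1)]
    by (rule T.class_closed[OF act_closed[OF c(1) d(1)]])
qed

lemma act_pure:
  assumes "a \<in> carrier A" "b \<in> carrier B" "x \<in> carrier M" "y \<in> carrier N"
  shows "act (S.pure a b) (T.pure x y) = T.pure (f a x) (g b y)"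
  unfolding S.pure_def T.pure_def using assms by (simp add: act_class)

lemma act_add_left:
  assumes "U \<in> carrier (tensor_group k A B)" "U' \<in> carrier (tensor_group k A B)"
    and "V \<in> carrier (tensor_group k M N)"
  shows "act (U \<otimes>\<^bsub>tensor_group k A B\<^esub> U') V = act U V \<otimes>\<^bsub>tensor_group k M N\<^esub> act U' V"
proof -
  obtain c where c: "Poly_Mapping.keys c \<subseteq> carrier A \<times> carrier B" "U = tensor_class k A B c"
    using assms(1) S.tens_carrier by auto
  obtain c' where c': "Poly_Mapping.keys c' \<subseteq> carrier A \<times> carrier B" "U' = tensor_class k A B c'"
    using assms(2) S.tens_carrier by auto
  obtain d where d: "Poly_Mapping.keys d \<subseteq> carrier M \<times> carrier N" "V = tensor_class k M N d"
    using assms(3) T.tens_carrier by auto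
  have k: "Poly_Mapping.keys (c + c') \<subseteq> carrier A \<times> carrier B" using keys_add[of c c'] c c' by blast
  show ?thesis
    unfolding c(2) c'(2) d(2) S.class_add[OF c(1) c'(1)] act_class[OF k d(1)] act_class[OF c(1) d(1)]
      act_class[OF c'(1) d(1)] T.class_add[OF act_closed[OF c(1) d(1)] act_closed[OF c'(1) d(1)]]
    by (simp add: frag_act_add_left)
qed

lemma act_add_right:
  assumes "U \<in> carrier (tensor_group k A B)"
    and "V \<in> carrier (tensor_group k M N)" "V' \<in> carrier (tensor_group k M N)"
  shows "act U (V \<otimes>\<^bsub>tensor_group k M N\<^esub> V') = act U V \<otimes>\<^bsub>tensor_group k M N\<^esub> act U V'"
proof -
  obtain c where c: "Poly_Mapping.keys c \<subseteq> carrier A \<times> carrier B" "U = tensor_class k A B c"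
    using assms(1) S.tens_carrier by auto
  obtain d where d: "Poly_Mapping.keys d \<subseteq> carrier M \<times> carrier N" "V = tensor_class k M N d"
    using assms(2) T.tens_carrier by auto
  obtain d' where d': "Poly_Mapping.keys d' \<subseteq> carrier M \<times> carrier N" "V' = tensor_class k M N d'"
    using assms(3) T.tens_carrier by auto
  have k: "Poly_Mapping.keys (d + d') \<subseteq> carrier M \<times> carrier N" using keys_add[of d d'] d d' by blast
  show ?thesis
    unfolding c(2) d(2) d'(2) T.class_add[OF d(1) d'(1)] act_class[OF c(1) k] act_class[OF c(1) d(1)]
      act_class[OF c(1) d'(1)] T.class_add[OF act_closed[OF c(1) d(1)] act_closed[OF c(1) d'(1)]]
    by (simp add: frag_act_add_right)
qed

end

section \<open>Artinian algebras\<close>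

lemma (in abelian_monoid) finsum_mem_closed:
  assumes "\<zero> \<in> H" "\<And>a b. a \<in> H \<Longrightarrow> b \<in> H \<Longrightarrow> a \<oplus> b \<in> H" "\<And>j. j < (l::nat) \<Longrightarrow> f j \<in> H"
    and "\<And>j. j < l \<Longrightarrow> f j \<in> carrier G"
  shows "(\<Oplus>j\<in>{..<l}. f j) \<in> H"
  using assms(3,4)
proof (induction l)
  case 0
  then show ?case using assms(1) by simp
next
  case (Suc l)
  have "(\<Oplus>j\<in>{..<Suc l}. f j) = f l \<oplus> (\<Oplus>j\<in>{..<l}. f j)"
    unfolding lessThan_Suc by (rule finsum_insert) (use Suc.prems in auto)
  then show ?case using Suc assms(2) by simp
qed

lemma hom_finsum_lessThan:
  assumes G: "abelian_monoid G" and H: "abelian_monoid H"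
    and h: "\<And>x. x \<in> carrier G \<Longrightarrow> h x \<in> carrier H" "h \<zero>\<^bsub>G\<^esub> = \<zero>\<^bsub>H\<^esub>"
      "\<And>x y. x \<in> carrier G \<Longrightarrow> y \<in> carrier G \<Longrightarrow> h (x \<oplus>\<^bsub>G\<^esub> y) = h x \<oplus>\<^bsub>H\<^esub> h y"
    and f: "\<And>j. j < (l::nat) \<Longrightarrow> f j \<in> carrier G"
  shows "h (finsum G f {..<l}) = finsum H (\<lambda>j. h (f j)) {..<l}"
  using f
proof (induction l)
  case 0
  show ?case using h(2) by (simp add: abelian_monoid.finsum_empty[OF G] abelian_monoid.finsum_empty[OF H])
next
  case (Suc l)
  have f: "f \<in> {..<l} \<rightarrow> carrier G" "f l \<in> carrier G" using Suc.prems by auto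
  have "finsum G f {..<Suc l} = f l \<oplus>\<^bsub>G\<^esub> finsum G f {..<l}"
    unfolding lessThan_Suc by (rule abelian_monoid.finsum_insert[OF G]) (use f in auto)
  moreover have "finsum H (\<lambda>j. h (f j)) {..<Suc l} = h (f l) \<oplus>\<^bsub>H\<^esub> finsum H (\<lambda>j. h (f j)) {..<l}"
    unfolding lessThan_Suc by (rule abelian_monoid.finsum_insert[OF H]) (use f h(1) in auto)
  moreover have "finsum G f {..<l} \<in> carrier G" by (rule abelian_monoid.finsum_closed[OF G f(1)])
  ultimately show ?case using Suc f h(3) by simp
qed

text \<open>As \<open>a^n = 0\<close>, the power \<open>(a + b)^n\<close> is a multiple of
  \<open>b\<close>, and its \<open>m\<close>-th power vanishes. The exponent \<open>n * m\<close> is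
  crude but avoids binomial coefficients.\<close>

lemma (in cring) nilpotent_add:
  assumes "a \<in> carrier R" "b \<in> carrier R" "a [^] (n::nat) = \<zero>" "b [^] (m::nat) = \<zero>" "0 < m"
  shows "(a \<oplus> b) [^] (n * m) = \<zero>"
proof -
  obtain d where d: "d \<in> carrier R" "(a \<oplus> b) [^] n = a [^] n \<oplus> d \<otimes> b"
    using pow_add_multiple[OF assms(1,2)] by blast
  have "(a \<oplus> b) [^] (n * m) = ((a \<oplus> b) [^] n) [^] m" using assms by (simp add: nat_pow_pow)
  also have "\<dots> = d [^] m \<otimes> b [^] m" using d assms by (simp add: nat_pow_distrib)
  finally show ?thesis using assms d by simp
qed

lemma (in cring) eval_map2_minus:
  assumes "length p = length q" "set p \<subseteq> carrier R" "set q \<subseteq> carrier R" "x \<in> carrier R"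
  shows "eval (map2 (\<lambda>a b. a \<ominus> b) p q) x = eval p x \<ominus> eval q x"
  using assms
proof (induction p q rule: list_induct2)
  case Nil
  then show ?case by (simp add: minus_eq)
next
  case (Cons a p b q)
  have c: "a \<in> carrier R" "b \<in> carrier R" "set p \<subseteq> carrier R" "set q \<subseteq> carrier R"
    using Cons.prems by auto
  have "eval p x \<in> carrier R" "eval q x \<in> carrier R"
    using eval_in_carrier[OF c(3)] eval_in_carrier[OF c(4)] Cons.prems by auto
  then show ?case
    using Cons c by (simp add: minus_eq l_distr l_minus minus_add a_ac)
qed

text \<open>Coefficient lists start with the leading coefficient, so this splits off the constant
  term.\<close>

lemma (in cring) eval_snoc:
  assumes "set p \<subseteq> carrier R" "c \<in> carrier R" "x \<in> carrier R"
  shows "eval (p @ [c]) x = eval p x \<otimes> x \<oplus> c"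
  using assms
proof (induction p)
  case (Cons a p)
  then have "eval p x \<in> carrier R" by (intro eval_in_carrier) auto
  then show ?case using Cons by (simp add: l_distr r_distr m_ac a_ac)
qed simp

lemma (in algebra) structure_map_closed: "c \<in> carrier R \<Longrightarrow> structure_map M c \<in> carrier M"
  by (simp add: structure_map_def)

lemma (in algebra) smult_structure_map:
  "c \<in> carrier R \<Longrightarrow> x \<in> carrier M \<Longrightarrow> c \<odot>\<^bsub>M\<^esub> x = structure_map M c \<otimes>\<^bsub>M\<^esub> x"
  unfolding structure_map_def using smult_assoc2[of c "\<one>\<^bsub>M\<^esub>" x] by simp

lemma (in algebra) structure_map_hom: "structure_map M \<in> ring_hom R M"
proof (rule ring_hom_memI)
  fix c d assume c: "c \<in> carrier R" and d: "d \<in> carrier R"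
  show "structure_map M c \<in> carrier M" using structure_map_closed c .
  show "structure_map M (c \<otimes>\<^bsub>R\<^esub> d) = structure_map M c \<otimes>\<^bsub>M\<^esub> structure_map M d"
    using smult_structure_map[OF c structure_map_closed[OF d]] c d
    by (simp add: structure_map_def smult_assoc1)
  show "structure_map M (c \<oplus>\<^bsub>R\<^esub> d) = structure_map M c \<oplus>\<^bsub>M\<^esub> structure_map M d"
    using c d by (simp add: structure_map_def smult_l_distr)
qed (simp add: structure_map_def)

section \<open>Local algebras whose residue field is the base field\<close>

locale residue_algebra =
  fixes k (structure) and A (structure) and \<mm>
  assumes field: "field k" and alg: "algebra k A" and noetherian: "noetherian_ring A"
    and local: "local_ring A \<mm>" and residue: "residue_field_is k A \<mm>"
begin

sublocale k: field k by (rule field)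
sublocale A: algebra k A by (rule alg)

abbreviation "\<sigma> \<equiv> structure_map A"

lemmas \<sigma>_closed = A.structure_map_closed
  and \<sigma>_smult = A.smult_structure_map
  and \<sigma>_hom = A.structure_map_hom

text \<open>The residue map from \<open>A\<close> onto \<open>k\<close>, that is, the scalar
  congruent to \<open>a\<close> modulo \<open>\<mm>\<close>; it is a retraction of
  \<open>\<sigma>\<close>.\<close>

definition \<rho> where "\<rho> a = inv_into (carrier k) (\<lambda>c. \<mm> +>\<^bsub>A\<^esub> \<sigma> c) (\<mm> +>\<^bsub>A\<^esub> a)"

lemma max_ideal: "ideal \<mm> A" by (rule local_ring_proper(1)[OF local])

lemma quot_iso: "(\<lambda>c. \<mm> +>\<^bsub>A\<^esub> \<sigma> c) \<in> ring_iso k (A Quot \<mm>)"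
  using residue by (simp add: residue_field_is_def)

lemma \<rho>_hom: "\<rho> \<in> ring_hom A k"
proof -
  have "inv_into (carrier k) (\<lambda>c. \<mm> +>\<^bsub>A\<^esub> \<sigma> c) \<in> ring_hom (A Quot \<mm>) k"
    using ring_iso_set_sym[OF k.ring_axioms quot_iso] by (simp add: ring_iso_def)
  from ring_hom_trans[OF ideal.rcos_ring_hom[OF max_ideal] this] show ?thesis
    unfolding \<rho>_def comp_def .
qed

lemma \<rho>_closed: "a \<in> carrier A \<Longrightarrow> \<rho> a \<in> carrier k"
  by (rule ring_hom_closed[OF \<rho>_hom])

lemma quot_bij: "bij_betw (\<lambda>c. \<mm> +>\<^bsub>A\<^esub> \<sigma> c) (carrier k) (carrier (A Quot \<mm>))"
  using quot_iso by (simp add: ring_iso_def)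

lemma \<rho>\<sigma>: "c \<in> carrier k \<Longrightarrow> \<rho> (\<sigma> c) = c"
  unfolding \<rho>_def by (rule inv_into_f_f[OF bij_betw_imp_inj_on[OF quot_bij]])

lemma \<rho>_smult: "c \<in> carrier k \<Longrightarrow> a \<in> carrier A \<Longrightarrow> \<rho> (c \<odot>\<^bsub>A\<^esub> a) = c \<otimes>\<^bsub>k\<^esub> \<rho> a"
  by (simp add: \<sigma>_smult \<sigma>_closed ring_hom_mult[OF \<rho>_hom] \<rho>\<sigma>)

lemma residue_diff:
  assumes a: "a \<in> carrier A"
  shows "a \<ominus>\<^bsub>A\<^esub> \<sigma> (\<rho> a) \<in> \<mm>"
proof -
  have "\<mm> +>\<^bsub>A\<^esub> a \<in> carrier (A Quot \<mm>)"
    using ring_hom_closed[OF ideal.rcos_ring_hom[OF max_ideal] a] .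
  then have "\<mm> +>\<^bsub>A\<^esub> \<sigma> (\<rho> a) = \<mm> +>\<^bsub>A\<^esub> a"
    unfolding \<rho>_def using bij_betw_imp_surj_on[OF quot_bij] by (intro f_inv_into_f) simp
  then show ?thesis
    using A.quotient_eq_iff_same_a_r_cos[OF max_ideal a \<sigma>_closed[OF \<rho>_closed[OF a]]] by simp
qed

end

section \<open>Algebraic local algebras: nilpotency, dimension zero and finite bases\<close>

locale artinian_algebra = residue_algebra +
  assumes algebraic: "algebraic_algebra k A"
begin

text \<open>An algebraic element of the maximal ideal is nilpotent: a polynomial relation for it is a power
  of the element times a polynomial with nonzero constant term, which is a unit.\<close>

lemma eval_power_unit:
  assumes x: "x \<in> \<mm>" and "set p \<subseteq> \<sigma> ` carrier k" "\<exists>c\<in>set p. c \<noteq> \<zero>\<^bsub>A\<^esub>"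
  shows "\<exists>n::nat. \<exists>u\<in>Units A. ring.eval A p x = x [^]\<^bsub>A\<^esub> n \<otimes>\<^bsub>A\<^esub> u"
  using assms(2,3)
proof (induction p rule: rev_induct)
  case (snoc c p)
  have xA: "x \<in> carrier A" using x local_ring_proper(2)[OF local] by blast
  have c: "c \<in> \<sigma> ` carrier k" and p: "set p \<subseteq> \<sigma> ` carrier k" using snoc.prems by auto
  have cA: "c \<in> carrier A" and pA: "set p \<subseteq> carrier A" using c p \<sigma>_closed by auto
  have ev: "A.eval (p @ [c]) x = A.eval p x \<otimes>\<^bsub>A\<^esub> x \<oplus>\<^bsub>A\<^esub> c" by (rule A.eval_snoc[OF pA cA xA])
  have evA: "A.eval p x \<in> carrier A" by (rule A.eval_in_carrier[OF pA xA])
  show ?case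
  proof (cases "c = \<zero>\<^bsub>A\<^esub>")
    case True
    then obtain n u where nu: "u \<in> Units A" "A.eval p x = x [^]\<^bsub>A\<^esub> (n::nat) \<otimes>\<^bsub>A\<^esub> u"
      using snoc by auto
    have "A.eval (p @ [c]) x = x [^]\<^bsub>A\<^esub> Suc n \<otimes>\<^bsub>A\<^esub> u"
      using ev True nu(2) xA A.Units_closed[OF nu(1)] by (simp add: A.m_ac)
    then show ?thesis using nu(1) by blast
  next
    case False
    obtain b where b: "b \<in> carrier k" "c = \<sigma> b" using c by blast
    then have "b \<noteq> \<zero>\<^bsub>k\<^esub>" using False ring_hom_zero[OF \<sigma>_hom k.ring_axioms A.ring_axioms] by auto
    then have bu: "b \<in> Units k" using b k.field_Units by simp
    interpret m: ideal \<mm> A by (rule max_ideal)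
    have "A.eval p x \<otimes>\<^bsub>A\<^esub> x \<oplus>\<^bsub>A\<^esub> c \<notin> \<mm>"
    proof
      assume mem: "A.eval p x \<otimes>\<^bsub>A\<^esub> x \<oplus>\<^bsub>A\<^esub> c \<in> \<mm>"
      have px: "A.eval p x \<otimes>\<^bsub>A\<^esub> x \<in> \<mm>" using m.I_l_closed[OF x evA] .
      have "\<ominus>\<^bsub>A\<^esub> (A.eval p x \<otimes>\<^bsub>A\<^esub> x) \<oplus>\<^bsub>A\<^esub> (A.eval p x \<otimes>\<^bsub>A\<^esub> x \<oplus>\<^bsub>A\<^esub> c) \<in> \<mm>"
        by (rule m.a_closed[OF m.a_inv_closed[OF px] mem])
      then have cm: "c \<in> \<mm>" using evA xA cA by (simp add: A.r_neg1)
      have "\<sigma> (inv\<^bsub>k\<^esub> b) \<otimes>\<^bsub>A\<^esub> c \<in> \<mm>"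
        by (rule m.I_l_closed[OF cm \<sigma>_closed[OF k.Units_inv_closed[OF bu]]])
      moreover have "\<sigma> (inv\<^bsub>k\<^esub> b) \<otimes>\<^bsub>A\<^esub> c = \<one>\<^bsub>A\<^esub>"
        using ring_hom_mult[OF \<sigma>_hom k.Units_inv_closed[OF bu] b(1)] ring_hom_one[OF \<sigma>_hom] b(2)
        by (simp add: k.Units_l_inv[OF bu])
      ultimately show False using local_ring_proper(3)[OF local] by simp
    qed
    then have "A.eval p x \<otimes>\<^bsub>A\<^esub> x \<oplus>\<^bsub>A\<^esub> c \<in> Units A"
      by (intro local_ring_unit[OF local noetherian]) (use evA xA cA in simp_all)
    then show ?thesis unfolding ev
      by (intro exI[of _ "0::nat"] bexI[of _ "A.eval p x \<otimes>\<^bsub>A\<^esub> x \<oplus>\<^bsub>A\<^esub> c"]) (use evA xA cA in simp_all)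
  qed
qed simp

lemma nilpotent:
  assumes x: "x \<in> \<mm>"
  shows "\<exists>n::nat. x [^]\<^bsub>A\<^esub> n = \<zero>\<^bsub>A\<^esub>"
proof -
  let ?K = "\<sigma> ` carrier k"
  have xA: "x \<in> carrier A" using x local_ring_proper(2)[OF local] by blast
  have KA: "?K \<subseteq> carrier A" using \<sigma>_closed by auto
  \<comment> \<open>Being algebraic means that evaluation at \<open>x\<close> is not injective on
    polynomials, so a relation has to be made from two distinct polynomials with the same
    value.\<close>
  have "\<not> inj_on (\<lambda>p. A.eval p x) (carrier (univ_poly A ?K))"
    using algebraic xA unfolding algebraic_algebra_def over_def A.transcendental_def by blast
  then obtain p q where pq: "p \<in> carrier (univ_poly A ?K)" "q \<in> carrier (univ_poly A ?K)" "p \<noteq> q"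
    "A.eval p x = A.eval q x" unfolding inj_on_def by blast
  obtain p q where pq: "p \<in> carrier (univ_poly A ?K)" "q \<in> carrier (univ_poly A ?K)" "p \<noteq> q"
    "A.eval p x = A.eval q x" "length q \<le> length p"
    using pq by (cases "length q \<le> length p") (metis, metis nle_le)
  have poly: "polynomial\<^bsub>A\<^esub> ?K p" "polynomial\<^bsub>A\<^esub> ?K q" using pq by (simp_all add: univ_poly_def)
  \<comment> \<open>The shorter list is padded with leading zeros so that subtraction of
    coefficients aligns equal powers.\<close>
  define n where "n = length p - length q"
  define q' where "q' = replicate n \<zero>\<^bsub>A\<^esub> @ q"
  have len: "length p = length q'" using pq(5) by (simp add: q'_def n_def)
  have zK: "\<zero>\<^bsub>A\<^esub> \<in> ?K"
    using ring_hom_zero[OF \<sigma>_hom k.ring_axioms A.ring_axioms] by (metis image_eqI k.zero_closed)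
  have pK: "set p \<subseteq> ?K" and qK: "set q \<subseteq> ?K" using poly by (auto simp: polynomial_def)
  have q'K: "set q' \<subseteq> ?K" using qK zK by (auto simp: q'_def)
  \<comment> \<open>Genuine padding would give \<open>p\<close> a zero leading coefficient, which
    \<open>polynomial\<close> excludes.\<close>
  have "p \<noteq> q'"
  proof
    assume eq: "p = q'"
    show False
    proof (cases n)
      case 0
      then show False using eq pq(3) by (simp add: q'_def)
    next
      case (Suc m)
      then have "lead_coeff p = \<zero>\<^bsub>A\<^esub>" "p \<noteq> []" using eq by (simp_all add: q'_def)
      then show False using poly(1) by (simp add: polynomial_def)
    qed
  qed
  then obtain i where i: "i < length p" "p ! i \<noteq> q' ! i" using len nth_equalityI by blast
  let ?d = "map2 (\<lambda>a b. a \<ominus>\<^bsub>A\<^esub> b) p q'"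
  have nthK: "p ! i \<in> ?K" "q' ! i \<in> ?K" using i len pK q'K by (metis nth_mem subsetD)+
  have dK: "set ?d \<subseteq> ?K"
  proof
    fix c assume "c \<in> set ?d"
    then obtain a b where ab: "a \<in> set p" "b \<in> set q'" "c = a \<ominus>\<^bsub>A\<^esub> b"
      by (auto dest: set_zip_leftD set_zip_rightD)
    then have "a \<in> ?K" "b \<in> ?K" using pK q'K by blast+
    then obtain a' b' where ab': "a' \<in> carrier k" "b' \<in> carrier k" "a = \<sigma> a'" "b = \<sigma> b'" by blast
    interpret h: ring_hom_cring k A \<sigma>
      by (intro ring_hom_cring.intro k.is_cring A.is_cring ring_hom_cring_axioms.intro \<sigma>_hom)
    have "c = \<sigma> (a' \<ominus>\<^bsub>k\<^esub> b')" using ab(3) ab' by (simp add: A.minus_eq k.minus_eq)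
    then show "c \<in> ?K" using ab' by blast
  qed
  have "?d ! i \<in> set ?d" using i len by (intro nth_mem) simp
  moreover have "?d ! i \<noteq> \<zero>\<^bsub>A\<^esub>"
    using i len A.r_right_minus_eq[OF subsetD[OF KA nthK(1)] subsetD[OF KA nthK(2)]] by simp
  ultimately have "\<exists>c\<in>set ?d. c \<noteq> \<zero>\<^bsub>A\<^esub>" by blast
  then obtain m u where u: "u \<in> Units A" "A.eval ?d x = x [^]\<^bsub>A\<^esub> (m::nat) \<otimes>\<^bsub>A\<^esub> u"
    using eval_power_unit[OF x dK] by blast
  have "A.eval q' x = A.eval q x"
    unfolding q'_def by (rule A.eval_replicate) (use qK KA xA in auto)
  moreover have "A.eval ?d x = A.eval p x \<ominus>\<^bsub>A\<^esub> A.eval q' x"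
    by (rule A.eval_map2_minus[OF len _ _ xA]) (use pK q'K KA in auto)
  moreover have "A.eval q x \<in> carrier A" by (rule A.eval_in_carrier) (use qK KA xA in auto)
  ultimately have "x [^]\<^bsub>A\<^esub> m \<otimes>\<^bsub>A\<^esub> u = \<zero>\<^bsub>A\<^esub>"
    using u(2) pq(4) by (simp add: A.minus_eq A.r_neg)
  then have "(x [^]\<^bsub>A\<^esub> m \<otimes>\<^bsub>A\<^esub> u) \<otimes>\<^bsub>A\<^esub> inv\<^bsub>A\<^esub> u = \<zero>\<^bsub>A\<^esub>" using u(1) by simp
  then have "x [^]\<^bsub>A\<^esub> m = \<zero>\<^bsub>A\<^esub>"
    using u(1) xA A.Units_closed[OF u(1)] by (simp add: A.m_assoc A.Units_r_inv)
  then show ?thesis by blast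
qed

lemma prime_eq_max:
  assumes P: "primeideal P A"
  shows "P = \<mm>"
proof -
  interpret P: primeideal P A by (rule P)
  have "P \<subseteq> \<mm>" using local_ring_ideal_subset[OF local noetherian P.is_ideal] P.I_notcarr by simp
  moreover have "\<mm> \<subseteq> P"
  proof
    fix x assume x: "x \<in> \<mm>"
    then have xA: "x \<in> carrier A" using local_ring_proper(2)[OF local] by blast
    obtain n where "x [^]\<^bsub>A\<^esub> (n::nat) = \<zero>\<^bsub>A\<^esub>" using nilpotent[OF x] by blast
    then have "x [^]\<^bsub>A\<^esub> n \<in> P" using P.zero_closed by simp
    then show "x \<in> P" by (rule P.pow_mem_imp_mem[OF xA])
  qed
  ultimately show ?thesis by blast
qed

lemma ideal_dim_zero: "ideal_dim A I = 0"
proof -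
  have "n = 0" if n: "prime_chain A I n" for n
  proof (rule ccontr)
    assume "n \<noteq> 0"
    obtain P where "\<And>i. i \<le> n \<Longrightarrow> primeideal (P i) A" "\<And>i. i < n \<Longrightarrow> P i \<subset> P (Suc i)"
      using n unfolding prime_chain_def by blast
    then have "P 0 = \<mm>" "P (Suc 0) = \<mm>" "P 0 \<subset> P (Suc 0)" using prime_eq_max \<open>n \<noteq> 0\<close> by auto
    then show False by simp
  qed
  then have "ideal_dim A I \<le> 0"
    unfolding ideal_dim_def by (intro Sup_least) (force simp: zero_enat_def)
  then show ?thesis by simp
qed

text \<open>All dimensions are zero, so depth is squeezed to zero and the one-step filtration from
  zero to \<open>L\<close> already has a Cohen-Macaulay factor.\<close>

lemma sequentially_cohen_macaulay_fin_gen: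
  assumes fg: "fin_gen_module A L" and ne: "carrier L \<noteq> {\<zero>\<^bsub>L\<^esub>}"
  shows "sequentially_cohen_macaulay A L"
proof -
  have mod: "module A L" using fg by (simp add: fin_gen_module_def)
  interpret L: local_noetherian_module A L \<mm>
    by (intro local_noetherian_module.intro local_noetherian_module_axioms.intro mod noetherian local
        fin_gen_imp_noetherian_module[OF noetherian fg])
  obtain z where z: "z \<in> carrier L" "z \<notin> {\<zero>\<^bsub>L\<^esub>}" using ne L.M.zero_closed by blast
  let ?F = "\<lambda>i::nat. if i = 0 then {\<zero>\<^bsub>L\<^esub>} else carrier L"
  have "depth_on L \<mm> (carrier L) {\<zero>\<^bsub>L\<^esub>} \<le> ideal_dim A (L.colon {\<zero>\<^bsub>L\<^esub>} {z})"
    by (rule L.depth_on_le_dim[OF L.carrier_is_submodule L.submodule_zero_singleton _ z]) simp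
  then have "depth_on L \<mm> (carrier L) {\<zero>\<^bsub>L\<^esub>} = 0" by (simp add: ideal_dim_zero)
  then have "L.cm_filtration 1 ?F"
    unfolding L.cm_filtration_def
    using L.submodule_zero_singleton L.carrier_is_submodule z by (auto simp: ideal_dim_zero)
  then show ?thesis unfolding L.sequentially_cohen_macaulay_iff by blast
qed

text \<open>A basis of \<open>W\<close> over \<open>k\<close>, given together with its coordinate
  functions \<open>c\<close> rather than by independence: vectors and coordinates become the
  injections and projections of \<open>L \<otimes> N\<close>.\<close>

definition basis_of where
  "basis_of L W e c l \<longleftrightarrow>
     (\<forall>j<l. e j \<in> W) \<and>
     (\<forall>j<l. \<forall>x\<in>W. c j x \<in> carrier k) \<and>
     (\<forall>j<l. \<forall>x\<in>W. \<forall>y\<in>W. c j (x \<oplus>\<^bsub>L\<^esub> y) = c j x \<oplus>\<^bsub>k\<^esub> c j y) \<and>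
     (\<forall>j<l. \<forall>a\<in>carrier k. \<forall>x\<in>W. c j (\<sigma> a \<odot>\<^bsub>L\<^esub> x) = a \<otimes>\<^bsub>k\<^esub> c j x) \<and>
     (\<forall>i<l. \<forall>j<l. c i (e j) = (if i = j then \<one>\<^bsub>k\<^esub> else \<zero>\<^bsub>k\<^esub>)) \<and>
     (\<forall>x\<in>W. x = finsum L (\<lambda>j. \<sigma> (c j x) \<odot>\<^bsub>L\<^esub> e j) {..<l :: nat})"

lemma basis_ofI:
  assumes "\<And>j. j < l \<Longrightarrow> e j \<in> W"
    and "\<And>j x. j < l \<Longrightarrow> x \<in> W \<Longrightarrow> c j x \<in> carrier k"
    and "\<And>j x y. j < l \<Longrightarrow> x \<in> W \<Longrightarrow> y \<in> W \<Longrightarrow> c j (x \<oplus>\<^bsub>L\<^esub> y) = c j x \<oplus>\<^bsub>k\<^esub> c j y"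
    and "\<And>j a x. j < l \<Longrightarrow> a \<in> carrier k \<Longrightarrow> x \<in> W \<Longrightarrow> c j (\<sigma> a \<odot>\<^bsub>L\<^esub> x) = a \<otimes>\<^bsub>k\<^esub> c j x"
    and "\<And>i j. i < l \<Longrightarrow> j < l \<Longrightarrow> c i (e j) = (if i = j then \<one>\<^bsub>k\<^esub> else \<zero>\<^bsub>k\<^esub>)"
    and "\<And>x. x \<in> W \<Longrightarrow> x = finsum L (\<lambda>j. \<sigma> (c j x) \<odot>\<^bsub>L\<^esub> e j) {..<l :: nat}"
  shows "basis_of L W e c l"
  unfolding basis_of_def using assms by blast

lemma basis_ofD:
  assumes "basis_of L W e c l"
  shows "\<And>j. j < l \<Longrightarrow> e j \<in> W"
    and "\<And>j x. j < l \<Longrightarrow> x \<in> W \<Longrightarrow> c j x \<in> carrier k"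
    and "\<And>j x y. j < l \<Longrightarrow> x \<in> W \<Longrightarrow> y \<in> W \<Longrightarrow> c j (x \<oplus>\<^bsub>L\<^esub> y) = c j x \<oplus>\<^bsub>k\<^esub> c j y"
    and "\<And>j a x. j < l \<Longrightarrow> a \<in> carrier k \<Longrightarrow> x \<in> W \<Longrightarrow> c j (\<sigma> a \<odot>\<^bsub>L\<^esub> x) = a \<otimes>\<^bsub>k\<^esub> c j x"
    and "\<And>i j. i < l \<Longrightarrow> j < l \<Longrightarrow> c i (e j) = (if i = j then \<one>\<^bsub>k\<^esub> else \<zero>\<^bsub>k\<^esub>)"
    and "\<And>x. x \<in> W \<Longrightarrow> x = finsum L (\<lambda>j. \<sigma> (c j x) \<odot>\<^bsub>L\<^esub> e j) {..<l :: nat}"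
  using assms unfolding basis_of_def by metis+

text \<open>\<open>W + k y\<close> is stable under all of \<open>A\<close>: a ring element is a
  scalar plus an element of \<open>\<mm>\<close>, and the latter sends \<open>y\<close> into
  \<open>W\<close>.\<close>

lemma basis_extend:
  assumes mod: "module A L" and W: "submodule W A L" and b: "basis_of L W e c l"
    and y: "y \<in> carrier L" "y \<notin> W" and my: "\<And>a. a \<in> \<mm> \<Longrightarrow> a \<odot>\<^bsub>L\<^esub> y \<in> W"
  shows "\<exists>W' e' c'. submodule W' A L \<and> W \<subseteq> W' \<and> y \<in> W' \<and> basis_of L W' e' c' (Suc l)"
proof -
  interpret L: module A L by (rule mod)
  interpret h: ring_hom_cring k A \<sigma>
    by (intro ring_hom_cring.intro k.is_cring A.is_cring ring_hom_cring_axioms.intro \<sigma>_hom)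
  note sub = L.submodule_subset[OF W] and Wc = L.submoduleE(3-5)[OF W]
  note bD = basis_ofD[OF b]
  define W' where "W' = {w \<oplus>\<^bsub>L\<^esub> \<sigma> a \<odot>\<^bsub>L\<^esub> y | w a. w \<in> W \<and> a \<in> carrier k}"
  \<comment> \<open>If the scalars differed, a nonzero, hence invertible, scalar multiple of
    \<open>y\<close> would lie in \<open>W\<close>.\<close>
  have uniq: "w = w' \<and> a = a'"
    if wa: "w \<in> W" "w' \<in> W" "a \<in> carrier k" "a' \<in> carrier k"
      and eq: "w \<oplus>\<^bsub>L\<^esub> \<sigma> a \<odot>\<^bsub>L\<^esub> y = w' \<oplus>\<^bsub>L\<^esub> \<sigma> a' \<odot>\<^bsub>L\<^esub> y" for w w' a a'
  proof -
    have c: "w \<in> carrier L" "w' \<in> carrier L" "\<sigma> a \<odot>\<^bsub>L\<^esub> y \<in> carrier L" "\<sigma> a' \<odot>\<^bsub>L\<^esub> y \<in> carrier L"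
      using wa sub y \<sigma>_closed by auto
    have "a = a'"
    proof (rule ccontr)
      assume ne: "a \<noteq> a'"
      let ?d = "a \<ominus>\<^bsub>k\<^esub> a'"
      have dk: "?d \<in> carrier k" using wa by simp
      have "?d \<noteq> \<zero>\<^bsub>k\<^esub>" using ne k.r_right_minus_eq wa by simp
      then have du: "?d \<in> Units k" using dk k.field_Units by simp
      have "\<sigma> ?d \<odot>\<^bsub>L\<^esub> y = \<sigma> a \<odot>\<^bsub>L\<^esub> y \<ominus>\<^bsub>L\<^esub> \<sigma> a' \<odot>\<^bsub>L\<^esub> y"
        using wa y \<sigma>_closed by (simp add: k.minus_eq a_minus_def L.smult_l_distr L.smult_l_minus)
      also have "\<dots> = w' \<ominus>\<^bsub>L\<^esub> w"
      proof -
        define u where "u = \<sigma> a \<odot>\<^bsub>L\<^esub> y"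
        define v where "v = \<sigma> a' \<odot>\<^bsub>L\<^esub> y"
        have uv: "u \<in> carrier L" "v \<in> carrier L" "w \<oplus>\<^bsub>L\<^esub> u = w' \<oplus>\<^bsub>L\<^esub> v" using c eq by (simp_all add: u_def v_def)
        have "u = \<ominus>\<^bsub>L\<^esub> w \<oplus>\<^bsub>L\<^esub> (w' \<oplus>\<^bsub>L\<^esub> v)" using uv c L.M.r_neg1[of w u] by simp
        then have "u \<ominus>\<^bsub>L\<^esub> v = \<ominus>\<^bsub>L\<^esub> w \<oplus>\<^bsub>L\<^esub> w'"
          using uv(2) c(1,2) by (simp add: a_minus_def L.M.a_assoc L.M.r_neg)
        then show ?thesis using c by (simp add: u_def v_def a_minus_def L.M.a_comm)
      qed
      also have "\<dots> \<in> W" using wa L.submodule_minus[OF W] by simp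
      finally have "\<sigma> (inv\<^bsub>k\<^esub> ?d) \<odot>\<^bsub>L\<^esub> (\<sigma> ?d \<odot>\<^bsub>L\<^esub> y) \<in> W"
        using Wc(2)[OF \<sigma>_closed[OF k.Units_inv_closed[OF du]]] by blast
      moreover have "\<sigma> (inv\<^bsub>k\<^esub> ?d) \<odot>\<^bsub>L\<^esub> (\<sigma> ?d \<odot>\<^bsub>L\<^esub> y) = (\<sigma> (inv\<^bsub>k\<^esub> ?d) \<otimes>\<^bsub>A\<^esub> \<sigma> ?d) \<odot>\<^bsub>L\<^esub> y"
        using L.smult_assoc1[OF \<sigma>_closed[OF k.Units_inv_closed[OF du]] \<sigma>_closed[OF dk] y(1)] by simp
      moreover have "\<sigma> (inv\<^bsub>k\<^esub> ?d) \<otimes>\<^bsub>A\<^esub> \<sigma> ?d = \<one>\<^bsub>A\<^esub>"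
        using ring_hom_mult[OF \<sigma>_hom k.Units_inv_closed[OF du] dk] ring_hom_one[OF \<sigma>_hom]
          k.Units_l_inv[OF du] by simp
      ultimately show False using y by simp
    qed
    then show ?thesis using eq c by simp
  qed
  define pr where "pr v = (SOME p. fst p \<in> W \<and> snd p \<in> carrier k \<and> v = fst p \<oplus>\<^bsub>L\<^esub> \<sigma> (snd p) \<odot>\<^bsub>L\<^esub> y)" for v
  have pr: "pr (w \<oplus>\<^bsub>L\<^esub> \<sigma> a \<odot>\<^bsub>L\<^esub> y) = (w, a)" if wa: "w \<in> W" "a \<in> carrier k" for w a
  proof -
    let ?v = "w \<oplus>\<^bsub>L\<^esub> \<sigma> a \<odot>\<^bsub>L\<^esub> y"
    have "fst (pr ?v) \<in> W \<and> snd (pr ?v) \<in> carrier k \<and> ?v = fst (pr ?v) \<oplus>\<^bsub>L\<^esub> \<sigma> (snd (pr ?v)) \<odot>\<^bsub>L\<^esub> y"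
      unfolding pr_def by (rule someI[of _ "(w, a)"]) (use wa in simp)
    then show ?thesis using uniq[of w "fst (pr ?v)" a "snd (pr ?v)"] wa by (metis prod.collapse)
  qed
  have W'E: "\<exists>w a. w \<in> W \<and> a \<in> carrier k \<and> v = w \<oplus>\<^bsub>L\<^esub> \<sigma> a \<odot>\<^bsub>L\<^esub> y" if "v \<in> W'" for v
    using that unfolding W'_def by blast
  have W'I: "w \<oplus>\<^bsub>L\<^esub> \<sigma> a \<odot>\<^bsub>L\<^esub> y \<in> W'" if "w \<in> W" "a \<in> carrier k" for w a
    using that unfolding W'_def by blast
  have add: "(w \<oplus>\<^bsub>L\<^esub> \<sigma> a \<odot>\<^bsub>L\<^esub> y) \<oplus>\<^bsub>L\<^esub> (w' \<oplus>\<^bsub>L\<^esub> \<sigma> a' \<odot>\<^bsub>L\<^esub> y) = (w \<oplus>\<^bsub>L\<^esub> w') \<oplus>\<^bsub>L\<^esub> \<sigma> (a \<oplus>\<^bsub>k\<^esub> a') \<odot>\<^bsub>L\<^esub> y"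
    if "w \<in> W" "w' \<in> W" "a \<in> carrier k" "a' \<in> carrier k" for w w' a a'
    using that sub y \<sigma>_closed by (simp add: L.smult_l_distr L.M.add.m_ac)
  have scal: "\<sigma> b \<odot>\<^bsub>L\<^esub> (w \<oplus>\<^bsub>L\<^esub> \<sigma> a \<odot>\<^bsub>L\<^esub> y) = \<sigma> b \<odot>\<^bsub>L\<^esub> w \<oplus>\<^bsub>L\<^esub> \<sigma> (b \<otimes>\<^bsub>k\<^esub> a) \<odot>\<^bsub>L\<^esub> y"
    if "w \<in> W" "a \<in> carrier k" "b \<in> carrier k" for w a b
    using that sub y \<sigma>_closed by (simp add: L.smult_r_distr L.smult_assoc1)
  have WW': "w \<in> W'" and prW: "pr w = (w, \<zero>\<^bsub>k\<^esub>)" if "w \<in> W" for w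
  proof -
    have "w = w \<oplus>\<^bsub>L\<^esub> \<sigma> \<zero>\<^bsub>k\<^esub> \<odot>\<^bsub>L\<^esub> y" using sub[OF that] y by simp
    then show "w \<in> W'" "pr w = (w, \<zero>\<^bsub>k\<^esub>)" using W'I[OF that k.zero_closed] pr[OF that k.zero_closed] by simp_all
  qed
  have y_eq: "y = \<zero>\<^bsub>L\<^esub> \<oplus>\<^bsub>L\<^esub> \<sigma> \<one>\<^bsub>k\<^esub> \<odot>\<^bsub>L\<^esub> y" using y by simp
  have yW': "y \<in> W'" using W'I[OF L.submodule_zero[OF W] k.one_closed] y_eq by simp
  have pry: "pr y = (\<zero>\<^bsub>L\<^esub>, \<one>\<^bsub>k\<^esub>)" using pr[OF L.submodule_zero[OF W] k.one_closed] y_eq by simp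
  have W'L: "W' \<subseteq> carrier L"
  proof
    fix v assume "v \<in> W'"
    then obtain w a where "w \<in> W" "a \<in> carrier k" "v = w \<oplus>\<^bsub>L\<^esub> \<sigma> a \<odot>\<^bsub>L\<^esub> y" using W'E by blast
    then show "v \<in> carrier L" using sub y \<sigma>_closed by simp
  qed
  have smult: "r \<odot>\<^bsub>L\<^esub> v \<in> W'" if r: "r \<in> carrier A" and v: "v \<in> W'" for r v
  proof -
    obtain w a where wa: "w \<in> W" "a \<in> carrier k" "v = w \<oplus>\<^bsub>L\<^esub> \<sigma> a \<odot>\<^bsub>L\<^esub> y" using v W'E by blast
    have ra: "r \<otimes>\<^bsub>A\<^esub> \<sigma> a \<in> carrier A" using r wa \<sigma>_closed by simp
    \<comment> \<open>The scalar part \<open>b\<close> of \<open>r \<otimes> \<sigma> a\<close> is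
      the new coefficient of \<open>y\<close>; the remainder \<open>n\<close> in
      \<open>\<mm>\<close> is absorbed by \<open>W\<close>.\<close>
    define b where "b = \<rho> (r \<otimes>\<^bsub>A\<^esub> \<sigma> a)"
    define n where "n = r \<otimes>\<^bsub>A\<^esub> \<sigma> a \<ominus>\<^bsub>A\<^esub> \<sigma> b"
    have b: "b \<in> carrier k" using \<rho>_closed[OF ra] by (simp add: b_def)
    have n: "n \<in> \<mm>" unfolding n_def b_def by (rule residue_diff[OF ra])
    have nA: "n \<in> carrier A" using n local_ring_proper(2)[OF local] by blast
    have ra_eq: "r \<otimes>\<^bsub>A\<^esub> \<sigma> a = n \<oplus>\<^bsub>A\<^esub> \<sigma> b"
      using ra \<sigma>_closed[OF b] by (simp add: n_def A.minus_eq A.a_assoc A.l_neg)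
    have "r \<odot>\<^bsub>L\<^esub> v = r \<odot>\<^bsub>L\<^esub> w \<oplus>\<^bsub>L\<^esub> (r \<otimes>\<^bsub>A\<^esub> \<sigma> a) \<odot>\<^bsub>L\<^esub> y"
      unfolding wa(3) using wa(1,2) r y sub \<sigma>_closed by (simp add: L.smult_r_distr L.smult_assoc1)
    also have "\<dots> = (r \<odot>\<^bsub>L\<^esub> w \<oplus>\<^bsub>L\<^esub> n \<odot>\<^bsub>L\<^esub> y) \<oplus>\<^bsub>L\<^esub> \<sigma> b \<odot>\<^bsub>L\<^esub> y"
      unfolding ra_eq using wa(1) r y sub nA \<sigma>_closed[OF b] by (simp add: L.smult_l_distr L.M.a_assoc)
    also have "\<dots> \<in> W'"
      by (rule W'I[OF Wc(3)[OF Wc(2)[OF r wa(1)] my[OF n]] b])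
    finally show ?thesis .
  qed
  have W': "submodule W' A L"
  proof (rule L.submoduleI[OF W'L WW'[OF L.submodule_zero[OF W]] _ _ smult])
    show "u \<oplus>\<^bsub>L\<^esub> v \<in> W'" if u: "u \<in> W'" and v: "v \<in> W'" for u v
    proof -
      obtain w a where wa: "w \<in> W" "a \<in> carrier k" "u = w \<oplus>\<^bsub>L\<^esub> \<sigma> a \<odot>\<^bsub>L\<^esub> y" using u W'E by blast
      obtain w' a' where wa': "w' \<in> W" "a' \<in> carrier k" "v = w' \<oplus>\<^bsub>L\<^esub> \<sigma> a' \<odot>\<^bsub>L\<^esub> y" using v W'E by blast
      show ?thesis unfolding wa(3) wa'(3) add[OF wa(1) wa'(1) wa(2) wa'(2)]
        by (rule W'I[OF Wc(3)[OF wa(1) wa'(1)] k.a_closed[OF wa(2) wa'(2)]])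
    qed
    show "\<ominus>\<^bsub>L\<^esub> v \<in> W'" if v: "v \<in> W'" for v
    proof -
      have "\<ominus>\<^bsub>L\<^esub> v = (\<ominus>\<^bsub>A\<^esub> \<one>\<^bsub>A\<^esub>) \<odot>\<^bsub>L\<^esub> v" using v W'L by (auto simp: L.smult_l_minus)
      then show ?thesis using smult[OF _ v, of "\<ominus>\<^bsub>A\<^esub> \<one>\<^bsub>A\<^esub>"] by simp
    qed
  qed
  let ?e = "e(l := y)" and ?c = "\<lambda>j v. if j = l then snd (pr v) else c j (fst (pr v))"
  have "basis_of L W' ?e ?c (Suc l)"
  proof (rule basis_ofI)
    show "?e j \<in> W'" if "j < Suc l" for j using that bD(1) WW' yW' by (cases "j = l") auto
  next
    fix j v assume j: "j < Suc l" and v: "v \<in> W'"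
    obtain w a where wa: "w \<in> W" "a \<in> carrier k" "v = w \<oplus>\<^bsub>L\<^esub> \<sigma> a \<odot>\<^bsub>L\<^esub> y" using v W'E by blast
    show "?c j v \<in> carrier k" unfolding wa(3) pr[OF wa(1,2)] using wa j bD(2) by auto
    show "?c j (\<sigma> b \<odot>\<^bsub>L\<^esub> v) = b \<otimes>\<^bsub>k\<^esub> ?c j v" if b: "b \<in> carrier k" for b
      unfolding wa(3) scal[OF wa(1,2) b] pr[OF wa(1,2)]
        pr[OF Wc(2)[OF \<sigma>_closed[OF b] wa(1)] k.m_closed[OF b wa(2)]]
      using bD(4)[OF _ b wa(1)] j by auto
    show "?c j (v \<oplus>\<^bsub>L\<^esub> v') = ?c j v \<oplus>\<^bsub>k\<^esub> ?c j v'" if v': "v' \<in> W'" for v'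
    proof -
      obtain w' a' where wa': "w' \<in> W" "a' \<in> carrier k" "v' = w' \<oplus>\<^bsub>L\<^esub> \<sigma> a' \<odot>\<^bsub>L\<^esub> y" using v' W'E by blast
      show ?thesis unfolding wa(3) wa'(3) add[OF wa(1) wa'(1) wa(2) wa'(2)] pr[OF wa(1,2)] pr[OF wa'(1,2)]
          pr[OF Wc(3)[OF wa(1) wa'(1)] k.a_closed[OF wa(2) wa'(2)]]
        using bD(3)[OF _ wa(1) wa'(1)] j by auto
    qed
  next
    fix i j assume ij: "i < Suc l" "j < Suc l"
    have c0: "c i \<zero>\<^bsub>L\<^esub> = \<zero>\<^bsub>k\<^esub>" if "i < l" for i
    proof -
      have z: "\<zero>\<^bsub>L\<^esub> \<in> W" by (rule L.submodule_zero[OF W])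
      have "c i \<zero>\<^bsub>L\<^esub> \<oplus>\<^bsub>k\<^esub> c i \<zero>\<^bsub>L\<^esub> = c i \<zero>\<^bsub>L\<^esub>" using bD(3)[OF that z z] by simp
      then show ?thesis using bD(2)[OF that z] by simp
    qed
    show "?c i (?e j) = (if i = j then \<one>\<^bsub>k\<^esub> else \<zero>\<^bsub>k\<^esub>)"
    proof (cases "j = l")
      case True
      then show ?thesis using ij c0 by (simp add: pry)
    next
      case False
      then have j: "j < l" using ij by simp
      then show ?thesis using ij bD(5) False by (auto simp: prW[OF bD(1)[OF j]])
    qed
  next
    fix v assume v: "v \<in> W'"
    obtain w a where wa: "w \<in> W" "a \<in> carrier k" "v = w \<oplus>\<^bsub>L\<^esub> \<sigma> a \<odot>\<^bsub>L\<^esub> y" using v W'E by blast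
    have eL: "e j \<in> carrier L" if "j < l" for j using sub[OF bD(1)[OF that]] .
    have ck: "\<sigma> (c j w) \<in> carrier A" if "j < l" for j using \<sigma>_closed[OF bD(2)[OF that wa(1)]] .
    have pv: "pr v = (w, a)" unfolding wa(3) by (rule pr[OF wa(1,2)])
    have "finsum L (\<lambda>j. \<sigma> (?c j v) \<odot>\<^bsub>L\<^esub> ?e j) {..<Suc l}
        = \<sigma> a \<odot>\<^bsub>L\<^esub> y \<oplus>\<^bsub>L\<^esub> finsum L (\<lambda>j. \<sigma> (?c j v) \<odot>\<^bsub>L\<^esub> ?e j) {..<l}"
      unfolding lessThan_Suc
      by (subst L.M.finsum_insert) (use eL ck wa(1,2) y(1) \<sigma>_closed in \<open>auto simp: pv Pi_def\<close>)
    also have "finsum L (\<lambda>j. \<sigma> (?c j v) \<odot>\<^bsub>L\<^esub> ?e j) {..<l} = finsum L (\<lambda>j. \<sigma> (c j w) \<odot>\<^bsub>L\<^esub> e j) {..<l}"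
      by (rule L.M.finsum_cong') (use eL ck in \<open>auto simp: pv\<close>)
    also have "\<dots> = w" by (rule bD(6)[OF wa(1), symmetric])
    finally show "v = finsum L (\<lambda>j. \<sigma> (?c j v) \<odot>\<^bsub>L\<^esub> ?e j) {..<Suc l}"
      using wa y sub \<sigma>_closed by (simp add: L.M.a_comm)
  qed
  then show ?thesis using W' WW' yW' by blast
qed

text \<open>A maximal submodule \<open>W\<close> with a basis is everything: choosing \<open>y \<notin> W\<close> with maximal annihilator modulo
  \<open>W\<close> gives \<open>\<mm> y \<subseteq> W\<close>, because \<open>\<mm>\<close> is nil.\<close>

lemma exists_basis:
  assumes fg: "fin_gen_module A L" and ne: "carrier L \<noteq> {\<zero>\<^bsub>L\<^esub>}"
  shows "\<exists>e c l. 0 < l \<and> basis_of L (carrier L) e c l"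
proof -
  have mod: "module A L" using fg by (simp add: fin_gen_module_def)
  interpret L: module A L by (rule mod)
  let ?C = "{W. submodule W A L \<and> (\<exists>e c l. basis_of L W e c l)}"
  have "basis_of L {\<zero>\<^bsub>L\<^esub>} e c 0" for e c by (rule basis_ofI) simp_all
  then have "{\<zero>\<^bsub>L\<^esub>} \<in> ?C" using L.submodule_zero_singleton by blast
  then have neC: "?C \<noteq> {}" by (metis empty_iff)
  have "\<exists>W\<in>?C. \<forall>K\<in>?C. W \<subseteq> K \<longrightarrow> K = W"
    by (rule noetherian_module_maximal[OF fin_gen_imp_noetherian_module[OF noetherian fg] neC]) simp
  then obtain W where WC: "W \<in> ?C" and max: "\<forall>K\<in>?C. W \<subseteq> K \<longrightarrow> K = W" by (elim bexE)
  from WC obtain e c l where W: "submodule W A L" and b: "basis_of L W e c l" by blast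
  have "W = carrier L"
  proof (rule ccontr)
    assume "W \<noteq> carrier L"
    then obtain x where x: "x \<in> carrier L" "x \<notin> W" using L.submodule_subset[OF W] by blast
    let ?D = "{L.colon W {y} | y. y \<in> carrier L \<and> y \<notin> W}"
    have "L.colon W {x} \<in> ?D" using x by blast
    then have neD: "?D \<noteq> {}" by (metis empty_iff)
    have "\<exists>I\<in>?D. \<forall>J\<in>?D. I \<subseteq> J \<longrightarrow> J = I"
    proof (rule noetherian_ring_maximal[OF noetherian neD])
      fix I assume "I \<in> ?D"
      then obtain y where "y \<in> carrier L" "I = L.colon W {y}" by blast
      then show "ideal I A" using L.colon_ideal[OF W, of "{y}"] by simp
    qed
    then obtain I where ID: "I \<in> ?D" and maxI: "\<forall>J\<in>?D. I \<subseteq> J \<longrightarrow> J = I" by (elim bexE)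
    from ID obtain y where y: "y \<in> carrier L" "y \<notin> W" and I: "I = L.colon W {y}" by blast
    have "a \<odot>\<^bsub>L\<^esub> y \<in> W" if a: "a \<in> \<mm>" for a
    proof (rule ccontr)
      assume neg: "a \<odot>\<^bsub>L\<^esub> y \<notin> W"
      have aA: "a \<in> carrier A" using a local_ring_proper(2)[OF local] by blast
      have ay: "a \<odot>\<^bsub>L\<^esub> y \<in> carrier L" using aA y by simp
      have "L.colon W {a \<odot>\<^bsub>L\<^esub> y} \<in> ?D" using ay neg by blast
      moreover have "I \<subseteq> L.colon W {a \<odot>\<^bsub>L\<^esub> y}"
      proof
        fix r assume "r \<in> I"
        then have r: "r \<in> carrier A" "r \<odot>\<^bsub>L\<^esub> y \<in> W" by (simp_all add: I L.colon_def)
        have "r \<odot>\<^bsub>L\<^esub> (a \<odot>\<^bsub>L\<^esub> y) = a \<odot>\<^bsub>L\<^esub> (r \<odot>\<^bsub>L\<^esub> y)"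
          using L.smult_assoc1[OF r(1) aA y(1)] L.smult_assoc1[OF aA r(1) y(1)] A.m_comm[OF r(1) aA] by simp
        then show "r \<in> L.colon W {a \<odot>\<^bsub>L\<^esub> y}"
          using r L.submoduleE(4)[OF W aA r(2)] by (simp add: L.colon_def)
      qed
      ultimately have eq: "L.colon W {a \<odot>\<^bsub>L\<^esub> y} = I" using maxI by blast
      \<comment> \<open>\<open>a y\<close> and \<open>y\<close> have the same annihilator modulo
        \<open>W\<close>, so a power of \<open>a\<close> sending \<open>y\<close> into
        \<open>W\<close> can be lowered. Starting from a vanishing power this would reach
        \<open>y \<in> W\<close>.\<close>
      have step: "a [^]\<^bsub>A\<^esub> n \<odot>\<^bsub>L\<^esub> y \<in> W" if "a [^]\<^bsub>A\<^esub> Suc n \<odot>\<^bsub>L\<^esub> y \<in> W" for n :: nat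
      proof -
        have "a [^]\<^bsub>A\<^esub> n \<odot>\<^bsub>L\<^esub> (a \<odot>\<^bsub>L\<^esub> y) \<in> W" using that aA y by (simp add: L.smult_assoc1)
        then have "a [^]\<^bsub>A\<^esub> n \<in> I" using aA unfolding eq[symmetric] by (simp add: L.colon_def)
        then show ?thesis by (simp add: I L.colon_def)
      qed
      obtain n where n: "a [^]\<^bsub>A\<^esub> (n::nat) = \<zero>\<^bsub>A\<^esub>" using nilpotent[OF a] by blast
      have "a [^]\<^bsub>A\<^esub> n \<odot>\<^bsub>L\<^esub> y \<notin> W" for n :: nat
      proof (induction n)
        case 0 then show ?case using y by simp
      next
        case (Suc n) then show ?case using step by blast
      qed
      then show False using n y L.submodule_zero[OF W] by (metis L.smult_l_null)
    qed
    then obtain W' e' c' where "submodule W' A L" "W \<subseteq> W'" "y \<in> W'" "basis_of L W' e' c' (Suc l)"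
      using basis_extend[OF mod W b y] by blast
    then show False using max y by blast
  qed
  moreover have "0 < l"
  proof (rule ccontr)
    assume "\<not> 0 < l"
    then have "x = \<zero>\<^bsub>L\<^esub>" if "x \<in> carrier L" for x
      using basis_ofD(6)[OF b, of x] that \<open>W = carrier L\<close> by simp
    then show False using ne L.M.zero_closed by blast
  qed
  ultimately show ?thesis using b by blast
qed

end

section \<open>Tensor products with an Artinian factor\<close>

text \<open>The scalar actions \<open>sM\<close> and \<open>sN\<close> are arguments, so that one
  notion covers \<open>A\<close> and \<open>B\<close> with their own scalars as well as
  \<open>L\<close> and \<open>N\<close> with scalars restricted along the structure maps.\<close>

definition balanced_map where
  "balanced_map K M sM N sN T f \<longleftrightarrow>
     (\<forall>x\<in>carrier M. \<forall>y\<in>carrier N. f x y \<in> carrier T) \<and>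
     (\<forall>x\<in>carrier M. \<forall>x'\<in>carrier M. \<forall>y\<in>carrier N. f (x \<oplus>\<^bsub>M\<^esub> x') y = f x y \<oplus>\<^bsub>T\<^esub> f x' y) \<and>
     (\<forall>x\<in>carrier M. \<forall>y\<in>carrier N. \<forall>y'\<in>carrier N. f x (y \<oplus>\<^bsub>N\<^esub> y') = f x y \<oplus>\<^bsub>T\<^esub> f x y') \<and>
     (\<forall>c\<in>K. \<forall>x\<in>carrier M. \<forall>y\<in>carrier N. f (sM c x) y = f x (sN c y))"

text \<open>The second half says, as an induction principle, that \<open>T\<close> is generated
  under addition by zero and the values of \<open>t\<close>. Together with \<open>lifts_to\<close>
  this replaces the concrete construction of the tensor product.\<close>

definition tensor_map where
  "tensor_map K M sM N sN T t \<longleftrightarrow> balanced_map K M sM N sN T t \<and>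
     (\<forall>P. P \<zero>\<^bsub>T\<^esub> \<longrightarrow> (\<forall>x\<in>carrier M. \<forall>y\<in>carrier N. P (t x y)) \<longrightarrow>
       (\<forall>u\<in>carrier T. \<forall>v\<in>carrier T. P u \<longrightarrow> P v \<longrightarrow> P (u \<oplus>\<^bsub>T\<^esub> v)) \<longrightarrow> (\<forall>u\<in>carrier T. P u))"

text \<open>The universal property for the single target \<open>Z\<close>; a locale cannot quantify over the type of the target.\<close>

definition lifts_to where
  "lifts_to K M sM N sN T t Z \<longleftrightarrow> (\<forall>f. balanced_map K M sM N sN Z f \<longrightarrow>
     (\<exists>h. (\<forall>u\<in>carrier T. h u \<in> carrier Z) \<and>
       (\<forall>u\<in>carrier T. \<forall>v\<in>carrier T. h (u \<oplus>\<^bsub>T\<^esub> v) = h u \<oplus>\<^bsub>Z\<^esub> h v) \<and>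
       (\<forall>x\<in>carrier M. \<forall>y\<in>carrier N. h (t x y) = f x y)))"

lemma balanced_mapI:
  assumes "\<And>x y. x \<in> carrier M \<Longrightarrow> y \<in> carrier N \<Longrightarrow> f x y \<in> carrier T"
    and "\<And>x x' y. x \<in> carrier M \<Longrightarrow> x' \<in> carrier M \<Longrightarrow> y \<in> carrier N \<Longrightarrow>
      f (x \<oplus>\<^bsub>M\<^esub> x') y = f x y \<oplus>\<^bsub>T\<^esub> f x' y"
    and "\<And>x y y'. x \<in> carrier M \<Longrightarrow> y \<in> carrier N \<Longrightarrow> y' \<in> carrier N \<Longrightarrow>
      f x (y \<oplus>\<^bsub>N\<^esub> y') = f x y \<oplus>\<^bsub>T\<^esub> f x y'"
    and "\<And>c x y. c \<in> K \<Longrightarrow> x \<in> carrier M \<Longrightarrow> y \<in> carrier N \<Longrightarrow> f (sM c x) y = f x (sN c y)"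
  shows "balanced_map K M sM N sN T f"
  unfolding balanced_map_def using assms by simp

lemma balanced_mapD:
  assumes "balanced_map K M sM N sN T f"
  shows "\<And>x y. x \<in> carrier M \<Longrightarrow> y \<in> carrier N \<Longrightarrow> f x y \<in> carrier T"
    and "\<And>x x' y. x \<in> carrier M \<Longrightarrow> x' \<in> carrier M \<Longrightarrow> y \<in> carrier N \<Longrightarrow>
      f (x \<oplus>\<^bsub>M\<^esub> x') y = f x y \<oplus>\<^bsub>T\<^esub> f x' y"
    and "\<And>x y y'. x \<in> carrier M \<Longrightarrow> y \<in> carrier N \<Longrightarrow> y' \<in> carrier N \<Longrightarrow>
      f x (y \<oplus>\<^bsub>N\<^esub> y') = f x y \<oplus>\<^bsub>T\<^esub> f x y'"
    and "\<And>c x y. c \<in> K \<Longrightarrow> x \<in> carrier M \<Longrightarrow> y \<in> carrier N \<Longrightarrow> f (sM c x) y = f x (sN c y)"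
  using assms unfolding balanced_map_def by simp_all

lemma balanced_map_flip:
  assumes "balanced_map K M sM N sN T f"
  shows "balanced_map K N sN M sM T (\<lambda>y x. f x y)"
  by (rule balanced_mapI) (simp_all add: balanced_mapD[OF assms])

lemma tensor_map_induct:
  assumes "tensor_map K M sM N sN T t" "u \<in> carrier T" "P \<zero>\<^bsub>T\<^esub>"
    and "\<And>x y. x \<in> carrier M \<Longrightarrow> y \<in> carrier N \<Longrightarrow> P (t x y)"
    and "\<And>u v. u \<in> carrier T \<Longrightarrow> v \<in> carrier T \<Longrightarrow> P u \<Longrightarrow> P v \<Longrightarrow> P (u \<oplus>\<^bsub>T\<^esub> v)"
  shows "P u"
proof -
  have "P \<zero>\<^bsub>T\<^esub> \<longrightarrow> (\<forall>x\<in>carrier M. \<forall>y\<in>carrier N. P (t x y)) \<longrightarrow>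
       (\<forall>u\<in>carrier T. \<forall>v\<in>carrier T. P u \<longrightarrow> P v \<longrightarrow> P (u \<oplus>\<^bsub>T\<^esub> v)) \<longrightarrow> (\<forall>u\<in>carrier T. P u)"
    using assms(1) unfolding tensor_map_def by (elim conjE allE)
  then show ?thesis using assms(2-) by simp
qed

lemma tensor_mapI:
  assumes "balanced_map K M sM N sN T t"
    and "\<And>P u. u \<in> carrier T \<Longrightarrow> P \<zero>\<^bsub>T\<^esub> \<Longrightarrow>
      (\<And>x y. x \<in> carrier M \<Longrightarrow> y \<in> carrier N \<Longrightarrow> P (t x y)) \<Longrightarrow>
      (\<And>u v. u \<in> carrier T \<Longrightarrow> v \<in> carrier T \<Longrightarrow> P u \<Longrightarrow> P v \<Longrightarrow> P (u \<oplus>\<^bsub>T\<^esub> v)) \<Longrightarrow> P u"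
  shows "tensor_map K M sM N sN T t"
  unfolding tensor_map_def
proof (intro conjI allI impI ballI)
  show "balanced_map K M sM N sN T t" by (rule assms(1))
  fix P u
  assume "P \<zero>\<^bsub>T\<^esub>" "\<forall>x\<in>carrier M. \<forall>y\<in>carrier N. P (t x y)"
    "\<forall>u\<in>carrier T. \<forall>v\<in>carrier T. P u \<longrightarrow> P v \<longrightarrow> P (u \<oplus>\<^bsub>T\<^esub> v)" "u \<in> carrier T"
  then show "P u" by (intro assms(2)[of u P]) simp_all
qed

lemma tensor_map_balanced: "tensor_map K M sM N sN T t \<Longrightarrow> balanced_map K M sM N sN T t"
  by (simp add: tensor_map_def)

lemma tensor_map_flip:
  assumes "tensor_map K M sM N sN T t"
  shows "tensor_map K N sN M sM T (\<lambda>y x. t x y)"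
proof (rule tensor_mapI[OF balanced_map_flip[OF tensor_map_balanced[OF assms]]])
  fix P u
  assume *: "u \<in> carrier T" "P \<zero>\<^bsub>T\<^esub>" "\<And>y x. y \<in> carrier N \<Longrightarrow> x \<in> carrier M \<Longrightarrow> P (t x y)"
    "\<And>u v. u \<in> carrier T \<Longrightarrow> v \<in> carrier T \<Longrightarrow> P u \<Longrightarrow> P v \<Longrightarrow> P (u \<oplus>\<^bsub>T\<^esub> v)"
  show "P u" by (rule tensor_map_induct[OF assms, where P = P]) (use * in simp_all)
qed

lemma lifts_toE:
  assumes "lifts_to K M sM N sN T t Z" "balanced_map K M sM N sN Z f"
  obtains h where "\<And>u. u \<in> carrier T \<Longrightarrow> h u \<in> carrier Z"
    "\<And>u v. u \<in> carrier T \<Longrightarrow> v \<in> carrier T \<Longrightarrow> h (u \<oplus>\<^bsub>T\<^esub> v) = h u \<oplus>\<^bsub>Z\<^esub> h v"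
    "\<And>x y. x \<in> carrier M \<Longrightarrow> y \<in> carrier N \<Longrightarrow> h (t x y) = f x y"
  using assms unfolding lifts_to_def by metis

lemma lifts_to_flip:
  assumes "lifts_to K M sM N sN T t Z"
  shows "lifts_to K N sN M sM T (\<lambda>y x. t x y) Z"
  unfolding lifts_to_def
proof (intro allI impI)
  fix f assume "balanced_map K N sN M sM Z f"
  from lifts_toE[OF assms balanced_map_flip[OF this]] obtain h where
    "\<And>u. u \<in> carrier T \<Longrightarrow> h u \<in> carrier Z"
    "\<And>u v. u \<in> carrier T \<Longrightarrow> v \<in> carrier T \<Longrightarrow> h (u \<oplus>\<^bsub>T\<^esub> v) = h u \<oplus>\<^bsub>Z\<^esub> h v"
    "\<And>x y. x \<in> carrier M \<Longrightarrow> y \<in> carrier N \<Longrightarrow> h (t x y) = f y x" by metis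
  then show "\<exists>h. (\<forall>u\<in>carrier T. h u \<in> carrier Z) \<and>
       (\<forall>u\<in>carrier T. \<forall>v\<in>carrier T. h (u \<oplus>\<^bsub>T\<^esub> v) = h u \<oplus>\<^bsub>Z\<^esub> h v) \<and>
       (\<forall>x\<in>carrier N. \<forall>y\<in>carrier M. h (t y x) = f x y)"
    by (intro exI[of _ h]) simp
qed

lemma additive_zero:
  assumes "abelian_group G" "abelian_group H" "h \<zero>\<^bsub>G\<^esub> \<in> carrier H"
    and "h (\<zero>\<^bsub>G\<^esub> \<oplus>\<^bsub>G\<^esub> \<zero>\<^bsub>G\<^esub>) = h \<zero>\<^bsub>G\<^esub> \<oplus>\<^bsub>H\<^esub> h \<zero>\<^bsub>G\<^esub>"
  shows "h \<zero>\<^bsub>G\<^esub> = \<zero>\<^bsub>H\<^esub>"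
proof -
  interpret G: abelian_group G by fact
  interpret H: abelian_group H by fact
  show ?thesis using assms(3,4) by simp
qed

text \<open>The workhorse for identities in tensor products: both sides are additive in each
  argument, so agreement on pure tensors is enough.\<close>

lemma tensor_map_ext:
  assumes t: "tensor_map K M sM N sN T t" and T: "abelian_group T" and Z: "abelian_group Z"
    and h: "\<And>u. u \<in> carrier T \<Longrightarrow> h u \<in> carrier Z"
      "\<And>u v. u \<in> carrier T \<Longrightarrow> v \<in> carrier T \<Longrightarrow> h (u \<oplus>\<^bsub>T\<^esub> v) = h u \<oplus>\<^bsub>Z\<^esub> h v"
    and h': "\<And>u. u \<in> carrier T \<Longrightarrow> h' u \<in> carrier Z"
      "\<And>u v. u \<in> carrier T \<Longrightarrow> v \<in> carrier T \<Longrightarrow> h' (u \<oplus>\<^bsub>T\<^esub> v) = h' u \<oplus>\<^bsub>Z\<^esub> h' v"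
    and eq: "\<And>x y. x \<in> carrier M \<Longrightarrow> y \<in> carrier N \<Longrightarrow> h (t x y) = h' (t x y)"
    and u: "u \<in> carrier T"
  shows "h u = h' u"
proof (rule tensor_map_induct[OF t u])
  have z: "\<zero>\<^bsub>T\<^esub> \<in> carrier T" by (rule abelian_groupE(2)[OF T])
  show "h \<zero>\<^bsub>T\<^esub> = h' \<zero>\<^bsub>T\<^esub>"
    using additive_zero[OF T Z h(1)[OF z] h(2)[OF z z]] additive_zero[OF T Z h'(1)[OF z] h'(2)[OF z z]] by simp
qed (simp_all add: eq h h')

text \<open>The assumptions are symmetric in the two factors, so exchanging them needs no
  isomorphism between \<open>A \<otimes> B\<close> and \<open>B \<otimes> A\<close>. Lifts into
  \<open>B\<close> and \<open>N\<close> serve the case where \<open>A\<close> is algebraic, those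
  into \<open>A\<close> and \<open>L\<close> the exchanged case.\<close>

locale tensor_pair =
  fixes k (structure) and A (structure) and \<mm> and B (structure) and \<nn> and L (structure) and N (structure)
    and S (structure) and M (structure) and tS and tM
  assumes A: "residue_algebra k A \<mm>" and B: "residue_algebra k B \<nn>"
    and L: "module A L" and N: "module B N" and S: "cring S" and M: "module S M"
    and noetherian_S: "noetherian_ring S"
    and tS: "tensor_map (carrier k) A (smult A) B (smult B) S tS"
    and tM: "tensor_map (carrier k) L (\<lambda>c x. structure_map A c \<odot>\<^bsub>L\<^esub> x) N (\<lambda>c y. structure_map B c \<odot>\<^bsub>N\<^esub> y) M tM"
    and lift_SA: "lifts_to (carrier k) A (smult A) B (smult B) S tS A"
    and lift_SB: "lifts_to (carrier k) A (smult A) B (smult B) S tS B"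
    and lift_ML: "lifts_to (carrier k) L (\<lambda>c x. structure_map A c \<odot>\<^bsub>L\<^esub> x) N (\<lambda>c y. structure_map B c \<odot>\<^bsub>N\<^esub> y) M tM L"
    and lift_MN: "lifts_to (carrier k) L (\<lambda>c x. structure_map A c \<odot>\<^bsub>L\<^esub> x) N (\<lambda>c y. structure_map B c \<odot>\<^bsub>N\<^esub> y) M tM N"
    and tS_one: "tS \<one>\<^bsub>A\<^esub> \<one>\<^bsub>B\<^esub> = \<one>\<^bsub>S\<^esub>"
    and tS_mult: "\<lbrakk>a \<in> carrier A; a' \<in> carrier A; b \<in> carrier B; b' \<in> carrier B\<rbrakk> \<Longrightarrow>
      tS a b \<otimes>\<^bsub>S\<^esub> tS a' b' = tS (a \<otimes>\<^bsub>A\<^esub> a') (b \<otimes>\<^bsub>B\<^esub> b')"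
    and tS_smult: "\<lbrakk>a \<in> carrier A; b \<in> carrier B; x \<in> carrier L; y \<in> carrier N\<rbrakk> \<Longrightarrow>
      tS a b \<odot>\<^bsub>M\<^esub> tM x y = tM (a \<odot>\<^bsub>L\<^esub> x) (b \<odot>\<^bsub>N\<^esub> y)"

lemma tensor_pair_flip:
  assumes "tensor_pair k A \<mm> B \<nn> L N S M tS tM"
  shows "tensor_pair k B \<nn> A \<mm> N L S M (\<lambda>b a. tS a b) (\<lambda>y x. tM x y)"
proof -
  interpret tensor_pair k A \<mm> B \<nn> L N S M tS tM by fact
  show ?thesis
    by (intro tensor_pair.intro A B L N S M noetherian_S tensor_map_flip[OF tS] tensor_map_flip[OF tM]
        lifts_to_flip[OF lift_SA] lifts_to_flip[OF lift_SB] lifts_to_flip[OF lift_ML] lifts_to_flip[OF lift_MN])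
      (simp_all add: tS_one tS_mult tS_smult)
qed

context tensor_pair
begin

theorem sequentially_cohen_macaulay_iff_if_artinian:
  assumes artin: "artinian_algebra k A \<mm>"
    and fgL: "fin_gen_module A L" and neL: "carrier L \<noteq> {\<zero>\<^bsub>L\<^esub>}" and fgN: "fin_gen_module B N"
  shows "sequentially_cohen_macaulay S M \<longleftrightarrow> sequentially_cohen_macaulay B N"
proof -
  interpret a: artinian_algebra k A \<mm> by (rule artin)
  interpret b: residue_algebra k B \<nn> by (rule B)
  interpret L: module A L by (rule L)
  interpret N: module B N by (rule N)
  interpret S: cring S by (rule S)
  interpret M: module S M by (rule M)
  let ?\<sigma> = "structure_map A" and ?\<tau> = "structure_map B"
  note bS = balanced_mapD[OF tensor_map_balanced[OF tS]]
  note bM = balanced_mapD[OF tensor_map_balanced[OF tM]]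
  have nS: "abelian_group S" and nB: "abelian_group B" and nM: "abelian_group M" and nN: "abelian_group N"
    by (rule S.abelian_group_axioms b.A.abelian_group_axioms M.abelian_group_axioms N.abelian_group_axioms)+
  obtain e c l where l: "0 < l" and basis: "a.basis_of L (carrier L) e c l"
    using a.exists_basis[OF fgL neL] by blast
  note bas = a.basis_ofD[OF basis]
  \<comment> \<open>\<open>\<phi>\<close> is \<open>b \<mapsto> 1 \<otimes> b\<close>; its
    retraction \<open>\<psi>\<close> will be \<open>a \<otimes> b \<mapsto> \<rho> a b\<close>,
    reduction of the first factor modulo \<open>\<mm>\<close>.\<close>
  define \<phi> where "\<phi> b = tS \<one>\<^bsub>A\<^esub> b" for b
  have one: "\<one>\<^bsub>A\<^esub> \<in> carrier A" by simp
  have \<phi>_cl: "\<phi> b \<in> carrier S" if "b \<in> carrier B" for b using bS(1)[OF one that] by (simp add: \<phi>_def)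
  have \<phi>: "\<phi> \<in> ring_hom B S"
    by (rule ring_hom_memI) (simp_all add: \<phi>_def tS_one bS tS_mult)
  have "balanced_map (carrier k) A (smult A) B (smult B) B (\<lambda>a b. a.\<rho> a \<odot>\<^bsub>B\<^esub> b)"
  proof (rule balanced_mapI)
    fix r x y assume r: "r \<in> carrier k" and x: "x \<in> carrier A" and y: "y \<in> carrier B"
    show "a.\<rho> (r \<odot>\<^bsub>A\<^esub> x) \<odot>\<^bsub>B\<^esub> y = a.\<rho> x \<odot>\<^bsub>B\<^esub> (r \<odot>\<^bsub>B\<^esub> y)"
      using r x y a.\<rho>_closed[OF x] a.k.m_comm[OF r a.\<rho>_closed[OF x]]
      by (simp add: a.\<rho>_smult b.A.smult_assoc1[symmetric])
  qed (simp_all add: a.\<rho>_closed ring_hom_add[OF a.\<rho>_hom] b.A.smult_l_distr b.A.smult_r_distr)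
  from lifts_toE[OF lift_SB this] obtain \<psi> where \<psi>_cl: "\<And>u. u \<in> carrier S \<Longrightarrow> \<psi> u \<in> carrier B"
    and \<psi>_add: "\<And>u v. u \<in> carrier S \<Longrightarrow> v \<in> carrier S \<Longrightarrow> \<psi> (u \<oplus>\<^bsub>S\<^esub> v) = \<psi> u \<oplus>\<^bsub>B\<^esub> \<psi> v"
    and \<psi>_pure: "\<And>x y. x \<in> carrier A \<Longrightarrow> y \<in> carrier B \<Longrightarrow> \<psi> (tS x y) = a.\<rho> x \<odot>\<^bsub>B\<^esub> y"
    by metis
  have \<psi>\<phi>: "\<psi> (\<phi> b) = b" if "b \<in> carrier B" for b
    using that by (simp add: \<phi>_def \<psi>_pure ring_hom_one[OF a.\<rho>_hom])
  have \<psi>_mult_pure: "\<psi> (tS x y \<otimes>\<^bsub>S\<^esub> tS x' y') = \<psi> (tS x y) \<otimes>\<^bsub>B\<^esub> \<psi> (tS x' y')"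
    if c: "x \<in> carrier A" "x' \<in> carrier A" "y \<in> carrier B" "y' \<in> carrier B" for x x' y y'
  proof -
    have r: "a.\<rho> x \<in> carrier k" "a.\<rho> x' \<in> carrier k" using c a.\<rho>_closed by auto
    have "\<psi> (tS x y \<otimes>\<^bsub>S\<^esub> tS x' y') = (a.\<rho> x \<otimes>\<^bsub>k\<^esub> a.\<rho> x') \<odot>\<^bsub>B\<^esub> (y \<otimes>\<^bsub>B\<^esub> y')"
      using c by (simp add: tS_mult \<psi>_pure ring_hom_mult[OF a.\<rho>_hom])
    also have "\<dots> = (a.\<rho> x \<odot>\<^bsub>B\<^esub> y) \<otimes>\<^bsub>B\<^esub> (a.\<rho> x' \<odot>\<^bsub>B\<^esub> y')"
      using c r ring_hom_mult[OF b.\<sigma>_hom r] b.\<sigma>_closed[OF r(1)] b.\<sigma>_closed[OF r(2)]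
      by (simp add: b.\<sigma>_smult b.A.m_ac)
    finally show ?thesis using c by (simp add: \<psi>_pure)
  qed
  have \<psi>_mult: "\<psi> (u \<otimes>\<^bsub>S\<^esub> v) = \<psi> u \<otimes>\<^bsub>B\<^esub> \<psi> v" if u: "u \<in> carrier S" and v: "v \<in> carrier S" for u v
  proof -
    have "\<psi> (u \<otimes>\<^bsub>S\<^esub> tS x y) = \<psi> u \<otimes>\<^bsub>B\<^esub> \<psi> (tS x y)" if c: "x \<in> carrier A" "y \<in> carrier B" for x y
      by (rule tensor_map_ext[OF tS nS nB _ _ _ _ _ u, where h = "\<lambda>u. \<psi> (u \<otimes>\<^bsub>S\<^esub> tS x y)"
            and h' = "\<lambda>u. \<psi> u \<otimes>\<^bsub>B\<^esub> \<psi> (tS x y)"])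
        (simp_all add: c bS(1) \<psi>_cl \<psi>_add S.l_distr b.A.l_distr \<psi>_mult_pure)
    then show ?thesis
      by (intro tensor_map_ext[OF tS nS nB _ _ _ _ _ v, where h = "\<lambda>v. \<psi> (u \<otimes>\<^bsub>S\<^esub> v)"
            and h' = "\<lambda>v. \<psi> u \<otimes>\<^bsub>B\<^esub> \<psi> v"])
        (simp_all add: u \<psi>_cl \<psi>_add S.r_distr b.A.r_distr)
  qed
  have \<psi>: "\<psi> \<in> ring_hom S B"
  proof (rule ring_hom_memI)
    show "\<psi> \<one>\<^bsub>S\<^esub> = \<one>\<^bsub>B\<^esub>"
      using \<psi>_pure[OF one b.A.one_closed] by (simp add: tS_one ring_hom_one[OF a.\<rho>_hom])
  qed (simp_all add: \<psi>_cl \<psi>_add \<psi>_mult)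
  have nil: "\<exists>n::nat. (s \<ominus>\<^bsub>S\<^esub> \<phi> (\<psi> s)) [^]\<^bsub>S\<^esub> n = \<zero>\<^bsub>S\<^esub>" if "s \<in> carrier S" for s
  proof -
    \<comment> \<open>The exponent is kept positive because the additive case goes through
      \<open>S.nilpotent_add\<close>.\<close>
    have "\<exists>n::nat. 0 < n \<and> (s \<ominus>\<^bsub>S\<^esub> \<phi> (\<psi> s)) [^]\<^bsub>S\<^esub> n = \<zero>\<^bsub>S\<^esub>"
    proof (rule tensor_map_induct[OF tS that])
      have "\<phi> (\<psi> \<zero>\<^bsub>S\<^esub>) = \<zero>\<^bsub>S\<^esub>"
        using ring_hom_zero[OF \<phi> b.A.ring_axioms S.ring_axioms] ring_hom_zero[OF \<psi> S.ring_axioms b.A.ring_axioms]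
        by simp
      then show "\<exists>n::nat. 0 < n \<and> (\<zero>\<^bsub>S\<^esub> \<ominus>\<^bsub>S\<^esub> \<phi> (\<psi> \<zero>\<^bsub>S\<^esub>)) [^]\<^bsub>S\<^esub> n = \<zero>\<^bsub>S\<^esub>"
        by (intro exI[of _ 1]) (simp add: S.minus_eq)
    next
      fix x y assume x: "x \<in> carrier A" and y: "y \<in> carrier B"
      let ?n = "x \<ominus>\<^bsub>A\<^esub> ?\<sigma> (a.\<rho> x)"
      have r: "a.\<rho> x \<in> carrier k" using a.\<rho>_closed[OF x] .
      have n: "?n \<in> \<mm>" by (rule a.residue_diff[OF x])
      have nA: "?n \<in> carrier A" using x a.\<sigma>_closed[OF r] by simp
      obtain m where m: "?n [^]\<^bsub>A\<^esub> (m::nat) = \<zero>\<^bsub>A\<^esub>" using a.nilpotent[OF n] by blast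
      \<comment> \<open>The scalar \<open>\<rho> x\<close> moves across the tensor sign, so the
        difference is \<open>(x - \<sigma> (\<rho> x)) \<otimes> y\<close>, whose first factor lies
        in the nil ideal \<open>\<mm>\<close>.\<close>
      have "\<phi> (\<psi> (tS x y)) = tS (?\<sigma> (a.\<rho> x)) y"
        using bS(4)[OF r one y] x y by (simp add: \<phi>_def \<psi>_pure structure_map_def)
      moreover have "tS x y = tS ?n y \<oplus>\<^bsub>S\<^esub> tS (?\<sigma> (a.\<rho> x)) y"
        using bS(2)[OF nA a.\<sigma>_closed[OF r] y] x a.\<sigma>_closed[OF r]
        by (simp add: a.A.minus_eq a.A.a_assoc a.A.l_neg)
      ultimately have diff: "tS x y \<ominus>\<^bsub>S\<^esub> \<phi> (\<psi> (tS x y)) = tS ?n y"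
        using bS(1)[OF nA y] bS(1)[OF a.\<sigma>_closed[OF r] y] by (simp add: S.minus_eq S.a_assoc S.r_neg)
      have pow: "tS ?n y [^]\<^bsub>S\<^esub> (i::nat) = tS (?n [^]\<^bsub>A\<^esub> i) (y [^]\<^bsub>B\<^esub> i)" for i
        using nA y by (induction i) (simp_all add: tS_one tS_mult)
      have yS: "y [^]\<^bsub>B\<^esub> Suc m \<in> carrier B" using y by simp
      have z: "tS \<zero>\<^bsub>A\<^esub> (y [^]\<^bsub>B\<^esub> Suc m) = \<zero>\<^bsub>S\<^esub>"
        using bS(2)[OF a.A.zero_closed a.A.zero_closed yS] bS(1)[OF a.A.zero_closed yS] by simp
      have "?n [^]\<^bsub>A\<^esub> Suc m = \<zero>\<^bsub>A\<^esub>" using m nA by simp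
      then have "tS ?n y [^]\<^bsub>S\<^esub> Suc m = \<zero>\<^bsub>S\<^esub>" unfolding pow using z by simp
      then show "\<exists>n::nat. 0 < n \<and> (tS x y \<ominus>\<^bsub>S\<^esub> \<phi> (\<psi> (tS x y))) [^]\<^bsub>S\<^esub> n = \<zero>\<^bsub>S\<^esub>"
        unfolding diff by blast
    next
      fix u v assume u: "u \<in> carrier S" and v: "v \<in> carrier S"
        and "\<exists>n::nat. 0 < n \<and> (u \<ominus>\<^bsub>S\<^esub> \<phi> (\<psi> u)) [^]\<^bsub>S\<^esub> n = \<zero>\<^bsub>S\<^esub>"
        and "\<exists>n::nat. 0 < n \<and> (v \<ominus>\<^bsub>S\<^esub> \<phi> (\<psi> v)) [^]\<^bsub>S\<^esub> n = \<zero>\<^bsub>S\<^esub>"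
      then obtain n m where nm: "0 < n" "0 < m" "(u \<ominus>\<^bsub>S\<^esub> \<phi> (\<psi> u)) [^]\<^bsub>S\<^esub> (n::nat) = \<zero>\<^bsub>S\<^esub>"
        "(v \<ominus>\<^bsub>S\<^esub> \<phi> (\<psi> v)) [^]\<^bsub>S\<^esub> (m::nat) = \<zero>\<^bsub>S\<^esub>" by blast
      have cl: "\<phi> (\<psi> u) \<in> carrier S" "\<phi> (\<psi> v) \<in> carrier S" using u v \<psi>_cl \<phi>_cl by auto
      have "\<phi> (\<psi> (u \<oplus>\<^bsub>S\<^esub> v)) = \<phi> (\<psi> u) \<oplus>\<^bsub>S\<^esub> \<phi> (\<psi> v)"
        using u v \<psi>_cl by (simp add: \<psi>_add ring_hom_add[OF \<phi>])
      then have "(u \<oplus>\<^bsub>S\<^esub> v) \<ominus>\<^bsub>S\<^esub> \<phi> (\<psi> (u \<oplus>\<^bsub>S\<^esub> v)) = (u \<ominus>\<^bsub>S\<^esub> \<phi> (\<psi> u)) \<oplus>\<^bsub>S\<^esub> (v \<ominus>\<^bsub>S\<^esub> \<phi> (\<psi> v))"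
        using u v cl by (simp add: S.minus_eq S.minus_add S.a_ac)
      then have "((u \<oplus>\<^bsub>S\<^esub> v) \<ominus>\<^bsub>S\<^esub> \<phi> (\<psi> (u \<oplus>\<^bsub>S\<^esub> v))) [^]\<^bsub>S\<^esub> (n * m) = \<zero>\<^bsub>S\<^esub>"
        using S.nilpotent_add[OF _ _ nm(3,4,2)] u v cl by simp
      then show "\<exists>n::nat. 0 < n \<and> ((u \<oplus>\<^bsub>S\<^esub> v) \<ominus>\<^bsub>S\<^esub> \<phi> (\<psi> (u \<oplus>\<^bsub>S\<^esub> v))) [^]\<^bsub>S\<^esub> n = \<zero>\<^bsub>S\<^esub>"
        using nm by (intro exI[of _ "n * m"]) simp
    qed
    then show ?thesis by blast
  qed
  \<comment> \<open>A basis of \<open>L\<close> over \<open>k\<close> splits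
    \<open>L \<otimes> N\<close> into copies of \<open>N\<close>: the injections are
    \<open>n \<mapsto> e j \<otimes> n\<close>, the projections
    \<open>x \<otimes> y \<mapsto> c j x y\<close>.\<close>
  define \<iota> where "\<iota> j n = tM (e j) n" for j n
  have \<tau>: "?\<tau> r \<in> carrier B" if "r \<in> carrier k" for r using b.\<sigma>_closed[OF that] .
  have \<tau>_add: "?\<tau> (r \<oplus>\<^bsub>k\<^esub> r') = ?\<tau> r \<oplus>\<^bsub>B\<^esub> ?\<tau> r'" if "r \<in> carrier k" "r' \<in> carrier k" for r r'
    using ring_hom_add[OF b.\<sigma>_hom that] .
  have \<tau>_mult: "?\<tau> (r \<otimes>\<^bsub>k\<^esub> r') = ?\<tau> r \<otimes>\<^bsub>B\<^esub> ?\<tau> r'" if "r \<in> carrier k" "r' \<in> carrier k" for r r'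
    using ring_hom_mult[OF b.\<sigma>_hom that] .
  have "balanced_map (carrier k) L (\<lambda>c x. ?\<sigma> c \<odot>\<^bsub>L\<^esub> x) N (\<lambda>c y. ?\<tau> c \<odot>\<^bsub>N\<^esub> y) N (\<lambda>x y. ?\<tau> (c j x) \<odot>\<^bsub>N\<^esub> y)"
    if j: "j < l" for j
  proof (rule balanced_mapI)
    fix r x y assume r: "r \<in> carrier k" and x: "x \<in> carrier L" and y: "y \<in> carrier N"
    have cx: "c j x \<in> carrier k" using bas(2)[OF j x] .
    show "?\<tau> (c j (?\<sigma> r \<odot>\<^bsub>L\<^esub> x)) \<odot>\<^bsub>N\<^esub> y = ?\<tau> (c j x) \<odot>\<^bsub>N\<^esub> (?\<tau> r \<odot>\<^bsub>N\<^esub> y)"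
      using bas(4)[OF j r x] N.smult_assoc1[OF \<tau>[OF cx] \<tau>[OF r] y] \<tau>_mult[OF cx r] a.k.m_comm[OF r cx] by simp
  qed (simp_all add: bas(2,3)[OF j] \<tau> \<tau>_add N.smult_l_distr N.smult_r_distr)
  then have "\<exists>h. (\<forall>u\<in>carrier M. h u \<in> carrier N) \<and>
      (\<forall>u\<in>carrier M. \<forall>v\<in>carrier M. h (u \<oplus>\<^bsub>M\<^esub> v) = h u \<oplus>\<^bsub>N\<^esub> h v) \<and>
      (\<forall>x\<in>carrier L. \<forall>y\<in>carrier N. h (tM x y) = ?\<tau> (c j x) \<odot>\<^bsub>N\<^esub> y)" if "j < l" for j
    using lift_MN that unfolding lifts_to_def by simp
  then obtain \<pi> where \<pi>: "\<And>j. j < l \<Longrightarrow> (\<forall>u\<in>carrier M. \<pi> j u \<in> carrier N) \<and>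
      (\<forall>u\<in>carrier M. \<forall>v\<in>carrier M. \<pi> j (u \<oplus>\<^bsub>M\<^esub> v) = \<pi> j u \<oplus>\<^bsub>N\<^esub> \<pi> j v) \<and>
      (\<forall>x\<in>carrier L. \<forall>y\<in>carrier N. \<pi> j (tM x y) = ?\<tau> (c j x) \<odot>\<^bsub>N\<^esub> y)" by metis
  have \<pi>_cl: "\<pi> j u \<in> carrier N" if "j < l" "u \<in> carrier M" for j u using \<pi> that by blast
  have \<pi>_add: "\<pi> j (u \<oplus>\<^bsub>M\<^esub> v) = \<pi> j u \<oplus>\<^bsub>N\<^esub> \<pi> j v" if "j < l" "u \<in> carrier M" "v \<in> carrier M" for j u v
    using \<pi>[OF that(1)] that(2,3) by simp
  have \<pi>_pure: "\<pi> j (tM x y) = ?\<tau> (c j x) \<odot>\<^bsub>N\<^esub> y" if "j < l" "x \<in> carrier L" "y \<in> carrier N" for j x y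
    using \<pi>[OF that(1)] that(2,3) by simp
  have \<iota>_cl: "\<iota> j n \<in> carrier M" if "j < l" "n \<in> carrier N" for j n
    using bM(1)[OF bas(1)[OF that(1)] that(2)] by (simp add: \<iota>_def)
  have \<iota>_add: "\<iota> j (n \<oplus>\<^bsub>N\<^esub> n') = \<iota> j n \<oplus>\<^bsub>M\<^esub> \<iota> j n'" if "j < l" "n \<in> carrier N" "n' \<in> carrier N" for j n n'
    using bM(3)[OF bas(1)[OF that(1)] that(2,3)] by (simp add: \<iota>_def)
  \<comment> \<open>Both sides are additive in \<open>m\<close>; on \<open>x \<otimes> y\<close> the
    identity is the basis expansion of \<open>x\<close>, with the coordinates moved across the
    tensor sign.\<close>
  have decomp_sum: "m = finsum M (\<lambda>j. \<iota> j (\<pi> j m)) {..<l}" if m: "m \<in> carrier M" for m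
  proof (rule tensor_map_ext[OF tM nM nM _ _ _ _ _ m, where h = "\<lambda>m. m"
        and h' = "\<lambda>m. finsum M (\<lambda>j. \<iota> j (\<pi> j m)) {..<l}"])
    show "finsum M (\<lambda>j. \<iota> j (\<pi> j u)) {..<l} \<in> carrier M" if "u \<in> carrier M" for u
      by (rule M.M.finsum_closed) (use that \<iota>_cl \<pi>_cl in auto)
    show "finsum M (\<lambda>j. \<iota> j (\<pi> j (u \<oplus>\<^bsub>M\<^esub> v))) {..<l} =
        finsum M (\<lambda>j. \<iota> j (\<pi> j u)) {..<l} \<oplus>\<^bsub>M\<^esub> finsum M (\<lambda>j. \<iota> j (\<pi> j v)) {..<l}"
      if uv: "u \<in> carrier M" "v \<in> carrier M" for u v
    proof -
      have "finsum M (\<lambda>j. \<iota> j (\<pi> j (u \<oplus>\<^bsub>M\<^esub> v))) {..<l} = finsum M (\<lambda>j. \<iota> j (\<pi> j u) \<oplus>\<^bsub>M\<^esub> \<iota> j (\<pi> j v)) {..<l}"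
        by (rule M.M.finsum_cong') (use uv \<iota>_cl \<pi>_cl \<iota>_add \<pi>_add in auto)
      then show ?thesis using uv \<iota>_cl \<pi>_cl by (simp add: M.M.finsum_addf Pi_def)
    qed
    show "tM x y = finsum M (\<lambda>j. \<iota> j (\<pi> j (tM x y))) {..<l}" if x: "x \<in> carrier L" and y: "y \<in> carrier N" for x y
    proof -
      have g: "\<And>j. j < l \<Longrightarrow> ?\<sigma> (c j x) \<odot>\<^bsub>L\<^esub> e j \<in> carrier L" using bas(1) bas(2)[OF _ x] a.\<sigma>_closed by simp
      have "tM x y = tM (finsum L (\<lambda>j. ?\<sigma> (c j x) \<odot>\<^bsub>L\<^esub> e j) {..<l}) y" using bas(6)[OF x] by simp
      also have "\<dots> = finsum M (\<lambda>j. tM (?\<sigma> (c j x) \<odot>\<^bsub>L\<^esub> e j) y) {..<l}"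
      proof (rule hom_finsum_lessThan[OF L.M.abelian_monoid_axioms M.M.abelian_monoid_axioms _ _ _ g, of "\<lambda>x. tM x y"])
        show "tM \<zero>\<^bsub>L\<^esub> y = \<zero>\<^bsub>M\<^esub>"
          using bM(2)[OF L.M.zero_closed L.M.zero_closed y] bM(1)[OF L.M.zero_closed y] by simp
      qed (simp_all add: bM y)
      also have "\<dots> = finsum M (\<lambda>j. \<iota> j (\<pi> j (tM x y))) {..<l}"
      proof (rule M.M.finsum_cong')
        show "(\<lambda>j. \<iota> j (\<pi> j (tM x y))) \<in> {..<l} \<rightarrow> carrier M" using \<iota>_cl \<pi>_cl bM(1)[OF x y] by auto
        show "tM (?\<sigma> (c j x) \<odot>\<^bsub>L\<^esub> e j) y = \<iota> j (\<pi> j (tM x y))" if "j \<in> {..<l}" for j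
          using that bM(4)[OF bas(2)[OF _ x] bas(1) y, of j j] by (simp add: \<iota>_def \<pi>_pure x y)
      qed simp
      finally show ?thesis .
    qed
  qed simp_all
  have \<pi>_smult: "\<pi> j (\<phi> r \<odot>\<^bsub>M\<^esub> m) = r \<odot>\<^bsub>N\<^esub> \<pi> j m" if j: "j < l" and m: "m \<in> carrier M" and r: "r \<in> carrier B" for j m r
  proof (rule tensor_map_ext[OF tM nM nN _ _ _ _ _ m, where h = "\<lambda>m. \<pi> j (\<phi> r \<odot>\<^bsub>M\<^esub> m)"
        and h' = "\<lambda>m. r \<odot>\<^bsub>N\<^esub> \<pi> j m"])
    fix x y assume x: "x \<in> carrier L" and y: "y \<in> carrier N"
    have t: "?\<tau> (c j x) \<in> carrier B" using \<tau>[OF bas(2)[OF j x]] .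
    have "\<pi> j (\<phi> r \<odot>\<^bsub>M\<^esub> tM x y) = ?\<tau> (c j x) \<odot>\<^bsub>N\<^esub> (r \<odot>\<^bsub>N\<^esub> y)"
      using x y r j by (simp add: \<phi>_def tS_smult \<pi>_pure)
    also have "\<dots> = r \<odot>\<^bsub>N\<^esub> (?\<tau> (c j x) \<odot>\<^bsub>N\<^esub> y)"
      using N.smult_assoc1[OF t r y] N.smult_assoc1[OF r t y] b.A.m_comm[OF r t] by simp
    finally show "\<pi> j (\<phi> r \<odot>\<^bsub>M\<^esub> tM x y) = r \<odot>\<^bsub>N\<^esub> \<pi> j (tM x y)" using j x y by (simp add: \<pi>_pure)
  qed (simp_all add: j r \<phi>_cl \<pi>_cl \<pi>_add M.smult_r_distr N.smult_r_distr)
  interpret nilpotent_extension B N \<nn> S M \<phi> \<psi> \<iota> \<pi> l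
  proof (intro nilpotent_extension.intro local_noetherian_module.intro local_noetherian_module_axioms.intro
      nilpotent_extension_axioms.intro N M b.noetherian b.local
      fin_gen_imp_noetherian_module[OF b.noetherian fgN] noetherian_S \<phi> \<psi> l)
    fix j n r assume j: "j < l" and n: "n \<in> carrier N" and r: "r \<in> carrier B"
    show "\<iota> j (r \<odot>\<^bsub>N\<^esub> n) = \<phi> r \<odot>\<^bsub>M\<^esub> \<iota> j n"
      using bas(1)[OF j] n r by (simp add: \<iota>_def \<phi>_def tS_smult)
  next
    fix i j n assume ij: "i < l" "j < l" and n: "n \<in> carrier N"
    show "\<pi> i (\<iota> j n) = (if i = j then n else \<zero>\<^bsub>N\<^esub>)"
      using ij n bas(1)[OF ij(2)] bas(5)[OF ij] ring_hom_one[OF b.\<sigma>_hom]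
        ring_hom_zero[OF b.\<sigma>_hom a.k.ring_axioms b.A.ring_axioms]
      by (simp add: \<iota>_def \<pi>_pure)
  next
    fix m H assume m: "m \<in> carrier M" and H: "\<zero>\<^bsub>M\<^esub> \<in> H" "\<And>a b. a \<in> H \<Longrightarrow> b \<in> H \<Longrightarrow> a \<oplus>\<^bsub>M\<^esub> b \<in> H"
      "\<And>j. j < l \<Longrightarrow> \<iota> j (\<pi> j m) \<in> H"
    have "finsum M (\<lambda>j. \<iota> j (\<pi> j m)) {..<l} \<in> H"
      by (rule M.M.finsum_mem_closed[OF H]) (use m \<iota>_cl \<pi>_cl in auto)
    then show "m \<in> H" using decomp_sum[OF m] by simp
  qed (fact \<psi>\<phi> nil \<iota>_cl \<iota>_add \<pi>_cl \<pi>_add \<pi>_smult)+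
  show ?thesis by (rule sequentially_cohen_macaulay_iff)
qed

end

section \<open>The concrete tensor product\<close>

lemma restrict_scalars_simps [simp]:
  "carrier (restrict_scalars A L) = carrier L" "zero (restrict_scalars A L) = zero L"
  "add (restrict_scalars A L) = add L"
  "smult (restrict_scalars A L) = (\<lambda>c x. structure_map A c \<odot>\<^bsub>L\<^esub> x)"
  by (simp_all add: restrict_scalars_def)

lemma restrict_scalars_module:
  assumes A: "algebra k A" and L: "module A L"
  shows "module k (restrict_scalars A L)"
proof -
  interpret A: algebra k A by fact
  interpret L: module A L by fact
  show ?thesis
  proof (rule moduleI[OF A.R_cring])
    show "abelian_group (restrict_scalars A L)"
      by (rule abelian_groupI)
        (use L.M.l_neg in \<open>auto simp: L.M.a_assoc intro: L.M.a_comm L.M.a_inv_closed\<close>)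
  qed (simp_all add: A.structure_map_closed L.smult_r_distr L.smult_l_distr L.smult_assoc1
      ring_hom_add[OF A.structure_map_hom] ring_hom_mult[OF A.structure_map_hom]
      ring_hom_one[OF A.structure_map_hom])
qed

lemma abelian_group_if_comm_group:
  assumes T: "comm_group T" and "carrier G = carrier T" "add G = monoid.mult T" "zero G = one T"
  shows "abelian_group G"
proof -
  interpret T: comm_group T by fact
  show ?thesis
    by (rule abelian_groupI) (use T.l_inv_ex in \<open>simp_all add: assms T.m_ac\<close>)
qed

context tensor_product
begin

lemma lifts_to_abelian_group:
  assumes Z: "abelian_group Z"
    and T: "carrier T = carrier tens" "add T = monoid.mult tens"
  shows "lifts_to (carrier k) M (smult M) N (smult N) T pure Z"
  unfolding lifts_to_def
proof (intro allI impI)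
  fix f assume "balanced_map (carrier k) M (smult M) N (smult N) Z f"
  note f = balanced_mapD[OF this]
  have "\<exists>h\<in>hom tens (add_monoid Z). \<forall>x\<in>carrier M. \<forall>y\<in>carrier N. h (pure x y) = f x y"
    by (rule tens_lift[OF abelian_group.a_comm_group[OF Z]]) (simp_all add: f)
  then obtain h where "h \<in> hom tens (add_monoid Z)" "\<forall>x\<in>carrier M. \<forall>y\<in>carrier N. h (pure x y) = f x y"
    by blast
  then show "\<exists>h. (\<forall>u\<in>carrier T. h u \<in> carrier Z) \<and>
       (\<forall>u\<in>carrier T. \<forall>v\<in>carrier T. h (u \<oplus>\<^bsub>T\<^esub> v) = h u \<oplus>\<^bsub>Z\<^esub> h v) \<and>
       (\<forall>x\<in>carrier M. \<forall>y\<in>carrier N. h (pure x y) = f x y)"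
    unfolding T by (intro exI[of _ h]) (auto simp: hom_def)
qed

lemma tensor_map_pure:
  assumes T: "carrier T = carrier tens" "add T = monoid.mult tens" "zero T = one tens"
  shows "tensor_map (carrier k) M (smult M) N (smult N) T pure"
proof (rule tensor_mapI)
  show "balanced_map (carrier k) M (smult M) N (smult N) T pure"
    by (rule balanced_mapI) (simp_all add: T pure_closed pure_add_left pure_add_right pure_smult)
  fix P u
  assume "u \<in> carrier T" "P \<zero>\<^bsub>T\<^esub>" "\<And>x y. x \<in> carrier M \<Longrightarrow> y \<in> carrier N \<Longrightarrow> P (pure x y)"
    "\<And>u v. u \<in> carrier T \<Longrightarrow> v \<in> carrier T \<Longrightarrow> P u \<Longrightarrow> P v \<Longrightarrow> P (u \<oplus>\<^bsub>T\<^esub> v)"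
  then show "P u" unfolding T by (rule tens_induct)
qed

end

text \<open>Well-definedness comes from the two \<open>tensor_action\<close> instances. The
  remaining laws are additive in each argument and are verified on pure tensors, one argument at a
  time.\<close>

lemma tensor_pair_tensor_algebra:
  fixes k :: "('k, 's) ring_scheme" and A :: "('k, 'a, 't) module_scheme" and B :: "('k, 'b, 'u) module_scheme"
    and L :: "('a, 'l, 'v) module_scheme" and N :: "('b, 'n, 'w) module_scheme"
  assumes resA: "residue_algebra k A \<mm>" and resB: "residue_algebra k B \<nn>"
    and modL: "module A L" and modN: "module B N"
    and noeth: "noetherian_ring (tensor_algebra k A B)"
  shows "tensor_pair k A \<mm> B \<nn> L N (tensor_algebra k A B) (tensor_module k A B L N)
    (tensor_product.pure k A B) (tensor_product.pure k (restrict_scalars A L) (restrict_scalars B N))"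
proof -
  let ?S = "tensor_algebra k A B" and ?M = "tensor_module k A B L N"
    and ?L = "restrict_scalars A L" and ?N = "restrict_scalars B N"
  interpret a: residue_algebra k A \<mm> by (rule resA)
  interpret b: residue_algebra k B \<nn> by (rule resB)
  interpret L: module A L by (rule modL)
  interpret N: module B N by (rule modN)
  interpret TS: tensor_product k A B
    by (intro tensor_product.intro a.A.module b.A.module)
  interpret TM: tensor_product k ?L ?N
    by (intro tensor_product.intro restrict_scalars_module a.alg b.alg modL modN)
  interpret actS: tensor_action k A B A B "monoid.mult A" "monoid.mult B"
  proof (intro tensor_action.intro tensor_action_axioms.intro TS.tensor_product_axioms)
    fix c x y assume "c \<in> carrier k" "x \<in> carrier A" "y \<in> carrier A"
    then show "x \<otimes>\<^bsub>A\<^esub> (c \<odot>\<^bsub>A\<^esub> y) = c \<odot>\<^bsub>A\<^esub> (x \<otimes>\<^bsub>A\<^esub> y)"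
      by (simp add: a.\<sigma>_smult a.\<sigma>_closed a.A.m_ac)
  next
    fix c x y assume "c \<in> carrier k" "x \<in> carrier B" "y \<in> carrier B"
    then show "x \<otimes>\<^bsub>B\<^esub> (c \<odot>\<^bsub>B\<^esub> y) = c \<odot>\<^bsub>B\<^esub> (x \<otimes>\<^bsub>B\<^esub> y)"
      by (simp add: b.\<sigma>_smult b.\<sigma>_closed b.A.m_ac)
  qed (simp_all add: a.A.l_distr a.A.r_distr b.A.l_distr b.A.r_distr a.A.smult_assoc2 b.A.smult_assoc2)
  interpret actM: tensor_action k A B ?L ?N "smult L" "smult N"
  proof (intro tensor_action.intro tensor_action_axioms.intro TS.tensor_product_axioms TM.tensor_product_axioms)
    fix c x y assume c: "c \<in> carrier k" and x: "x \<in> carrier A" and y: "y \<in> carrier ?L"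
    show "(c \<odot>\<^bsub>A\<^esub> x) \<odot>\<^bsub>L\<^esub> y = c \<odot>\<^bsub>?L\<^esub> (x \<odot>\<^bsub>L\<^esub> y)"
      using c x y a.\<sigma>_closed[OF c] by (simp add: a.\<sigma>_smult L.smult_assoc1)
    show "x \<odot>\<^bsub>L\<^esub> (c \<odot>\<^bsub>?L\<^esub> y) = c \<odot>\<^bsub>?L\<^esub> (x \<odot>\<^bsub>L\<^esub> y)"
      using x y L.smult_assoc1[OF x a.\<sigma>_closed[OF c], of y] L.smult_assoc1[OF a.\<sigma>_closed[OF c] x, of y]
        a.A.m_comm[OF x a.\<sigma>_closed[OF c]] by simp
  next
    fix c x y assume c: "c \<in> carrier k" and x: "x \<in> carrier B" and y: "y \<in> carrier ?N"
    show "(c \<odot>\<^bsub>B\<^esub> x) \<odot>\<^bsub>N\<^esub> y = c \<odot>\<^bsub>?N\<^esub> (x \<odot>\<^bsub>N\<^esub> y)"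
      using c x y b.\<sigma>_closed[OF c] by (simp add: b.\<sigma>_smult N.smult_assoc1)
    show "x \<odot>\<^bsub>N\<^esub> (c \<odot>\<^bsub>?N\<^esub> y) = c \<odot>\<^bsub>?N\<^esub> (x \<odot>\<^bsub>N\<^esub> y)"
      using x y N.smult_assoc1[OF x b.\<sigma>_closed[OF c], of y] N.smult_assoc1[OF b.\<sigma>_closed[OF c] x, of y]
        b.A.m_comm[OF x b.\<sigma>_closed[OF c]] by simp
  qed (simp_all add: L.smult_l_distr L.smult_r_distr N.smult_l_distr N.smult_r_distr)
  have Ss: "carrier ?S = carrier (tensor_group k A B)" "add ?S = monoid.mult (tensor_group k A B)"
    "zero ?S = one (tensor_group k A B)" and Sm: "monoid.mult ?S = actS.act" and S1: "one ?S = TS.pure \<one>\<^bsub>A\<^esub> \<one>\<^bsub>B\<^esub>"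
    by (simp_all add: tensor_algebra_def actS.act_def TS.pure_def fun_eq_iff)
  have Ms: "carrier ?M = carrier (tensor_group k ?L ?N)" "add ?M = monoid.mult (tensor_group k ?L ?N)"
    "zero ?M = one (tensor_group k ?L ?N)" and Mm: "smult ?M = actM.act"
    by (simp_all add: tensor_module_def actM.act_def Let_def fun_eq_iff)
  \<comment> \<open>\<open>noetherian_ring\<close> supplies the ring axioms of the tensor algebra;
    its commutativity is proved below.\<close>
  interpret S: noetherian_ring ?S by (rule noeth)
  have tS: "tensor_map (carrier k) A (smult A) B (smult B) ?S TS.pure"
    by (rule TS.tensor_map_pure) (rule Ss)+
  have tM: "tensor_map (carrier k) ?L (smult ?L) ?N (smult ?N) ?M TM.pure"
    by (rule TM.tensor_map_pure) (rule Ms)+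
  note pS = balanced_mapD[OF tensor_map_balanced[OF tS]] and pM = balanced_mapD[OF tensor_map_balanced[OF tM]]
  have mult_pure: "TS.pure x y \<otimes>\<^bsub>?S\<^esub> TS.pure x' y' = TS.pure (x \<otimes>\<^bsub>A\<^esub> x') (y \<otimes>\<^bsub>B\<^esub> y')"
    if "x \<in> carrier A" "x' \<in> carrier A" "y \<in> carrier B" "y' \<in> carrier B" for x x' y y'
    unfolding Sm using that by (simp add: actS.act_pure)
  have smult_pure: "TS.pure x y \<odot>\<^bsub>?M\<^esub> TM.pure u v = TM.pure (x \<odot>\<^bsub>L\<^esub> u) (y \<odot>\<^bsub>N\<^esub> v)"
    if "x \<in> carrier A" "y \<in> carrier B" "u \<in> carrier L" "v \<in> carrier N" for x y u v
    unfolding Mm using that by (simp add: actM.act_pure)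
  have nS: "abelian_group ?S" by (rule S.abelian_group_axioms)
  have nM: "abelian_group ?M" by (rule abelian_group_if_comm_group[OF TM.tens_comm Ms])
  have comm_pure: "TS.pure x y \<otimes>\<^bsub>?S\<^esub> v = v \<otimes>\<^bsub>?S\<^esub> TS.pure x y"
    if v: "v \<in> carrier ?S" and c: "x \<in> carrier A" "y \<in> carrier B" for x y v
    by (rule tensor_map_ext[OF tS nS nS _ _ _ _ _ v, where h = "\<lambda>v. TS.pure x y \<otimes>\<^bsub>?S\<^esub> v"
          and h' = "\<lambda>v. v \<otimes>\<^bsub>?S\<^esub> TS.pure x y"])
      (simp_all add: c pS(1) S.l_distr S.r_distr mult_pure a.A.m_comm b.A.m_comm)
  have comm: "u \<otimes>\<^bsub>?S\<^esub> v = v \<otimes>\<^bsub>?S\<^esub> u" if u: "u \<in> carrier ?S" and v: "v \<in> carrier ?S" for u v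
    by (rule tensor_map_ext[OF tS nS nS _ _ _ _ _ u, where h = "\<lambda>u. u \<otimes>\<^bsub>?S\<^esub> v"
          and h' = "\<lambda>u. v \<otimes>\<^bsub>?S\<^esub> u"])
      (simp_all add: v S.l_distr S.r_distr comm_pure)
  have crS: "cring ?S"
    by (intro cring.intro S.ring_axioms comm_monoid.intro S.monoid_axioms comm_monoid_axioms.intro comm)
  have cl: "u \<odot>\<^bsub>?M\<^esub> m \<in> carrier ?M" if "u \<in> carrier ?S" "m \<in> carrier ?M" for u m
    using that actM.act_mem by (simp add: Mm Ms Ss)
  have l_distr: "(u \<oplus>\<^bsub>?S\<^esub> v) \<odot>\<^bsub>?M\<^esub> m = u \<odot>\<^bsub>?M\<^esub> m \<oplus>\<^bsub>?M\<^esub> v \<odot>\<^bsub>?M\<^esub> m"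
    if "u \<in> carrier ?S" "v \<in> carrier ?S" "m \<in> carrier ?M" for u v m
    using that actM.act_add_left by (simp add: Mm Ms Ss)
  have r_distr: "u \<odot>\<^bsub>?M\<^esub> (m \<oplus>\<^bsub>?M\<^esub> m') = u \<odot>\<^bsub>?M\<^esub> m \<oplus>\<^bsub>?M\<^esub> u \<odot>\<^bsub>?M\<^esub> m'"
    if "u \<in> carrier ?S" "m \<in> carrier ?M" "m' \<in> carrier ?M" for u m m'
    using that actM.act_add_right by (simp add: Mm Ms Ss)
  \<comment> \<open>Associativity is freed from pure tensors in stages: \<open>assoc1\<close> frees
    the first ring element, \<open>assoc2\<close> the second, \<open>assoc\<close> the module
    element.\<close>
  have assoc1: "(u \<otimes>\<^bsub>?S\<^esub> TS.pure x y) \<odot>\<^bsub>?M\<^esub> TM.pure x' y' = u \<odot>\<^bsub>?M\<^esub> (TS.pure x y \<odot>\<^bsub>?M\<^esub> TM.pure x' y')"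
    if u: "u \<in> carrier ?S" and c: "x \<in> carrier A" "y \<in> carrier B" "x' \<in> carrier L" "y' \<in> carrier N"
    for u x y x' y'
    by (rule tensor_map_ext[OF tS nS nM _ _ _ _ _ u, where h = "\<lambda>u. (u \<otimes>\<^bsub>?S\<^esub> TS.pure x y) \<odot>\<^bsub>?M\<^esub> TM.pure x' y'"
          and h' = "\<lambda>u. u \<odot>\<^bsub>?M\<^esub> (TS.pure x y \<odot>\<^bsub>?M\<^esub> TM.pure x' y')"])
      (simp_all add: c pS(1) pM(1) cl S.l_distr l_distr mult_pure smult_pure L.smult_assoc1 N.smult_assoc1)
  have assoc2: "(u \<otimes>\<^bsub>?S\<^esub> v) \<odot>\<^bsub>?M\<^esub> TM.pure x' y' = u \<odot>\<^bsub>?M\<^esub> (v \<odot>\<^bsub>?M\<^esub> TM.pure x' y')"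
    if u: "u \<in> carrier ?S" and v: "v \<in> carrier ?S" and c: "x' \<in> carrier L" "y' \<in> carrier N"
    for u v x' y'
    by (rule tensor_map_ext[OF tS nS nM _ _ _ _ _ v, where h = "\<lambda>v. (u \<otimes>\<^bsub>?S\<^esub> v) \<odot>\<^bsub>?M\<^esub> TM.pure x' y'"
          and h' = "\<lambda>v. u \<odot>\<^bsub>?M\<^esub> (v \<odot>\<^bsub>?M\<^esub> TM.pure x' y')"])
      (simp_all add: c u pM(1) cl S.r_distr l_distr r_distr assoc1)
  have assoc: "(u \<otimes>\<^bsub>?S\<^esub> v) \<odot>\<^bsub>?M\<^esub> m = u \<odot>\<^bsub>?M\<^esub> (v \<odot>\<^bsub>?M\<^esub> m)"
    if u: "u \<in> carrier ?S" and v: "v \<in> carrier ?S" and m: "m \<in> carrier ?M" for u v m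
    by (rule tensor_map_ext[OF tM nM nM _ _ _ _ _ m, where h = "\<lambda>m. (u \<otimes>\<^bsub>?S\<^esub> v) \<odot>\<^bsub>?M\<^esub> m"
          and h' = "\<lambda>m. u \<odot>\<^bsub>?M\<^esub> (v \<odot>\<^bsub>?M\<^esub> m)"])
      (simp_all add: u v cl r_distr assoc2)
  have one: "\<one>\<^bsub>?S\<^esub> \<odot>\<^bsub>?M\<^esub> m = m" if m: "m \<in> carrier ?M" for m
    by (rule tensor_map_ext[OF tM nM nM _ _ _ _ _ m, where h = "\<lambda>m. \<one>\<^bsub>?S\<^esub> \<odot>\<^bsub>?M\<^esub> m" and h' = "\<lambda>m. m"])
      (simp_all add: cl r_distr, simp add: S1 smult_pure)
  have modM: "module ?S ?M"
    by (rule moduleI[OF crS nM]) (simp_all add: cl l_distr r_distr assoc one)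
  have bal: "tensor_map (carrier k) L (\<lambda>c x. structure_map A c \<odot>\<^bsub>L\<^esub> x) N (\<lambda>c y. structure_map B c \<odot>\<^bsub>N\<^esub> y) ?M TM.pure"
    using tM unfolding tensor_map_def balanced_map_def restrict_scalars_simps .
  have lift: "lifts_to (carrier k) L (\<lambda>c x. structure_map A c \<odot>\<^bsub>L\<^esub> x) N (\<lambda>c y. structure_map B c \<odot>\<^bsub>N\<^esub> y) ?M TM.pure Z"
    if "abelian_group Z" for Z :: "('z, 'q) ring_scheme"
    using TM.lifts_to_abelian_group[OF that Ms(1,2)]
    unfolding lifts_to_def balanced_map_def restrict_scalars_simps .
  show ?thesis
    by (intro tensor_pair.intro resA resB modL modN crS modM noeth tS bal
        TS.lifts_to_abelian_group[OF a.A.abelian_group_axioms Ss(1,2)]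
        TS.lifts_to_abelian_group[OF b.A.abelian_group_axioms Ss(1,2)]
        lift[OF L.abelian_group_axioms] lift[OF N.abelian_group_axioms] S1[symmetric] mult_pure smult_pure)
qed

theorem corollary4p8:
  fixes k :: "'k ring"
    and A :: "('k, 'a) module" and \<mm> :: "'a set"
    and B :: "('k, 'b) module" and \<nn> :: "'b set"
    and L :: "('a, 'l) module" and N :: "('b, 'n) module"
  assumes "algebraically_closed k"
    and "algebra k A" and "noetherian_ring A" and "local_ring A \<mm>"
    and "algebra k B" and "noetherian_ring B" and "local_ring B \<nn>"
    and "noetherian_ring (tensor_algebra k A B)"
    and "residue_field_is k A \<mm>" and "residue_field_is k B \<nn>"
    and "algebraic_algebra k A \<or> algebraic_algebra k B"
    and "fin_gen_module A L" and "carrier L \<noteq> {\<zero>\<^bsub>L\<^esub>}"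
    and "fin_gen_module B N" and "carrier N \<noteq> {\<zero>\<^bsub>N\<^esub>}"
  shows "sequentially_cohen_macaulay (tensor_algebra k A B) (tensor_module k A B L N) \<longleftrightarrow>
         sequentially_cohen_macaulay A L \<and> sequentially_cohen_macaulay B N"
proof -
  have k: "field k" using assms(1) by (rule algebraically_closed.axioms(1))
  have resA: "residue_algebra k A \<mm>" by (intro residue_algebra.intro k assms)
  have resB: "residue_algebra k B \<nn>" by (intro residue_algebra.intro k assms)
  have "module A L" "module B N" using assms(12,14) by (simp_all add: fin_gen_module_def)
  note pair = tensor_pair_tensor_algebra[OF resA resB this assms(8)]
  from assms(11) show ?thesis
  proof
    assume "algebraic_algebra k A"
    then have artin: "artinian_algebra k A \<mm>"
      by (intro artinian_algebra.intro artinian_algebra_axioms.intro resA)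
    show ?thesis
      using tensor_pair.sequentially_cohen_macaulay_iff_if_artinian[OF pair artin assms(12,13,14)]
        artinian_algebra.sequentially_cohen_macaulay_fin_gen[OF artin assms(12,13)] by blast
  next
    assume "algebraic_algebra k B"
    then have artin: "artinian_algebra k B \<nn>"
      by (intro artinian_algebra.intro artinian_algebra_axioms.intro resB)
    \<comment> \<open>Flipping the pair exchanges the factors but keeps the same ring
      \<open>A \<otimes> B\<close> and the same module \<open>L \<otimes> N\<close>.\<close>
    show ?thesis
      using tensor_pair.sequentially_cohen_macaulay_iff_if_artinian
          [OF tensor_pair_flip[OF pair] artin assms(14,15,12)]
        artinian_algebra.sequentially_cohen_macaulay_fin_gen[OF artin assms(14,15)] by blast
  qed
qed

end
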